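(* Let $(A,\Delta,\epsilon,\Phi,\mathcal R)$ be a quasi-triangular quasi-Hopf (super)algebra, let $u\in A$ be an invertible even element with $S^2(a)=uau^{-1}$ for all $a\in A$, and let $V$ be a finite-dimensional graded $A$-module. For $m\in\mathbb Z$ write $$\Phi^{-1}\big((\mathcal R^T\mathcal R)^m\otimes1\big)\Phi=\sum_ia_i\otimes b_i\otimes c_i,\qquad \Phi\big(1\otimes(\mathcal R^T\mathcal R)^m\big)\Phi^{-1}=\sum_i\bar a_i\otimes\bar b_i\otimes\bar c_i .$$ Then for every $m\in\mathbb Z$ the elements $$C_m=\sum_i\mathrm{Str}_V\big(uS^{-1}(\alpha)\,b_i\,\beta\,S(c_i)\big)\,a_i,\qquad \bar C_m=\sum_i\mathrm{Str}_V\big(u^{-1}S(\beta)S(\bar a_i)\,\alpha\,\bar b_i\big)\,\bar c_i$$ are central elements (Casimir invariants) of $A$.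
   Context: A quasi-Hopf (super)algebra $(A,\Delta,\epsilon,\Phi)$ is a unital associative $\mathbb Z_2$-graded algebra $A$ over a field $K$ (the ungraded case being $A$ concentrated in degree $0$; $[a]\in\mathbb Z_2$ is the degree of a homogeneous $a$; sign formulas are stated for homogeneous elements and extended linearly), with grading-preserving algebra homomorphisms $\epsilon:A\to K$, $\Delta:A\to A\otimes A$, an invertible homogeneous $\Phi\in A\otimes A\otimes A$, a graded algebra anti-homomorphism $S:A\to A$ (grading preserving, $S(ab)=(-1)^{[a][b]}S(b)S(a)$) and homogeneous $\alpha,\beta\in A$; $S$ is assumed bijective. Tensor products are multiplied by $(a\otimes b)(a'\otimes b')=(-1)^{[b][a']}aa'\otimes bb'$. Write $\Phi=\sum_\nu X_\nu\otimes Y_\nu\otimes Z_\nu$, $\Phi^{-1}=\sum_\nu\bar X_\nu\otimes\bar Y_\nu\otimes\bar Z_\nu$, $\Delta(a)=\sum a_{(1)}\otimes a_{(2)}$ (homogeneous components). The axioms are, for all $a\in A$: $(1\otimes\Delta)\Delta(a)=\Phi^{-1}(\Delta\otimes1)\Delta(a)\Phi$; $(\Delta\otimes1\otimes1)\Phi\cdot(1\otimes1\otimes\Delta)\Phi=(\Phi\otimes1)\cdot(1\otimes\Delta\otimes1)\Phi\cdot(1\otimes\Phi)$; $(\epsilon\otimes1)\Delta=1=(1\otimes\epsilon)\Delta$; $(1\otimes\epsilon\otimes1)\Phi=1$; $\sum S(a_{(1)})\alpha a_{(2)}=\epsilon(a)\alpha$; $\sum a_{(1)}\beta S(a_{(2)})=\epsilon(a)\beta$;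 $\sum\bar X_\nu\beta S(\bar Y_\nu)\alpha\bar Z_\nu=1$; $\sum S(X_\nu)\alpha Y_\nu\beta S(Z_\nu)=1$. These imply that $\Phi,\alpha,\beta$ are even. Let $T(a\otimes b)=(-1)^{[a][b]}b\otimes a$, $\Delta^T=T\cdot\Delta$, $\mathcal R^T=T(\mathcal R)$. $A$ is quasi-triangular if there is an invertible homogeneous $\mathcal R\in A\otimes A$ (it is then even) with $\Delta^T(a)\mathcal R=\mathcal R\Delta(a)$ for all $a\in A$, $(\Delta\otimes1)\mathcal R=\Phi^{-1}_{231}\mathcal R_{13}\Phi_{132}\mathcal R_{23}\Phi^{-1}_{123}$ and $(1\otimes\Delta)\mathcal R=\Phi_{312}\mathcal R_{13}\Phi^{-1}_{213}\mathcal R_{12}\Phi_{123}$, where $\Phi_{123}=\Phi$, $\Phi_{132}=(1\otimes T)\Phi$, $\Phi_{312}=(T\otimes1)(1\otimes T)\Phi$, $\Phi^{-1}_{213}=(T\otimes1)\Phi^{-1}$, $\Phi^{-1}_{231}=(1\otimes T)(T\otimes1)\Phi^{-1}$, and $\mathcal R_{ij}$ is $\mathcal R$ placed in tensor positions $i,j$. For $a\in A$, $\mathrm{Str}_V(a)$ is the supertrace over $V$ of the operator by which $a$ acts on $V$ (the ordinary trace in the ungraded case). Central means commuting with every element of $A$. *)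

theory Defs
  imports Complex_Main "HOL-Library.Poly_Mapping" "HOL-Library.Z2" "HOL-Algebra.Module"
begin

section \<open>Graded vector spaces and the supertrace\<close>

definition ksgn :: "bit \<Rightarrow> 'k::field" where
  "ksgn i = (if i = 1 then - 1 else 1)"

locale superspace = vector_space scale
  for scale :: "'k::field \<Rightarrow> 'v::ab_group_add \<Rightarrow> 'v" (infixr \<open>*s\<close> 75) +
  fixes gr :: "bit \<Rightarrow> 'v set"
  assumes gr_subspace: "subspace (gr i)"
    and gr_disjoint: "gr 0 \<inter> gr 1 = {0}"
    and gr_decompose: "\<exists>x\<in>gr 0. \<exists>y\<in>gr 1. v = x + y"
begin

text \<open>The homogeneous component of degree \<open>i\<close>; note \<open>i + 1\<close> is the other degree.\<close>

definition gproj :: "bit \<Rightarrow> 'v \<Rightarrow> 'v" where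
  "gproj i v = (THE x. x \<in> gr i \<and> v - x \<in> gr (i + 1))"

definition homogeneous_basis :: "'v set \<Rightarrow> bool" where
  "homogeneous_basis B \<longleftrightarrow> B \<subseteq> gr 0 \<union> gr 1 \<and> independent B \<and> span B = UNIV"

text \<open>The trace on the even part minus the trace on the odd part, computed in an arbitrary
  homogeneous basis; only meaningful for finite-dimensional spaces.\<close>

definition supertrace :: "('v \<Rightarrow> 'v) \<Rightarrow> 'k" where
  "supertrace f =
    (let B = (SOME B. homogeneous_basis B)
     in \<Sum>b\<in>B. (if b \<in> gr 0 then 1 else - 1) * representation B (f b) b)"

end

locale superalgebra = superspace scale gr
  for scale :: "'k::field \<Rightarrow> 'a::ring_1 \<Rightarrow> 'a" (infixr \<open>*s\<close> 75) and gr +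
  assumes scale_mult_left: "(c *s a) * b = c *s (a * b)"
    and scale_mult_right: "a * (c *s b) = c *s (a * b)"
    and gr_mult: "a \<in> gr i \<Longrightarrow> b \<in> gr j \<Longrightarrow> a * b \<in> gr (i + j)"

section \<open>Tensor powers of a superalgebra\<close>

text \<open>
  The \<open>n\<close>-th tensor power of \<open>A\<close> over \<open>K\<close> is the free vector space on lists of length \<open>n\<close>
  over \<open>A\<close>, modulo the subspace spanned by the multilinearity relations.  Its elements are
  cosets; operations on it are computed on representatives.
\<close>

type_synonym ('a, 'k) formal = "'a list \<Rightarrow>\<^sub>0 'k"
type_synonym ('a, 'k) tensor = "('a list \<Rightarrow>\<^sub>0 'k) set"

definition fscale :: "'k::field \<Rightarrow> ('x \<Rightarrow>\<^sub>0 'k) \<Rightarrow> ('x \<Rightarrow>\<^sub>0 'k)" where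
  "fscale c p = Poly_Mapping.map (\<lambda>x. c * x) p"

interpretation formal: vector_space "fscale :: 'k::field \<Rightarrow> ('x \<Rightarrow>\<^sub>0 'k) \<Rightarrow> _"
proof
  have l: "Poly_Mapping.lookup (fscale c p) x = c * Poly_Mapping.lookup p x"
    for c :: 'k and p :: "'x \<Rightarrow>\<^sub>0 'k" and x
    unfolding fscale_def by transfer (simp add: when_def)
  show "fscale a (x + y) = fscale a x + fscale a y" for a :: 'k and x y :: "'x \<Rightarrow>\<^sub>0 'k"
    by (rule poly_mapping_eqI) (simp add: l lookup_add algebra_simps)
  show "fscale (a + b) x = fscale a x + fscale b x" for a b :: 'k and x :: "'x \<Rightarrow>\<^sub>0 'k"
    by (rule poly_mapping_eqI) (simp add: l lookup_add algebra_simps)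
  show "fscale a (fscale b x) = fscale (a * b) x" for a b :: 'k and x :: "'x \<Rightarrow>\<^sub>0 'k"
    by (rule poly_mapping_eqI) (simp add: l)
  show "fscale 1 x = x" for x :: "'x \<Rightarrow>\<^sub>0 'k"
    by (rule poly_mapping_eqI) (simp add: l)
qed

text \<open>Linear extension of a map on generators, into the vector space with scaling \<open>s\<close>.\<close>

definition linext :: "('k::field \<Rightarrow> 'w \<Rightarrow> 'w) \<Rightarrow> ('x \<Rightarrow> 'w) \<Rightarrow> ('x \<Rightarrow>\<^sub>0 'k) \<Rightarrow> 'w::ab_group_add" where
  "linext s F p = (\<Sum>x\<in>Poly_Mapping.keys p. s (Poly_Mapping.lookup p x) (F x))"

abbreviation word :: "'a list \<Rightarrow> ('a, 'k::field) formal" where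
  "word xs \<equiv> Poly_Mapping.single xs 1"

definition formals :: "nat \<Rightarrow> ('a, 'k::field) formal set" where
  "formals n = {p. \<forall>xs\<in>Poly_Mapping.keys p. length xs = n}"

text \<open>The Koszul sign of \<open>(a\<^sub>1 \<otimes> \<dots> \<otimes> a\<^sub>n)(b\<^sub>1 \<otimes> \<dots> \<otimes> b\<^sub>n)\<close>: each \<open>b\<^sub>j\<close> passes every \<open>a\<^sub>i\<close> with \<open>i > j\<close>.\<close>

definition koszul :: "bit list \<Rightarrow> bit list \<Rightarrow> 'k::field" where
  "koszul ds es = (\<Prod>i<length ds. \<Prod>j<i. ksgn (ds ! i * es ! j))"

definition rep :: "('a, 'k::field) tensor \<Rightarrow> ('a, 'k) formal" where
  "rep X = (SOME p. p \<in> X)"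

context superalgebra
begin

definition multilinear_relations :: "nat \<Rightarrow> ('a, 'k) formal set" where
  "multilinear_relations n =
     {word (xs @ (a + b) # ys) - word (xs @ a # ys) - word (xs @ b # ys) | xs ys a b.
        length xs + length ys + 1 = n}
   \<union> {word (xs @ (c *s a) # ys) - fscale c (word (xs @ a # ys)) | xs ys c a.
        length xs + length ys + 1 = n}"

definition tensor_rel :: "nat \<Rightarrow> (('a, 'k) formal \<times> ('a, 'k) formal) set" where
  "tensor_rel n = {(p, q). p \<in> formals n \<and> q \<in> formals n
                         \<and> p - q \<in> formal.span (multilinear_relations n)}"

definition cls :: "nat \<Rightarrow> ('a, 'k) formal \<Rightarrow> ('a, 'k) tensor" where
  "cls n p = tensor_rel n `` {p}"

definition word_mult :: "nat \<Rightarrow> 'a list \<Rightarrow> 'a list \<Rightarrow> ('a, 'k) formal" where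
  "word_mult n xs ys =
    (\<Sum>ds | length ds = n. \<Sum>es | length es = n.
       fscale (koszul ds es)
         (word (map2 (*) (map2 gproj ds xs) (map2 gproj es ys))))"

text \<open>The tensor power as a graded algebra: \<open>mult\<close> is the Koszul-signed product.\<close>

definition TP :: "nat \<Rightarrow> ('k, ('a, 'k) tensor) module" where
  "TP n = \<lparr>carrier = formals n // tensor_rel n,
           mult = (\<lambda>X Y. cls n (linext fscale (\<lambda>xs. linext fscale (word_mult n xs) (rep Y)) (rep X))),
           one = cls n (word (replicate n 1)),
           zero = cls n 0,
           add = (\<lambda>X Y. cls n (rep X + rep Y)),
           smult = (\<lambda>c X. cls n (fscale c (rep X)))\<rparr>"

definition TP_gr :: "nat \<Rightarrow> bit \<Rightarrow> ('a, 'k) tensor set" where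
  "TP_gr n d = cls n ` {p. \<forall>xs\<in>Poly_Mapping.keys p. \<exists>ds. length xs = n \<and>
                             list_all2 (\<lambda>x i. x \<in> gr i) xs ds \<and> sum_list ds = d}"

text \<open>Linear maps on tensor powers induced by multilinear functions: into the tensor power of
  degree \<open>n\<close>, and into \<open>A\<close> from the tensor powers of degree 2 and 3.\<close>

definition tmap :: "nat \<Rightarrow> ('a list \<Rightarrow> ('a, 'k) formal) \<Rightarrow> ('a, 'k) tensor \<Rightarrow> ('a, 'k) tensor" where
  "tmap n F X = cls n (linext fscale F (rep X))"

definition lift2 :: "('a \<Rightarrow> 'a \<Rightarrow> 'a) \<Rightarrow> ('a, 'k) tensor \<Rightarrow> 'a" where
  "lift2 f X = linext scale (\<lambda>xs. f (xs ! 0) (xs ! 1)) (rep X)"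

definition lift3 :: "('a \<Rightarrow> 'a \<Rightarrow> 'a \<Rightarrow> 'a) \<Rightarrow> ('a, 'k) tensor \<Rightarrow> 'a" where
  "lift3 f X = linext scale (\<lambda>xs. f (xs ! 0) (xs ! 1) (xs ! 2)) (rep X)"

text \<open>In the following, \<open>n\<close> is the tensor degree of the result and positions count from 0.
  \<open>swap_at\<close> applies the graded flip to the positions \<open>i\<close>, \<open>i + 1\<close>; \<open>unit_at\<close> inserts the tensor
  factor \<open>1\<close> so that it stands at position \<open>i\<close> of the result.\<close>

definition swap_at :: "nat \<Rightarrow> nat \<Rightarrow> ('a, 'k) tensor \<Rightarrow> ('a, 'k) tensor" where
  "swap_at n i = tmap n (\<lambda>xs. \<Sum>d\<in>UNIV. \<Sum>e\<in>UNIV. fscale (ksgn (d * e))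
     (word (take i xs @ [gproj e (xs ! Suc i), gproj d (xs ! i)] @ drop (i + 2) xs)))"

definition unit_at :: "nat \<Rightarrow> nat \<Rightarrow> ('a, 'k) tensor \<Rightarrow> ('a, 'k) tensor" where
  "unit_at n i = tmap n (\<lambda>xs. word (take i xs @ [1] @ drop i xs))"

definition coproduct_at ::
  "('a \<Rightarrow> ('a, 'k) tensor) \<Rightarrow> nat \<Rightarrow> nat \<Rightarrow> ('a, 'k) tensor \<Rightarrow> ('a, 'k) tensor" where
  "coproduct_at \<Delta> n i = tmap n (\<lambda>xs.
     linext fscale (\<lambda>ys. word (take i xs @ ys @ drop (Suc i) xs)) (rep (\<Delta> (xs ! i))))"

definition counit_at ::
  "('a \<Rightarrow> 'k) \<Rightarrow> nat \<Rightarrow> nat \<Rightarrow> ('a, 'k) tensor \<Rightarrow> ('a, 'k) tensor" where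
  "counit_at \<epsilon> n i = tmap n (\<lambda>xs. fscale (\<epsilon> (xs ! i)) (word (take i xs @ drop (Suc i) xs)))"

end

section \<open>Quasi-Hopf superalgebras\<close>

locale quasi_hopf_superalgebra = superalgebra scale gr
  for scale :: "'k::field \<Rightarrow> 'a::ring_1 \<Rightarrow> 'a" (infixr \<open>*s\<close> 75) and gr +
  fixes \<Delta> :: "'a \<Rightarrow> ('a, 'k) tensor"
    and \<epsilon> :: "'a \<Rightarrow> 'k"
    and \<Phi> :: "('a, 'k) tensor"
    and S :: "'a \<Rightarrow> 'a"
    and \<alpha> \<beta> :: 'a
  assumes counit_linear: "Vector_Spaces.linear scale (*) \<epsilon>"
    and counit_mult: "\<epsilon> (a * b) = \<epsilon> a * \<epsilon> b"
    and counit_one: "\<epsilon> 1 = 1"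
    and counit_gr: "a \<in> gr 1 \<Longrightarrow> \<epsilon> a = 0"
    and coproduct_gr: "a \<in> gr i \<Longrightarrow> \<Delta> a \<in> TP_gr 2 i"
    and coproduct_closed: "\<Delta> a \<in> carrier (TP 2)"
    and coproduct_add: "\<Delta> (a + b) = \<Delta> a \<oplus>\<^bsub>TP 2\<^esub> \<Delta> b"
    and coproduct_scale: "\<Delta> (c *s a) = c \<odot>\<^bsub>TP 2\<^esub> \<Delta> a"
    and coproduct_mult: "\<Delta> (a * b) = \<Delta> a \<otimes>\<^bsub>TP 2\<^esub> \<Delta> b"
    and coproduct_one: "\<Delta> 1 = \<one>\<^bsub>TP 2\<^esub>"
    and coassociator_Units: "\<Phi> \<in> Units (TP 3)"
    and coassociator_homogeneous: "\<exists>d. \<Phi> \<in> TP_gr 3 d"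
    and antipode_linear: "Vector_Spaces.linear scale scale S"
    and antipode_gr: "a \<in> gr i \<Longrightarrow> S a \<in> gr i"
    and antipode_one: "S 1 = 1"
    and antipode_mult: "a \<in> gr i \<Longrightarrow> b \<in> gr j \<Longrightarrow> S (a * b) = ksgn (i * j) *s (S b * S a)"
    and antipode_bij: "bij S"
    and alpha_homogeneous: "\<exists>d. \<alpha> \<in> gr d"
    and beta_homogeneous: "\<exists>d. \<beta> \<in> gr d"
    and quasi_coassoc:
      "coproduct_at \<Delta> 3 1 (\<Delta> a) =
         inv\<^bsub>TP 3\<^esub> \<Phi> \<otimes>\<^bsub>TP 3\<^esub> coproduct_at \<Delta> 3 0 (\<Delta> a) \<otimes>\<^bsub>TP 3\<^esub> \<Phi>"
    and pentagon:
      "coproduct_at \<Delta> 4 0 \<Phi> \<otimes>\<^bsub>TP 4\<^esub> coproduct_at \<Delta> 4 2 \<Phi> =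
         unit_at 4 3 \<Phi> \<otimes>\<^bsub>TP 4\<^esub> coproduct_at \<Delta> 4 1 \<Phi> \<otimes>\<^bsub>TP 4\<^esub> unit_at 4 0 \<Phi>"
    and counit_left: "lift2 (\<lambda>x y. \<epsilon> x *s y) (\<Delta> a) = a"
    and counit_right: "lift2 (\<lambda>x y. \<epsilon> y *s x) (\<Delta> a) = a"
    and counit_coassociator: "counit_at \<epsilon> 2 1 \<Phi> = \<one>\<^bsub>TP 2\<^esub>"
    and antipode_alpha: "lift2 (\<lambda>x y. S x * \<alpha> * y) (\<Delta> a) = \<epsilon> a *s \<alpha>"
    and antipode_beta: "lift2 (\<lambda>x y. x * \<beta> * S y) (\<Delta> a) = \<epsilon> a *s \<beta>"
    and antipode_coassociator_inv:
      "lift3 (\<lambda>x y z. x * \<beta> * S y * \<alpha> * z) (inv\<^bsub>TP 3\<^esub> \<Phi>) = 1"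
    and antipode_coassociator:
      "lift3 (\<lambda>x y z. S x * \<alpha> * y * \<beta> * S z) \<Phi> = 1"

text \<open>
  In terms of \<open>T\<close>, positions \<open>0,1\<close> being flipped by \<open>T \<otimes> 1\<close> and \<open>1,2\<close> by \<open>1 \<otimes> T\<close>, the permuted
  coassociators are \<open>\<Phi>\<^sub>1\<^sub>3\<^sub>2 = (1 \<otimes> T)\<Phi>\<close>, \<open>\<Phi>\<^sub>3\<^sub>1\<^sub>2 = (T \<otimes> 1)(1 \<otimes> T)\<Phi>\<close>, \<open>\<Phi>\<^sup>-\<^sup>1\<^sub>2\<^sub>1\<^sub>3 = (T \<otimes> 1)\<Phi>\<^sup>-\<^sup>1\<close> and
  \<open>\<Phi>\<^sup>-\<^sup>1\<^sub>2\<^sub>3\<^sub>1 = (1 \<otimes> T)(T \<otimes> 1)\<Phi>\<^sup>-\<^sup>1\<close>.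
\<close>

locale quasi_triangular_quasi_hopf_superalgebra =
  quasi_hopf_superalgebra scale gr \<Delta> \<epsilon> \<Phi> S \<alpha> \<beta>
  for scale :: "'k::field \<Rightarrow> 'a::ring_1 \<Rightarrow> 'a" (infixr \<open>*s\<close> 75) and gr \<Delta> \<epsilon> \<Phi> S \<alpha> \<beta> +
  fixes R :: "('a, 'k) tensor"
  assumes R_Units: "R \<in> Units (TP 2)"
    and R_homogeneous: "\<exists>d. R \<in> TP_gr 2 d"
    and R_intertwines: "swap_at 2 0 (\<Delta> a) \<otimes>\<^bsub>TP 2\<^esub> R = R \<otimes>\<^bsub>TP 2\<^esub> \<Delta> a"
    and hexagon_left:
      "coproduct_at \<Delta> 3 0 R =
         swap_at 3 1 (swap_at 3 0 (inv\<^bsub>TP 3\<^esub> \<Phi>)) \<otimes>\<^bsub>TP 3\<^esub> unit_at 3 1 R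
           \<otimes>\<^bsub>TP 3\<^esub> swap_at 3 1 \<Phi> \<otimes>\<^bsub>TP 3\<^esub> unit_at 3 0 R \<otimes>\<^bsub>TP 3\<^esub> inv\<^bsub>TP 3\<^esub> \<Phi>"
    and hexagon_right:
      "coproduct_at \<Delta> 3 1 R =
         swap_at 3 0 (swap_at 3 1 \<Phi>) \<otimes>\<^bsub>TP 3\<^esub> unit_at 3 1 R
           \<otimes>\<^bsub>TP 3\<^esub> swap_at 3 0 (inv\<^bsub>TP 3\<^esub> \<Phi>) \<otimes>\<^bsub>TP 3\<^esub> unit_at 3 2 R \<otimes>\<^bsub>TP 3\<^esub> \<Phi>"

section \<open>Graded modules\<close>

locale graded_module =
  superalgebra scale gr + V: superspace scaleV grV
  for scale :: "'k::field \<Rightarrow> 'a::ring_1 \<Rightarrow> 'a" and gr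
    and scaleV :: "'k \<Rightarrow> 'v::ab_group_add \<Rightarrow> 'v" and grV +
  fixes act :: "'a \<Rightarrow> 'v \<Rightarrow> 'v"
  assumes act_linear_right: "Vector_Spaces.linear scaleV scaleV (act a)"
    and act_linear_left: "Vector_Spaces.linear scale scaleV (\<lambda>a. act a v)"
    and act_one: "act 1 v = v"
    and act_mult: "act (a * b) v = act a (act b v)"
    and act_gr: "a \<in> gr i \<Longrightarrow> v \<in> grV j \<Longrightarrow> act a v \<in> grV (i + j)"

section \<open>Casimir elements\<close>

context quasi_triangular_quasi_hopf_superalgebra
begin

definition monodromy :: "('a, 'k) tensor" where
  "monodromy = swap_at 2 0 R \<otimes>\<^bsub>TP 2\<^esub> R"

text \<open>Here \<open>str\<close> stands for \<open>a \<mapsto> Str\<^sub>V a\<close>, and \<open>u'\<close> for the inverse of \<open>u\<close>.\<close>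

definition casimir :: "('a \<Rightarrow> 'k) \<Rightarrow> 'a \<Rightarrow> int \<Rightarrow> 'a" where
  "casimir str u m =
     lift3 (\<lambda>a b c. str (u * inv_into UNIV S \<alpha> * b * \<beta> * S c) *s a)
       (inv\<^bsub>TP 3\<^esub> \<Phi> \<otimes>\<^bsub>TP 3\<^esub> unit_at 3 2 (monodromy [^]\<^bsub>TP 2\<^esub> m) \<otimes>\<^bsub>TP 3\<^esub> \<Phi>)"

definition casimir_bar :: "('a \<Rightarrow> 'k) \<Rightarrow> 'a \<Rightarrow> int \<Rightarrow> 'a" where
  "casimir_bar str u' m =
     lift3 (\<lambda>a b c. str (u' * S \<beta> * S a * \<alpha> * b) *s c)
       (\<Phi> \<otimes>\<^bsub>TP 3\<^esub> unit_at 3 0 (monodromy [^]\<^bsub>TP 2\<^esub> m) \<otimes>\<^bsub>TP 3\<^esub> inv\<^bsub>TP 3\<^esub> \<Phi>)"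

end

definition central :: "'a::ring_1 \<Rightarrow> bool" where
  "central z \<longleftrightarrow> (\<forall>a. z * a = a * z)"

end

theory Submission
  imports Defs
begin

text \<open>
  Let \<open>D = (1 \<otimes> \<Delta>)\<Delta>(a)\<close> and \<open>\<omega> = \<Phi>\<^sup>-\<^sup>1(M \<otimes> 1)\<Phi>\<close>, where \<open>M\<close> is a power of the monodromy
  \<open>R\<^sup>TR\<close>.  Two facts make \<open>C\<^sub>m\<close> central.

  First, \<open>\<omega>D = D\<omega>\<close>.  Applying the flip to \<open>\<Delta>\<^sup>T(a)R = R\<Delta>(a)\<close> shows that \<open>R\<^sup>TR\<close>, and hence \<open>M\<close>, commutes
  with every \<open>\<Delta>(a)\<close>.  Since \<open>M\<close> is even, no sign arises when a third tensor factor moves past it,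
  so \<open>M \<otimes> 1\<close> commutes with \<open>(\<Delta> \<otimes> 1)\<Delta>(a)\<close>; conjugation by \<open>\<Phi>\<close> turns the latter into \<open>D\<close>
  (\<open>monodromy_pow\<close>, \<open>coproduct_first_commutes\<close>, \<open>casimir_tensor_commutes\<close>).

  Second, let \<open>\<theta>(x \<otimes> y \<otimes> z) = Str(u S\<^sup>-\<^sup>1(\<alpha>) y \<beta> S(z)) x\<close>, so that \<open>C\<^sub>m = \<theta>(\<omega>)\<close>.  Then
  \<open>\<theta>(\<omega>D) = \<theta>(\<omega>)a\<close>, because the last two legs of \<open>D\<close> meet inside the trace as \<open>\<Sum> b\<^sub>(\<^sub>1\<^sub>) \<beta> S(b\<^sub>(\<^sub>2\<^sub>)) = \<epsilon>(b)\<beta>\<close>.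
  And \<open>\<theta>(D\<omega>) = a\<theta>(\<omega>)\<close>: cyclicity moves \<open>S(b\<^sub>(\<^sub>2\<^sub>))\<close> to the front, \<open>S(b)u = u S\<^sup>-\<^sup>1(b)\<close> (this is \<open>S\<^sup>2 = u _ u\<^sup>-\<^sup>1\<close>) carries it
  past \<open>u\<close>, and \<open>S\<^sup>-\<^sup>1\<close> of \<open>\<Sum> S(b\<^sub>(\<^sub>1\<^sub>)) \<alpha> b\<^sub>(\<^sub>2\<^sub>) = \<epsilon>(b)\<alpha>\<close> finishes (\<open>casimir_right\<close>, \<open>casimir_left\<close>).  The
  Koszul signs cancel because \<open>\<epsilon>\<close> and \<open>Str\<close> vanish in odd degree and \<open>\<alpha>\<close>, \<open>\<beta>\<close>, \<open>u\<close> are even.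
  The element with the bar is treated in the same way, with the roles of the outer tensor factors exchanged.

  Equations between tensors are proved by duality: over a field, a tensor is determined by its
  contractions with scalar multilinear forms (\<open>tensor_eqI\<close>), and two multilinear forms agree as soon as they agree
  on homogeneous arguments (\<open>multilinear_homogeneous_eq\<close>), where the product carries an explicit sign.
\<close>

section \<open>Linear extensions\<close>

lemma lookup_fscale [simp]: "Poly_Mapping.lookup (fscale c p) x = c * Poly_Mapping.lookup p x"
  unfolding fscale_def by transfer (simp add: when_def)

context vector_space
begin

lemma linext_superset:
  assumes "finite X" "Poly_Mapping.keys p \<subseteq> X"
  shows "linext scale F p = (\<Sum>x\<in>X. scale (Poly_Mapping.lookup p x) (F x))"
  unfolding linext_def using assms
  by (intro sum.mono_neutral_left) (auto simp: in_keys_iff)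

lemma linext_add: "linext scale F (p + q) = linext scale F p + linext scale F q"
proof -
  let ?X = "Poly_Mapping.keys p \<union> Poly_Mapping.keys q"
  have "Poly_Mapping.keys (p + q) \<subseteq> ?X" by (rule Poly_Mapping.keys_add)
  then show ?thesis
    by (simp add: linext_superset[of ?X] lookup_add scale_left_distrib sum.distrib)
qed

lemma linext_fscale: "linext scale F (fscale c p) = scale c (linext scale F p)"
proof -
  have "Poly_Mapping.keys (fscale c p) \<subseteq> Poly_Mapping.keys p" by (auto simp: in_keys_iff)
  then show ?thesis
    by (simp add: linext_superset[of "Poly_Mapping.keys p"] scale_sum_right)
qed

lemma linext_single [simp]: "linext scale F (Poly_Mapping.single x c) = scale c (F x)"
  by (simp add: linext_def)

lemma linext_0 [simp]: "linext scale F 0 = 0"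
  by (simp add: linext_def)

lemma linext_linear: "Vector_Spaces.linear fscale scale (linext scale F)"
  unfolding Vector_Spaces.linear_iff
  by (simp add: linext_add linext_fscale formal.vector_space_axioms vector_space_axioms)

lemma linext_diff: "linext scale F (p - q) = linext scale F p - linext scale F q"
  using linext_add[of F "p - q" q] by (simp add: algebra_simps)

lemma linext_sum: "linext scale F (\<Sum>i\<in>I. g i) = (\<Sum>i\<in>I. linext scale F (g i))"
  by (induction I rule: infinite_finite_induct) (simp_all add: linext_add)

lemma linext_linext:
  "linext scale F (linext fscale G p) = linext scale (\<lambda>x. linext scale F (G x)) p"
  by (simp add: linext_def[of fscale] linext_def[of scale _ p] linext_sum linext_fscale)

end

lemma linear_linext:
  assumes "Vector_Spaces.linear s t g"
  shows "g (linext s F p) = linext t (\<lambda>x. g (F x)) p"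
proof -
  interpret Vector_Spaces.linear s t g by fact
  show ?thesis by (simp add: linext_def sum scale)
qed

interpretation field_space: vector_space "(*) :: 'k::field \<Rightarrow> 'k \<Rightarrow> 'k"
  by unfold_locales (simp_all add: algebra_simps)

text \<open>
  As a rewrite rule, this instance of \<open>scale_scale\<close> undoes \<open>mult.assoc\<close> on the scalars, and the two
  together do not terminate.
\<close>

declare field_space.scale_scale [simp del]

lemma linext_word: "linext fscale word p = p"
proof (rule poly_mapping_eqI)
  fix x
  have "Poly_Mapping.lookup (linext fscale word p) x =
      (\<Sum>y\<in>Poly_Mapping.keys p. Poly_Mapping.lookup p y * (1 when y = x))"
    by (simp add: linext_def lookup_sum lookup_single)
  also have "\<dots> = Poly_Mapping.lookup p x"
    by (cases "x \<in> Poly_Mapping.keys p") (auto simp: when_def in_keys_iff if_distrib cong: if_cong)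
  finally show "Poly_Mapping.lookup (linext fscale word p) x = Poly_Mapping.lookup p x" .
qed

lemma formals_subspace: "formal.subspace (formals n)"
proof (rule formal.subspaceI)
  show "p + q \<in> formals n" if "p \<in> formals n" "q \<in> formals n" for p q
    using that Poly_Mapping.keys_add[of p q] unfolding formals_def by blast
  show "fscale c p \<in> formals n" if "p \<in> formals n" for c p
    using that by (auto simp: formals_def in_keys_iff)
qed (simp add: formals_def)

lemma word_formals [simp]: "word xs \<in> formals n \<longleftrightarrow> length xs = n"
  by (simp add: formals_def)

lemma linext_formals:
  assumes "p \<in> formals n" "\<And>xs. length xs = n \<Longrightarrow> F xs \<in> formals m"
  shows "linext fscale F p \<in> formals m"
  unfolding linext_def using assms formals_subspace[of m]
  by (intro formal.subspace_sum formal.subspace_scale) (auto simp: formals_def)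

section \<open>Multilinear forms separate tensors\<close>

context superalgebra
begin

definition multilinear :: "nat \<Rightarrow> ('a list \<Rightarrow> 'k) \<Rightarrow> bool" where
  "multilinear n F \<longleftrightarrow> (\<forall>xs i. length xs = n \<longrightarrow> i < n \<longrightarrow>
     (\<forall>a b. F (xs[i := a + b]) = F (xs[i := a]) + F (xs[i := b])) \<and>
     (\<forall>c a. F (xs[i := c *s a]) = c * F (xs[i := a])))"

text \<open>
  For a multilinear form, the value of the induced functional on a tensor; by \<open>contract_cls\<close> it can be
  computed on any representative.
\<close>

definition contract :: "('a list \<Rightarrow> 'k) \<Rightarrow> ('a, 'k) tensor \<Rightarrow> 'k" where
  "contract F X = linext (*) F (rep X)"

text \<open>
  This is what lets a multilinear form descend to the tensor power.
\<close>

lemma multilinear_vanishes: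
  assumes F: "multilinear n F" and r: "r \<in> formal.span (multilinear_relations n)"
  shows "linext (*) F r = 0"
  using r
proof (induction rule: formal.span_induct)
  case base
  interpret Vector_Spaces.linear fscale "(*)" "linext (*) F" by (rule field_space.linext_linear)
  show ?case by (simp add: formal.subspace_def add scale)
next
  case (step r)
  from step show ?case
    unfolding multilinear_relations_def
  proof (elim UnE CollectE exE conjE)
    fix xs ys a b
    assume *: "r = word (xs @ (a + b) # ys) - word (xs @ a # ys) - word (xs @ b # ys)"
      and len: "length xs + length ys + 1 = n"
    from len have "F (xs @ (a + b) # ys) = F (xs @ a # ys) + F (xs @ b # ys)"
      using F[unfolded multilinear_def, rule_format, of "xs @ 0 # ys" "length xs"] by simp
    then show ?thesis by (simp add: * field_space.linext_diff)
  next
    fix xs ys c a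
    assume *: "r = word (xs @ (c *s a) # ys) - fscale c (word (xs @ a # ys))"
      and len: "length xs + length ys + 1 = n"
    from len have "F (xs @ (c *s a) # ys) = c * F (xs @ a # ys)"
      using F[unfolded multilinear_def, rule_format, of "xs @ 0 # ys" "length xs"] by simp
    then show ?thesis by (simp add: * field_space.linext_diff field_space.linext_fscale)
  qed
qed

text \<open>
  The converse of \<open>multilinear_vanishes\<close>, which is where the scalars have to form a field: a formal
  sum outside the span of the relations is detected by a linear functional that vanishes on the
  span, and such a functional is a multilinear form in the entries of the words.
\<close>

lemma multilinear_forms_separate:
  assumes sep: "\<And>F. multilinear n F \<Longrightarrow> linext (*) F p = 0"
  shows "p \<in> formal.span (multilinear_relations n)"
proof (rule ccontr)
  let ?N = "multilinear_relations n :: ('a, 'k) formal set"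
  assume p: "p \<notin> formal.span ?N"
  obtain B where B: "B \<subseteq> ?N" "formal.independent B" "?N \<subseteq> formal.span B"
    using formal.maximal_independent_subset by blast
  interpret vs: vector_space_pair "fscale :: 'k \<Rightarrow> ('a, 'k) formal \<Rightarrow> _" "(*)" ..
  have "p \<notin> formal.span B" using p B(1) formal.span_mono by blast
  then have "formal.independent (insert p B)" using B(2) by (rule formal.independent_insertI)
  from vs.linear_independent_extend[OF this, of "\<lambda>x. if x = p then 1 else 0"]
  obtain g where g: "Vector_Spaces.linear fscale (*) g" "g p = 1" "\<And>b. b \<in> B \<Longrightarrow> b \<noteq> p \<Longrightarrow> g b = 0"
    by auto
  interpret g: Vector_Spaces.linear fscale "(*)" g by fact
  have gB: "g b = 0" if "b \<in> B" for b using g(3) that \<open>p \<notin> formal.span B\<close> formal.span_base by metis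
  have g0: "g r = 0" if "r \<in> ?N" for r
    using B(3) gB that by (metis g.eq_0_on_span subsetD)
  have "multilinear n (\<lambda>xs. g (word xs))"
    unfolding multilinear_def
  proof (intro allI impI conjI)
    fix xs :: "'a list" and i a b c
    assume len: "length xs = n" "i < n"
    have upd: "xs[i := z] = take i xs @ z # drop (Suc i) xs" for z
      using len by (simp add: upd_conv_take_nth_drop)
    have "word (xs[i := a + b]) - word (xs[i := a]) - word (xs[i := b]) \<in> ?N"
      unfolding upd multilinear_relations_def using len by (intro UnI1 CollectI) fastforce
    from g0[OF this] show "g (word (xs[i := a + b])) = g (word (xs[i := a])) + g (word (xs[i := b]))"
      by (simp add: g.diff diff_diff_eq flip: g.add)
    have "word (xs[i := c *s a]) - fscale c (word (xs[i := a])) \<in> ?N"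
      unfolding upd multilinear_relations_def using len by (intro UnI2 CollectI) fastforce
    from g0[OF this] show "g (word (xs[i := c *s a])) = c * g (word (xs[i := a]))"
      by (simp add: g.diff g.scale)
  qed
  from sep[OF this] have "g p = 0"
    by (simp flip: linear_linext[OF g(1)] add: linext_word)
  with g(2) show False by simp
qed

lemma equiv_tensor_rel: "equiv (formals n) (tensor_rel n)"
proof (rule equivI)
  let ?N = "formal.span (multilinear_relations n)"
  show "refl_on (formals n) (tensor_rel n)"
    by (auto simp: refl_on_def tensor_rel_def formal.span_zero)
  show "tensor_rel n \<subseteq> formals n \<times> formals n" by (auto simp: tensor_rel_def)
  show "sym (tensor_rel n)"
    unfolding sym_def tensor_rel_def using formal.span_neg[of _ "multilinear_relations n"]
    by fastforce
  show "trans (tensor_rel n)"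
    unfolding trans_def tensor_rel_def using formal.span_add[of _ "multilinear_relations n"]
    by fastforce
qed

lemma carrier_TP: "carrier (TP n) = cls n ` formals n"
  by (auto simp: TP_def quotient_def cls_def)

lemma cls_carrier: "p \<in> formals n \<Longrightarrow> cls n p \<in> carrier (TP n)"
  by (simp add: carrier_TP)

lemma rep_in: "X \<in> carrier (TP n) \<Longrightarrow> rep X \<in> X"
proof -
  assume "X \<in> carrier (TP n)"
  then obtain p where "p \<in> formals n" "X = cls n p" by (auto simp: carrier_TP)
  then have "p \<in> X" using equiv_class_self[OF equiv_tensor_rel] by (simp add: cls_def)
  then show ?thesis unfolding rep_def by (rule someI)
qed

lemma rep_formals: "X \<in> carrier (TP n) \<Longrightarrow> rep X \<in> formals n"
  using rep_in[of X n] by (auto simp: carrier_TP cls_def tensor_rel_def)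

lemma cls_rep: "X \<in> carrier (TP n) \<Longrightarrow> cls n (rep X) = X"
  using rep_in[of X n] equiv_class_eq[OF equiv_tensor_rel, of _ "rep X" n]
  by (auto simp: carrier_TP cls_def)

lemma cls_eqI:
  assumes "p \<in> formals n" "q \<in> formals n"
    and "\<And>F. multilinear n F \<Longrightarrow> linext (*) F p = linext (*) F q"
  shows "cls n p = cls n q"
  unfolding cls_def
  using assms multilinear_forms_separate[of n "p - q"]
  by (intro equiv_class_eq[OF equiv_tensor_rel]) (simp add: tensor_rel_def field_space.linext_diff)

lemma contract_cls:
  assumes "p \<in> formals n" "multilinear n F"
  shows "contract F (cls n p) = linext (*) F p"
proof -
  have "rep (cls n p) \<in> cls n p" by (rule rep_in[OF cls_carrier[OF assms(1)]])
  then have "p - rep (cls n p) \<in> formal.span (multilinear_relations n)"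
    unfolding cls_def tensor_rel_def by blast
  from multilinear_vanishes[OF assms(2) this] show ?thesis
    by (simp add: contract_def field_space.linext_diff)
qed

lemma tensor_eqI:
  assumes "X \<in> carrier (TP n)" "Y \<in> carrier (TP n)"
    and "\<And>F. multilinear n F \<Longrightarrow> contract F X = contract F Y"
  shows "X = Y"
  using cls_eqI[OF assms(1,2)[THEN rep_formals] assms(3)[unfolded contract_def]] assms(1,2)
  by (simp add: cls_rep)

lemma contract_cong:
  assumes "X \<in> carrier (TP n)" "\<And>xs. length xs = n \<Longrightarrow> F xs = G xs"
  shows "contract F X = contract G X"
  using rep_formals[OF assms(1)] assms(2)
  by (auto simp: contract_def linext_def formals_def intro!: sum.cong)

lemma contract_zero [simp]: "contract (\<lambda>xs. 0) X = 0"
  by (simp add: contract_def linext_def)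

lemma contract_add: "contract (\<lambda>xs. F xs + G xs) X = contract F X + contract G X"
  by (simp add: contract_def linext_def algebra_simps sum.distrib)

lemma contract_mult_left: "contract (\<lambda>xs. c * F xs) X = c * contract F X"
  unfolding contract_def linext_def sum_distrib_left by (simp add: ac_simps)

lemma contract_sum: "contract (\<lambda>xs. \<Sum>i\<in>I. F i xs) X = (\<Sum>i\<in>I. contract (F i) X)"
  by (induction I rule: infinite_finite_induct) (simp_all add: contract_add)

lemma contract_swap:
  "contract (\<lambda>xs. contract (F xs) Y) X = contract (\<lambda>ys. contract (\<lambda>xs. F xs ys) X) Y"
  unfolding contract_def linext_def
  by (simp add: sum_distrib_left mult.left_commute) (rule sum.swap)

lemma contract_TP_add:
  assumes "X \<in> carrier (TP n)" "Y \<in> carrier (TP n)" "multilinear n F"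
  shows "contract F (X \<oplus>\<^bsub>TP n\<^esub> Y) = contract F X + contract F Y"
  using assms formal.subspace_add[OF formals_subspace assms(1,2)[THEN rep_formals]]
  by (simp add: TP_def contract_cls) (simp add: field_space.linext_add contract_def)

lemma contract_TP_smult:
  assumes "X \<in> carrier (TP n)" "multilinear n F"
  shows "contract F (c \<odot>\<^bsub>TP n\<^esub> X) = c * contract F X"
  using assms formal.subspace_scale[OF formals_subspace assms(1)[THEN rep_formals]]
  by (simp add: TP_def contract_cls) (simp add: field_space.linext_fscale contract_def)

lemma tmap_carrier:
  assumes "X \<in> carrier (TP n)" "\<And>xs. length xs = n \<Longrightarrow> G xs \<in> formals m"
  shows "tmap m G X \<in> carrier (TP m)"
  unfolding tmap_def by (intro cls_carrier linext_formals[OF rep_formals[OF assms(1)]] assms(2))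

text \<open>
  The map induced on tensors is the transpose of the pullback of forms.
\<close>

lemma contract_tmap:
  assumes "X \<in> carrier (TP n)" "\<And>xs. length xs = n \<Longrightarrow> G xs \<in> formals m" "multilinear m F"
  shows "contract F (tmap m G X) = contract (\<lambda>xs. linext (*) F (G xs)) X"
  unfolding tmap_def
  using contract_cls[OF linext_formals[OF rep_formals[OF assms(1)] assms(2)] assms(3)]
  by (simp add: field_space.linext_linext contract_def)

lemma one_carrier: "\<one>\<^bsub>TP n\<^esub> \<in> carrier (TP n)"
  using cls_carrier[of "word (replicate n 1)" n] by (simp add: TP_def)

lemma contract_one: "multilinear n F \<Longrightarrow> contract F \<one>\<^bsub>TP n\<^esub> = F (replicate n 1)"
  by (simp add: TP_def contract_cls)

end

section \<open>Koszul signs and homogeneous components\<close>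

text \<open>
  Degrees are added and multiplied in the field of two elements; rewriting these operations into
  bitwise ones would hide the algebra.
\<close>

declare add_bit_eq_xor [simp del] mult_bit_eq_and [simp del]

lemma UNIV_bit: "(UNIV :: bit set) = {0, 1}"
  by auto

lemma bit_add_self [simp]: "(i :: bit) + i = 0"
  by (cases i) simp_all

lemma ksgn_0 [simp]: "ksgn 0 = (1 :: 'k::field)"
  by (simp add: ksgn_def)

lemma ksgn_add: "ksgn (i + j) = (ksgn i * ksgn j :: 'k::field)"
  by (cases i; cases j) (simp_all add: ksgn_def)

lemma ksgn_square [simp]: "ksgn i * ksgn i = (1 :: 'k::field)"
  by (simp add: ksgn_def)

lemma ksgn_add_mult: "ksgn ((i + j) * l) = (ksgn (i * l) * ksgn (j * l) :: 'k::field)"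
  by (simp only: distrib_right ksgn_add)

lemma ksgn_mult_add: "ksgn (l * (i + j)) = (ksgn (l * i) * ksgn (l * j) :: 'k::field)"
  by (simp only: distrib_left ksgn_add)

lemma koszul_add_left:
  assumes "length ds = n" "length es = n" "length fs = n"
  shows "koszul (map2 (+) ds es) fs = (koszul ds fs * koszul es fs :: 'k::field)"
proof -
  have "ksgn (map2 (+) ds es ! i * fs ! j) = (ksgn (ds ! i * fs ! j) * ksgn (es ! i * fs ! j) :: 'k)"
    if "i < n" for i j
  proof -
    have "map2 (+) ds es ! i = ds ! i + es ! i" using that assms by simp
    then show ?thesis by (simp only: ksgn_add_mult)
  qed
  then show ?thesis using assms by (simp add: koszul_def prod.distrib)
qed

lemma koszul_add_right:
  assumes "length ds = n" "length es = n" "length fs = n"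
  shows "koszul ds (map2 (+) es fs) = (koszul ds es * koszul ds fs :: 'k::field)"
proof -
  have "ksgn (ds ! i * map2 (+) es fs ! j) = (ksgn (ds ! i * es ! j) * ksgn (ds ! i * fs ! j) :: 'k)"
    if "i < n" "j < i" for i j
  proof -
    have "map2 (+) es fs ! j = es ! j + fs ! j" using that assms by simp
    then show ?thesis by (simp only: ksgn_mult_add)
  qed
  then show ?thesis using assms by (simp add: koszul_def prod.distrib)
qed

lemma koszul_zero_left: "koszul (replicate n 0) es = (1 :: 'k::field)"
  by (simp add: koszul_def)

lemma koszul_zero_right: "length ds = n \<Longrightarrow> koszul ds (replicate n 0) = (1 :: 'k::field)"
  by (simp add: koszul_def)

lemma map2_list_update_right:
  "length xs = length ys \<Longrightarrow> map2 f xs (ys[i := a]) = (map2 f xs ys)[i := f (xs ! i) a]"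
  by (rule nth_equalityI; cases "i < length ys") (auto simp: nth_list_update)

lemma map2_list_update_left:
  "length xs = length ys \<Longrightarrow> map2 f (xs[i := a]) ys = (map2 f xs ys)[i := f a (ys ! i)]"
  by (rule nth_equalityI; cases "i < length ys") (auto simp: nth_list_update)

lemma replicate_2: "replicate 2 x = [x, x]"
  by (simp add: numeral_2_eq_2)

lemma length2E: assumes "length xs = 2" obtains x y where "xs = [x, y]"
  using assms by (auto simp: numeral_2_eq_2 length_Suc_conv)

lemma length3E: assumes "length xs = 3" obtains x y z where "xs = [x, y, z]"
  using assms by (auto simp: numeral_3_eq_3 length_Suc_conv)

context superspace
begin

lemma gr_unique: "x \<in> gr i \<Longrightarrow> x \<in> gr j \<Longrightarrow> i \<noteq> j \<Longrightarrow> x = 0"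
  using gr_disjoint by (cases i; cases j) auto

lemma gr_add: "x \<in> gr i \<Longrightarrow> y \<in> gr i \<Longrightarrow> x + y \<in> gr i"
  and gr_diff: "x \<in> gr i \<Longrightarrow> y \<in> gr i \<Longrightarrow> x - y \<in> gr i"
  and gr_scale: "x \<in> gr i \<Longrightarrow> c *s x \<in> gr i"
  and gr_zero [simp]: "0 \<in> gr i"
  using gr_subspace[of i]
  by (simp_all add: subspace_add subspace_diff subspace_scale subspace_0)

text \<open>
  Two candidates for the component differ by an element of both graded parts, that is, by zero.
\<close>

lemma gproj_eqI:
  assumes "x \<in> gr i" "v - x \<in> gr (i + 1)"
  shows "gproj i v = x"
  unfolding gproj_def
proof (rule the_equality)
  fix y assume y: "y \<in> gr i \<and> v - y \<in> gr (i + 1)"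
  have "y - x = (v - x) - (v - y)" by simp
  then have "y - x \<in> gr (i + 1)" using gr_diff y assms(2) by metis
  moreover have "y - x \<in> gr i" using gr_diff y assms(1) by metis
  ultimately have "y - x = 0" by (rule gr_unique) simp
  then show "y = x" by simp
qed (use assms in simp)

lemma gproj_ex: "\<exists>x. x \<in> gr i \<and> v - x \<in> gr (i + 1)"
proof -
  obtain x y where "x \<in> gr 0" "y \<in> gr 1" "v = x + y" using gr_decompose by blast
  then show ?thesis by (cases i) (auto intro: exI[of _ x] exI[of _ y])
qed

lemma gproj_mem: "gproj i v \<in> gr i" and gproj_rest: "v - gproj i v \<in> gr (i + 1)"
  using gproj_ex[of i v] gproj_eqI by auto

lemma gproj_sum: "gproj 0 v + gproj 1 v = v"
proof -
  have "gproj 1 v = v - gproj 0 v"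
    using gproj_mem[of 0 v] gproj_rest[of v 0] by (intro gproj_eqI) auto
  then show ?thesis by simp
qed

lemma gproj_add: "gproj i (a + b) = gproj i a + gproj i b"
proof (rule gproj_eqI)
  have "a + b - (gproj i a + gproj i b) = (a - gproj i a) + (b - gproj i b)" by simp
  then show "a + b - (gproj i a + gproj i b) \<in> gr (i + 1)" using gr_add gproj_rest by metis
qed (intro gr_add gproj_mem)

lemma gproj_scale: "gproj i (c *s a) = c *s gproj i a"
  using gr_scale[OF gproj_rest] 
  by (intro gproj_eqI gr_scale gproj_mem) (simp add: scale_right_diff_distrib)

lemma gproj_homogeneous: "x \<in> gr i \<Longrightarrow> gproj d x = (if d = i then x else 0)"
  by (cases d; cases i) (auto intro!: gproj_eqI)

end

context superalgebra
begin

text \<open>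
  Multiplication by the odd part of \<open>1\<close> from the right kills homogeneous elements, since it changes their degree and
  yet equals \<open>a - a * gproj 0 1\<close>, which has the degree of \<open>a\<close>.
\<close>

lemma one_even: "1 \<in> gr 0"
proof -
  have "a * gproj 1 1 = 0" if "a \<in> gr i" for a i
  proof -
    have "a = a * gproj 0 1 + a * gproj 1 1" by (simp flip: distrib_left add: gproj_sum)
    then have "a - a * gproj 0 1 = a * gproj 1 1" by (simp add: algebra_simps)
    moreover have "a * gproj 0 1 \<in> gr i" using gr_mult[OF that gproj_mem, of 0] by simp
    ultimately have "a * gproj 1 1 \<in> gr i" using gr_diff that by metis
    moreover have "a * gproj 1 1 \<in> gr (i + 1)" by (rule gr_mult[OF that gproj_mem])
    ultimately show ?thesis by (rule gr_unique) simp
  qed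
  from this[OF gproj_mem] have "gproj 0 1 * gproj 1 1 + gproj 1 1 * gproj 1 1 = 0" by simp
  then have "gproj 1 1 = 0" by (simp flip: distrib_right add: gproj_sum)
  then show ?thesis using gproj_sum[of 1] gproj_mem[of 0 1] by simp
qed

abbreviation of_degrees :: "'a list \<Rightarrow> bit list \<Rightarrow> bool" where
  "of_degrees \<equiv> list_all2 (\<lambda>x i. x \<in> gr i)"

lemma multilinearI:
  assumes "\<And>xs i a b. length xs = n \<Longrightarrow> i < n \<Longrightarrow> F (xs[i := a + b]) = F (xs[i := a]) + F (xs[i := b])"
    and "\<And>xs i c a. length xs = n \<Longrightarrow> i < n \<Longrightarrow> F (xs[i := c *s a]) = c * F (xs[i := a])"
  shows "multilinear n F"
  using assms by (simp add: multilinear_def)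

lemma multilinear_add:
  "multilinear n F \<Longrightarrow> length xs = n \<Longrightarrow> i < n \<Longrightarrow> F (xs[i := a + b]) = F (xs[i := a]) + F (xs[i := b])"
  and multilinear_scale:
  "multilinear n F \<Longrightarrow> length xs = n \<Longrightarrow> i < n \<Longrightarrow> F (xs[i := c *s a]) = c * F (xs[i := a])"
  by (simp_all add: multilinear_def)

lemma multilinear_zero:
  assumes "multilinear n F" "length xs = n" "i < n" "xs ! i = 0"
  shows "F xs = 0"
  using multilinear_scale[OF assms(1-3), of 0 0] assms(4) by (metis list_update_id mult_zero_left scale_zero_left)

lemma multilinear2I:
  assumes "\<And>x x' y. F [x + x', y] = F [x, y] + F [x', y]" "\<And>x y y'. F [x, y + y'] = F [x, y] + F [x, y']"
    "\<And>c x y. F [c *s x, y] = c * F [x, y]" "\<And>c x y. F [x, c *s y] = c * F [x, y]"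
  shows "multilinear 2 F"
  by (rule multilinearI) (use assms in \<open>auto elim!: length2E simp: less_2_cases_iff\<close>)

lemma multilinear3I:
  assumes "\<And>x x' y z. F [x + x', y, z] = F [x, y, z] + F [x', y, z]"
    "\<And>x y y' z. F [x, y + y', z] = F [x, y, z] + F [x, y', z]"
    "\<And>x y z z'. F [x, y, z + z'] = F [x, y, z] + F [x, y, z']"
    "\<And>c x y z. F [c *s x, y, z] = c * F [x, y, z]" "\<And>c x y z. F [x, c *s y, z] = c * F [x, y, z]"
    "\<And>c x y z. F [x, y, c *s z] = c * F [x, y, z]"
  shows "multilinear 3 F"
proof -
  have three: "i < 3 \<longleftrightarrow> i = 0 \<or> i = 1 \<or> i = 2" for i :: nat by auto
  show ?thesis
    by (rule multilinearI) (use assms in \<open>auto elim!: length3E simp: three\<close>)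
qed

lemma multilinear2D:
  assumes "multilinear 2 F"
  shows "F [x + x', y] = F [x, y] + F [x', y]" "F [x, y + y'] = F [x, y] + F [x, y']"
    "F [c *s x, y] = c * F [x, y]" "F [x, c *s y] = c * F [x, y]"
  using multilinear_add[OF assms, of "[_, _]" 0] multilinear_add[OF assms, of "[_, _]" 1]
    multilinear_scale[OF assms, of "[_, _]" 0] multilinear_scale[OF assms, of "[_, _]" 1]
  by simp_all

lemma multilinear3D:
  assumes "multilinear 3 F"
  shows "F [x + x', y, z] = F [x, y, z] + F [x', y, z]" "F [x, y + y', z] = F [x, y, z] + F [x, y', z]"
    "F [x, y, z + z'] = F [x, y, z] + F [x, y, z']"
    "F [c *s x, y, z] = c * F [x, y, z]" "F [x, c *s y, z] = c * F [x, y, z]"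
    "F [x, y, c *s z] = c * F [x, y, z]"
  using multilinear_add[OF assms, of "[_, _, _]" 0] multilinear_add[OF assms, of "[_, _, _]" 1]
    multilinear_add[OF assms, of "[_, _, _]" 2] multilinear_scale[OF assms, of "[_, _, _]" 0]
    multilinear_scale[OF assms, of "[_, _, _]" 1] multilinear_scale[OF assms, of "[_, _, _]" 2]
  by simp_all

lemma multilinear_sum:
  assumes "\<And>i. i \<in> I \<Longrightarrow> multilinear n (F i)"
  shows "multilinear n (\<lambda>xs. \<Sum>i\<in>I. F i xs)"
proof (rule multilinearI)
  fix xs :: "'a list" and j c a b assume "length xs = n" "j < n"
  note * = multilinear_add[OF assms this] multilinear_scale[OF assms this]
  show "(\<Sum>i\<in>I. F i (xs[j := a + b])) = (\<Sum>i\<in>I. F i (xs[j := a])) + (\<Sum>i\<in>I. F i (xs[j := b]))"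
    by (simp add: * flip: sum.distrib)
  show "(\<Sum>i\<in>I. F i (xs[j := c *s a])) = c * (\<Sum>i\<in>I. F i (xs[j := a]))"
    by (simp add: * sum_distrib_left)
qed

lemma multilinear_cmult: "multilinear n F \<Longrightarrow> multilinear n (\<lambda>xs. c * F xs)"
  by (auto intro!: multilinearI simp: multilinear_add multilinear_scale distrib_left mult.left_commute)

lemma multilinear_contract:
  assumes "X \<in> carrier (TP m)" "\<And>ys. length ys = m \<Longrightarrow> multilinear n (\<lambda>xs. G xs ys)"
  shows "multilinear n (\<lambda>xs. contract (G xs) X)"
  unfolding contract_def linext_def
  using assms(2) rep_formals[OF assms(1)]
  by (intro multilinear_sum multilinear_cmult) (auto simp: formals_def)

text \<open>
  Splitting one argument after the other into its even and odd parts.  This is the device that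
  reduces every identity below to homogeneous words.
\<close>

lemma multilinear_homogeneous_eq:
  assumes F: "multilinear n F" and G: "multilinear n G"
    and eq: "\<And>xs ds. length xs = n \<Longrightarrow> of_degrees xs ds \<Longrightarrow> F xs = G xs"
    and len: "length xs = n"
  shows "F xs = G xs"
proof -
  have "\<forall>xs. length xs = n \<longrightarrow> (\<forall>i. k \<le> i \<longrightarrow> i < n \<longrightarrow> (\<exists>d. xs ! i \<in> gr d)) \<longrightarrow> F xs = G xs"
    if "k \<le> n" for k
    using that
  proof (induction k)
    case 0
    show ?case
    proof (intro allI impI)
      fix xs :: "'a list"
      assume len: "length xs = n" and "\<forall>i. 0 \<le> i \<longrightarrow> i < n \<longrightarrow> (\<exists>d. xs ! i \<in> gr d)"
      then have "\<forall>i. \<exists>d. i < n \<longrightarrow> xs ! i \<in> gr d" by blast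
      then obtain d where "\<forall>i<n. xs ! i \<in> gr (d i)" by metis
      then have "of_degrees xs (map d [0..<n])" by (simp add: list_all2_conv_all_nth len)
      then show "F xs = G xs" by (rule eq[OF len])
    qed
  next
    case (Suc k)
    show ?case
    proof (intro allI impI)
      fix xs :: "'a list"
      assume len: "length xs = n" and hom: "\<forall>i. Suc k \<le> i \<longrightarrow> i < n \<longrightarrow> (\<exists>d. xs ! i \<in> gr d)"
      have "F (xs[k := gproj d (xs ! k)]) = G (xs[k := gproj d (xs ! k)])" for d
      proof (rule Suc.IH[rule_format])
        fix i assume "k \<le> i" "i < n"
        then show "\<exists>e. xs[k := gproj d (xs ! k)] ! i \<in> gr e"
          using gproj_mem[of d "xs ! k"] hom[rule_format, of i] len by (cases "i = k") auto
      qed (use Suc.prems len in auto)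
      then have "F (xs[k := gproj 0 (xs ! k) + gproj 1 (xs ! k)]) = G (xs[k := gproj 0 (xs ! k) + gproj 1 (xs ! k)])"
        using Suc.prems len by (simp add: multilinear_add[OF F] multilinear_add[OF G])
      then show "F xs = G xs" by (simp add: gproj_sum)
    qed
  qed
  from this[of n] show ?thesis using len by simp
qed

end

section \<open>The Koszul product is associative\<close>

context superalgebra
begin

text \<open>
  The form that a multilinear form induces on a pair of tensors through their product.
\<close>

definition product_form :: "nat \<Rightarrow> ('a list \<Rightarrow> 'k) \<Rightarrow> 'a list \<Rightarrow> 'a list \<Rightarrow> 'k" where
  "product_form n F xs ys =
    (\<Sum>ds | length ds = n. \<Sum>es | length es = n.
       koszul ds es * F (map2 (*) (map2 gproj ds xs) (map2 gproj es ys)))"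

lemma linext_word_mult: "linext (*) F (word_mult n xs ys) = product_form n F xs ys"
  by (simp add: word_mult_def product_form_def field_space.linext_sum field_space.linext_fscale)

lemma word_mult_formals:
  "length xs = n \<Longrightarrow> length ys = n \<Longrightarrow> word_mult n xs ys \<in> formals n"
  unfolding word_mult_def
  by (intro formal.subspace_sum[OF formals_subspace] formal.subspace_scale[OF formals_subspace]) simp

lemma multilinear_product_left:
  assumes F: "multilinear n F" and ys: "length ys = n"
  shows "multilinear n (\<lambda>xs. product_form n F xs ys)"
  unfolding product_form_def
proof (intro multilinear_sum multilinear_cmult, unfold mem_Collect_eq)
  fix ds es :: "bit list" assume [simp]: "length ds = n" "length es = n"
  show "multilinear n (\<lambda>xs. F (map2 (*) (map2 gproj ds xs) (map2 gproj es ys)))"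
    using ys F
    by (intro multilinearI)
      (simp_all add: map2_list_update_right map2_list_update_left gproj_add gproj_scale distrib_right
        scale_mult_left multilinear_add multilinear_scale)
qed

lemma multilinear_product_right:
  assumes F: "multilinear n F" and xs: "length xs = n"
  shows "multilinear n (\<lambda>ys. product_form n F xs ys)"
  unfolding product_form_def
proof (intro multilinear_sum multilinear_cmult, unfold mem_Collect_eq)
  fix ds es :: "bit list" assume [simp]: "length ds = n" "length es = n"
  show "multilinear n (\<lambda>ys. F (map2 (*) (map2 gproj ds xs) (map2 gproj es ys)))"
    using xs F
    by (intro multilinearI)
      (simp_all add: map2_list_update_right map2_list_update_left gproj_add gproj_scale distrib_left
        scale_mult_right multilinear_add multilinear_scale)
qed

lemma multilinear_product_param:
  assumes "\<And>v. length v = n \<Longrightarrow> multilinear m (G v)" "length xs = n" "length ys = n"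
  shows "multilinear m (\<lambda>zs. product_form n (\<lambda>v. G v zs) xs ys)"
  unfolding product_form_def
  by (intro multilinear_sum multilinear_cmult assms(1)) (simp add: assms)

lemma product_form_contract:
  "product_form n (\<lambda>v. contract (G v) Z) xs ys = contract (\<lambda>zs. product_form n (\<lambda>v. G v zs) xs ys) Z"
  by (simp add: product_form_def contract_sum contract_mult_left)

text \<open>
  Of the sum over all pairs of degree vectors only the actual degrees survive: for any other choice some
  projection is zero.
\<close>

lemma product_form_homogeneous:
  assumes F: "multilinear n F" and xs: "of_degrees xs ds" "length xs = n"
    and ys: "of_degrees ys es" "length ys = n"
  shows "product_form n F xs ys = koszul ds es * F (map2 (*) xs ys)"
proof -
  have lens: "length ds = n" "length es = n" using assms by (auto dest: list_all2_lengthD)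
  have proj: "map2 gproj ds' xs' = xs'" if "of_degrees xs' ds'" for xs' ds'
    using that by (auto simp: list_all2_conv_all_nth gproj_homogeneous intro!: nth_equalityI)
  have zero: "\<exists>i<n. map2 gproj ds' xs' ! i = 0"
    if "of_degrees xs' ds''" "length xs' = n" "length ds' = n" "ds' \<noteq> ds''" for xs' ds' ds''
  proof -
    have "length ds'' = n" using that by (auto dest: list_all2_lengthD)
    then have "\<exists>i<n. ds' ! i \<noteq> ds'' ! i"
      using that(3,4) nth_equalityI[of ds' ds''] by metis
    then obtain i where "i < n" "ds' ! i \<noteq> ds'' ! i" by blast
    have "xs' ! i \<in> gr (ds'' ! i)" using list_all2_nthD[OF that(1), of i] that(2) \<open>i < n\<close> by simp
    then have "gproj (ds' ! i) (xs' ! i) = 0" using \<open>ds' ! i \<noteq> ds'' ! i\<close> gproj_homogeneous by metis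
    then show ?thesis using that(2,3) \<open>i < n\<close> by (intro exI[of _ i]) simp
  qed
  have "finite (UNIV :: bit set)" by (simp add: UNIV_bit)
  then have fin: "finite {l :: bit list. length l = n}"
    using finite_lists_length_eq[of "UNIV :: bit set" n] by simp
  have "koszul ds' es' * F (map2 (*) (map2 gproj ds' xs) (map2 gproj es' ys)) =
      (if es' = es then if ds' = ds then koszul ds es * F (map2 (*) xs ys) else 0 else 0)"
    if l: "length ds' = n" "length es' = n" for ds' es'
  proof (cases "ds' = ds \<and> es' = es")
    case True
    then show ?thesis using proj xs ys by simp
  next
    case False
    then have "\<exists>i<n. map2 (*) (map2 gproj ds' xs) (map2 gproj es' ys) ! i = 0"
      using zero[OF xs l(1)] zero[OF ys l(2)] l xs(2) ys(2) by fastforce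
    then have "F (map2 (*) (map2 gproj ds' xs) (map2 gproj es' ys)) = 0"
      using l xs(2) ys(2) by (auto intro: multilinear_zero[OF F])
    then show ?thesis using False by auto
  qed
  then have "product_form n F xs ys = (\<Sum>ds' | length ds' = n. \<Sum>es' | length es' = n.
      if es' = es then if ds' = ds then koszul ds es * F (map2 (*) xs ys) else 0 else 0)"
    unfolding product_form_def by (intro sum.cong refl) auto
  then show ?thesis using lens by (simp add: fin)
qed

lemma mult_carrier:
  assumes "X \<in> carrier (TP n)" "Y \<in> carrier (TP n)"
  shows "X \<otimes>\<^bsub>TP n\<^esub> Y \<in> carrier (TP n)"
proof -
  have "cls n (linext fscale (\<lambda>xs. linext fscale (word_mult n xs) (rep Y)) (rep X)) \<in> carrier (TP n)"
    by (intro cls_carrier linext_formals[where n = n] rep_formals assms word_mult_formals)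
  then show ?thesis by (simp add: TP_def)
qed

lemma contract_mult:
  assumes "X \<in> carrier (TP n)" "Y \<in> carrier (TP n)" "multilinear n F"
  shows "contract F (X \<otimes>\<^bsub>TP n\<^esub> Y) = contract (\<lambda>xs. contract (product_form n F xs) Y) X"
proof -
  have "contract F (X \<otimes>\<^bsub>TP n\<^esub> Y) =
      linext (*) F (linext fscale (\<lambda>xs. linext fscale (word_mult n xs) (rep Y)) (rep X))"
    unfolding TP_def
    by (simp, intro contract_cls linext_formals[where n = n] rep_formals assms word_mult_formals)
  then show ?thesis
    by (simp add: field_space.linext_linext linext_word_mult contract_def)
qed

lemma multilinear_contract_product_left:
  assumes "multilinear n F" "Y \<in> carrier (TP n)"
  shows "multilinear n (\<lambda>xs. contract (product_form n F xs) Y)"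
  by (rule multilinear_contract[OF assms(2)]) (rule multilinear_product_left[OF assms(1)])

lemma of_degrees_mult:
  "of_degrees xs ds \<Longrightarrow> of_degrees ys es \<Longrightarrow> length xs = length ys \<Longrightarrow>
    of_degrees (map2 (*) xs ys) (map2 (+) ds es)"
  by (auto simp: list_all2_conv_all_nth gr_mult)

text \<open>
  On homogeneous words both sides carry the sign \<open>koszul ds es * koszul ds fs * koszul es fs\<close>, because
  \<open>koszul\<close> is multiplicative in each of its arguments.
\<close>

lemma product_form_assoc:
  assumes F: "multilinear n F" and l: "length xs = n" "length ys = n" "length zs = n"
  shows "product_form n (\<lambda>v. product_form n F v zs) xs ys
    = product_form n (\<lambda>v. product_form n F xs v) ys zs"
proof -
  note ml = multilinear_product_left multilinear_product_right multilinear_product_param F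
  let ?L = "\<lambda>xs ys zs. product_form n (\<lambda>v. product_form n F v zs) xs ys"
  let ?R = "\<lambda>xs ys zs. product_form n (\<lambda>v. product_form n F xs v) ys zs"
  have hom: "?L xs ys zs = ?R xs ys zs"
    if xs: "of_degrees xs ds" "length xs = n" and ys: "of_degrees ys es" "length ys = n"
      and zs: "of_degrees zs fs" "length zs = n" for xs ys zs ds es fs
  proof -
    have lens: "length ds = n" "length es = n" "length fs = n"
      using that by (auto dest: list_all2_lengthD)
    have a: "map2 (*) (map2 (*) xs ys) zs = map2 (*) xs (map2 (*) ys zs)"
      using that by (intro nth_equalityI) (simp_all add: mult.assoc)
    have "?L xs ys zs = koszul ds es * (koszul (map2 (+) ds es) fs * F (map2 (*) (map2 (*) xs ys) zs))"
      using that of_degrees_mult[OF xs(1) ys(1)]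
      by (simp add: product_form_homogeneous[OF _ xs ys] product_form_homogeneous[OF F _ _ zs] ml)
    also have "\<dots> = koszul es fs * (koszul ds (map2 (+) es fs) * F (map2 (*) xs (map2 (*) ys zs)))"
      using lens by (simp add: koszul_add_left koszul_add_right a)
    also have "\<dots> = ?R xs ys zs"
      using that of_degrees_mult[OF ys(1) zs(1)]
      by (simp add: product_form_homogeneous[OF _ ys zs] product_form_homogeneous[OF F xs] ml)
    finally show ?thesis .
  qed
  have 1: "?L xs ys zs = ?R xs ys zs"
    if "of_degrees xs ds" "length xs = n" "of_degrees ys es" "length ys = n" "length zs = n"
    for xs ys zs ds es
    by (rule multilinear_homogeneous_eq[where n = n and F = "?L xs ys" and G = "?R xs ys"])
      (use that hom in \<open>simp_all add: ml\<close>)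
  have 2: "?L xs ys zs = ?R xs ys zs"
    if "of_degrees xs ds" "length xs = n" "length ys = n" "length zs = n" for xs ys zs ds
    by (rule multilinear_homogeneous_eq[where n = n and F = "\<lambda>ys. ?L xs ys zs" and G = "\<lambda>ys. ?R xs ys zs"])
      (use that 1 in \<open>simp_all add: ml\<close>)
  show ?thesis
    by (rule multilinear_homogeneous_eq[where n = n and F = "\<lambda>xs. ?L xs ys zs" and G = "\<lambda>xs. ?R xs ys zs"])
      (use l 2 in \<open>simp_all add: ml\<close>)
qed

lemma product_form_one_left:
  assumes F: "multilinear n F" and "length xs = n"
  shows "product_form n F (replicate n 1) xs = F xs"
proof (rule multilinear_homogeneous_eq[OF multilinear_product_right[OF F] F _ assms(2)])
  fix xs ds assume xs: "length xs = n" "of_degrees xs ds"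
  have "of_degrees (replicate n 1) (replicate n 0)" by (simp add: list_all2_conv_all_nth one_even)
  moreover have "map2 (*) (replicate n 1) xs = xs" using xs by (intro nth_equalityI) auto
  ultimately show "product_form n F (replicate n 1) xs = F xs"
    using product_form_homogeneous[OF F _ _ xs(2,1)] by (simp add: koszul_zero_left)
qed simp

lemma product_form_one_right:
  assumes F: "multilinear n F" and "length xs = n"
  shows "product_form n F xs (replicate n 1) = F xs"
proof (rule multilinear_homogeneous_eq[OF multilinear_product_left[OF F] F _ assms(2)])
  fix xs ds assume xs: "length xs = n" "of_degrees xs ds"
  have "of_degrees (replicate n 1) (replicate n 0)" by (simp add: list_all2_conv_all_nth one_even)
  moreover have "map2 (*) xs (replicate n 1) = xs" using xs by (intro nth_equalityI) auto
  moreover have "length ds = n" using xs by (auto dest: list_all2_lengthD)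
  ultimately show "product_form n F xs (replicate n 1) = F xs"
    using product_form_homogeneous[OF F xs(2,1)] by (simp add: koszul_zero_right)
qed simp

lemma monoid_TP: "monoid (TP n)"
proof
  fix X Y Z assume X: "X \<in> carrier (TP n)" and Y: "Y \<in> carrier (TP n)" and Z: "Z \<in> carrier (TP n)"
  show XY: "X \<otimes>\<^bsub>TP n\<^esub> Y \<in> carrier (TP n)" using X Y by (rule mult_carrier)
  show "X \<otimes>\<^bsub>TP n\<^esub> Y \<otimes>\<^bsub>TP n\<^esub> Z = X \<otimes>\<^bsub>TP n\<^esub> (Y \<otimes>\<^bsub>TP n\<^esub> Z)"
  proof (rule tensor_eqI[where n = n])
    fix F assume F: "multilinear n F"
    show "contract F (X \<otimes>\<^bsub>TP n\<^esub> Y \<otimes>\<^bsub>TP n\<^esub> Z) = contract F (X \<otimes>\<^bsub>TP n\<^esub> (Y \<otimes>\<^bsub>TP n\<^esub> Z))"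
    proof -
      have "contract F (X \<otimes>\<^bsub>TP n\<^esub> Y \<otimes>\<^bsub>TP n\<^esub> Z)
          = contract (\<lambda>xs. contract (product_form n (\<lambda>v. contract (product_form n F v) Z) xs) Y) X"
        by (simp add: contract_mult mult_carrier X Y Z F multilinear_contract_product_left)
      also have "\<dots> = contract (\<lambda>xs. contract (\<lambda>ys. contract (product_form n (product_form n F xs) ys) Z) Y) X"
        unfolding product_form_contract
        by (intro contract_cong[OF X] contract_cong[OF Y] contract_cong[OF Z])
          (simp add: product_form_assoc[OF F])
      also have "\<dots> = contract (\<lambda>xs. contract (product_form n F xs) (Y \<otimes>\<^bsub>TP n\<^esub> Z)) X"
        by (intro contract_cong[OF X]) (simp add: contract_mult Y Z F multilinear_product_right)
      also have "\<dots> = contract F (X \<otimes>\<^bsub>TP n\<^esub> (Y \<otimes>\<^bsub>TP n\<^esub> Z))"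
        by (simp add: contract_mult mult_carrier X Y Z F)
      finally show ?thesis .
    qed
  qed (intro mult_carrier X Y Z)+
next
  fix X assume X: "X \<in> carrier (TP n)"
  show "\<one>\<^bsub>TP n\<^esub> \<otimes>\<^bsub>TP n\<^esub> X = X"
  proof (rule tensor_eqI[where n = n])
    fix F assume F: "multilinear n F"
    show "contract F (\<one>\<^bsub>TP n\<^esub> \<otimes>\<^bsub>TP n\<^esub> X) = contract F X"
      using contract_cong[OF X product_form_one_left[OF F]]
      by (simp add: contract_mult one_carrier X F contract_one multilinear_contract_product_left)
  qed (intro mult_carrier one_carrier X)+
  show "X \<otimes>\<^bsub>TP n\<^esub> \<one>\<^bsub>TP n\<^esub> = X"
  proof (rule tensor_eqI[where n = n])
    fix F assume F: "multilinear n F"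
    have "contract (product_form n F xs) \<one>\<^bsub>TP n\<^esub> = F xs" if "length xs = n" for xs
      using that by (simp add: contract_one multilinear_product_right F product_form_one_right)
    then show "contract F (X \<otimes>\<^bsub>TP n\<^esub> \<one>\<^bsub>TP n\<^esub>) = contract F X"
      unfolding contract_mult[OF X one_carrier F] by (intro contract_cong[OF X])
  qed (intro mult_carrier one_carrier X)+
qed (rule one_carrier)

end

section \<open>Integer powers in monoids\<close>

text \<open>
  Properties of integer powers of a unit thus follow from induction on natural powers and stability
  under inverses.
\<close>

lemma int_pow_cases:
  fixes m :: int
  obtains k :: nat where "x [^]\<^bsub>G\<^esub> m = x [^]\<^bsub>G\<^esub> k" | k :: nat where "x [^]\<^bsub>G\<^esub> m = inv\<^bsub>G\<^esub> (x [^]\<^bsub>G\<^esub> k)"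
proof (cases "m < 0")
  case True
  then have "x [^]\<^bsub>G\<^esub> m = inv\<^bsub>G\<^esub> (x [^]\<^bsub>G\<^esub> nat (- m))" by (subst int_pow_def2) (rule if_P)
  then show thesis by (rule that(2))
next
  case False
  then have "x [^]\<^bsub>G\<^esub> m = x [^]\<^bsub>G\<^esub> nat m" by (subst int_pow_def2) (rule if_not_P)
  then show thesis by (rule that(1))
qed

lemma (in monoid) Units_nat_pow_closed: "x \<in> Units G \<Longrightarrow> x [^] (k :: nat) \<in> Units G"
  by (induction k) simp_all

lemma (in monoid) mult_Units_hom:
  assumes T: "\<And>x y. x \<in> carrier G \<Longrightarrow> y \<in> carrier G \<Longrightarrow> T (x \<otimes> y) = T x \<otimes> T y"
    and closed: "\<And>x. x \<in> carrier G \<Longrightarrow> T x \<in> carrier G" and one: "T \<one> = \<one>"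
    and x: "x \<in> Units G"
  shows "T x \<in> Units G" and "T (inv x) = inv (T x)"
proof -
  have *: "T x \<otimes> T (inv x) = \<one>" "T (inv x) \<otimes> T x = \<one>"
    using T[of x "inv x"] T[of "inv x" x] x Units_closed[OF x] one by simp_all
  then show "T x \<in> Units G"
    using closed[OF Units_closed[OF x]] closed[OF Units_inv_closed[OF x]] unfolding Units_def by blast
  show "T (inv x) = inv (T x)"
    using * closed[OF Units_closed[OF x]] closed[OF Units_inv_closed[OF x]] by (simp add: inv_char)
qed

lemma (in monoid) fixed_int_pow:
  assumes T: "\<And>x y. x \<in> carrier G \<Longrightarrow> y \<in> carrier G \<Longrightarrow> T (x \<otimes> y) = T x \<otimes> T y"
    and closed: "\<And>x. x \<in> carrier G \<Longrightarrow> T x \<in> carrier G" and one: "T \<one> = \<one>"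
    and x: "x \<in> Units G" and fixed: "T x = x"
  shows "T (x [^] (m :: int)) = x [^] m"
proof -
  have *: "T (x [^] (k :: nat)) = x [^] k" for k
  proof (induction k)
    case (Suc k)
    then show ?case using T[of "x [^] k" x] fixed Units_closed[OF x] by simp
  qed (simp add: one)
  have "T (inv (x [^] k)) = inv (x [^] k)" for k :: nat
    using mult_Units_hom(2)[of T "x [^] k"] T closed one Units_nat_pow_closed[OF x] * by metis
  with * show ?thesis by (cases rule: int_pow_cases[of G x m]) simp_all
qed

lemma (in monoid) Units_int_pow_closed: "x \<in> Units G \<Longrightarrow> x [^] (m :: int) \<in> Units G"
  by (cases rule: int_pow_cases[of G x m]) (simp_all add: Units_nat_pow_closed)

lemma (in monoid) commutes_inv:
  assumes "x \<in> Units G" "y \<in> carrier G" "x \<otimes> y = y \<otimes> x"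
  shows "inv x \<otimes> y = y \<otimes> inv x"
proof -
  have "inv x \<otimes> y = inv x \<otimes> (y \<otimes> x) \<otimes> inv x"
    using assms(1,2) by (simp add: m_assoc Units_closed)
  also have "\<dots> = y \<otimes> inv x"
    using assms(1,2) unfolding assms(3)[symmetric] by (simp add: Units_closed flip: m_assoc)
  finally show ?thesis .
qed

lemma (in monoid) commutes_int_pow:
  assumes x: "x \<in> Units G" and y: "y \<in> carrier G" and c: "x \<otimes> y = y \<otimes> x"
  shows "x [^] (m :: int) \<otimes> y = y \<otimes> x [^] m"
proof -
  have *: "x [^] (k :: nat) \<otimes> y = y \<otimes> x [^] k" for k
  proof (induction k)
    case (Suc k)
    have "x [^] k \<otimes> x \<otimes> y = x [^] k \<otimes> y \<otimes> x" using x y c by (simp add: m_assoc Units_closed)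
    with Suc show ?case using x y by (simp add: m_assoc Units_closed)
  qed (use y in simp)
  show ?thesis
    using * commutes_inv[OF Units_nat_pow_closed[OF x] y *] by (cases rule: int_pow_cases[of G x m]) simp_all
qed

lemma (in monoid) conjugates_commute:
  assumes "p \<in> Units G" "w \<in> carrier G" "l \<in> carrier G" "w \<otimes> l = l \<otimes> w"
  shows "(inv p \<otimes> w \<otimes> p) \<otimes> (inv p \<otimes> l \<otimes> p) = (inv p \<otimes> l \<otimes> p) \<otimes> (inv p \<otimes> w \<otimes> p)"
proof -
  have *: "(inv p \<otimes> v \<otimes> p) \<otimes> (inv p \<otimes> k \<otimes> p) = inv p \<otimes> (v \<otimes> k) \<otimes> p"
    if "v \<in> carrier G" "k \<in> carrier G" for v k
  proof -
    have "p \<otimes> (inv p \<otimes> k \<otimes> p) = k \<otimes> p"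
      using assms(1) that by (simp add: Units_closed flip: m_assoc)
    then show ?thesis using assms(1) that by (simp add: m_assoc Units_closed)
  qed
  show ?thesis using assms by (simp add: *)
qed

section \<open>Parity and flip on the tensor square\<close>

lemma koszul_2: "koszul [a, b] [c, d] = (ksgn (b * c) :: 'k::field)"
  by (simp add: koszul_def lessThan_Suc)

lemma koszul_3: "koszul [a, b, c] [d, e, f] = (ksgn (b * d) * ksgn (c * d) * ksgn (c * e) :: 'k::field)"
  by (simp add: koszul_def lessThan_Suc mult_ac)

context superalgebra
begin

lemma homogeneous_eq2:
  assumes "multilinear 2 F" "multilinear 2 G"
    and "\<And>x y d e. x \<in> gr d \<Longrightarrow> y \<in> gr e \<Longrightarrow> F [x, y] = G [x, y]" and "length xs = 2"
  shows "F xs = G xs"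
proof (rule multilinear_homogeneous_eq[OF assms(1,2) _ assms(4)])
  fix xs ds assume "length xs = 2" "of_degrees xs ds"
  then show "F xs = G xs" using assms(3) by (auto elim!: length2E simp: list_all2_Cons1)
qed

lemma homogeneous_eq3:
  assumes "multilinear 3 F" "multilinear 3 G"
    and "\<And>x y z d e f. x \<in> gr d \<Longrightarrow> y \<in> gr e \<Longrightarrow> z \<in> gr f \<Longrightarrow> F [x, y, z] = G [x, y, z]"
    and "length xs = 3"
  shows "F xs = G xs"
proof (rule multilinear_homogeneous_eq[OF assms(1,2) _ assms(4)])
  fix xs ds assume "length xs = 3" "of_degrees xs ds"
  then show "F xs = G xs" using assms(3) by (auto elim!: length3E simp: list_all2_Cons1)
qed

lemma product_form_2:
  assumes "multilinear 2 F" "x \<in> gr d" "y \<in> gr e" "x' \<in> gr d'" "y' \<in> gr e'"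
  shows "product_form 2 F [x, y] [x', y'] = ksgn (e * d') * F [x * x', y * y']"
  using product_form_homogeneous[OF assms(1), of "[x, y]" "[d, e]" "[x', y']" "[d', e']"] assms
  by (simp add: koszul_2)

lemma product_form_3:
  assumes "multilinear 3 F" "x \<in> gr d" "y \<in> gr e" "z \<in> gr f" "x' \<in> gr d'" "y' \<in> gr e'" "z' \<in> gr f'"
  shows "product_form 3 F [x, y, z] [x', y', z'] =
    ksgn (e * d') * ksgn (f * d') * ksgn (f * e') * F [x * x', y * y', z * z']"
  using product_form_homogeneous[OF assms(1), of "[x, y, z]" "[d, e, f]" "[x', y', z']" "[d', e', f']"] assms
  by (simp add: koszul_3)

lemma contract_TP_gr:
  assumes X: "X \<in> TP_gr n k" and F: "multilinear n F" and G: "multilinear n G"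
    and eq: "\<And>xs ds. length xs = n \<Longrightarrow> of_degrees xs ds \<Longrightarrow> sum_list ds = k \<Longrightarrow> F xs = G xs"
  shows "contract F X = contract G X"
proof -
  obtain p where p: "X = cls n p"
    "\<And>xs. xs \<in> Poly_Mapping.keys p \<Longrightarrow> \<exists>ds. length xs = n \<and> of_degrees xs ds \<and> sum_list ds = k"
    using X unfolding TP_gr_def by blast
  then have "p \<in> formals n" by (auto simp: formals_def)
  moreover have "linext (*) F p = linext (*) G p"
    unfolding linext_def using p(2) eq by (intro sum.cong refl) (metis (no_types))
  ultimately show ?thesis using F G p(1) by (simp add: contract_cls)
qed

lemma contract_TP_gr2:
  assumes "X \<in> TP_gr 2 k" "multilinear 2 F" "multilinear 2 G"
    and "\<And>x y d e. x \<in> gr d \<Longrightarrow> y \<in> gr e \<Longrightarrow> d + e = k \<Longrightarrow> F [x, y] = G [x, y]"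
  shows "contract F X = contract G X"
proof (rule contract_TP_gr[OF assms(1-3)])
  fix xs ds assume "length xs = 2" "of_degrees xs ds" "sum_list ds = k"
  then show "F xs = G xs" using assms(4) by (auto elim!: length2E simp: list_all2_Cons1)
qed

text \<open>
  A criterion for multiplicativity of a map on tensors that acts on homogeneous words by a rearrangement
  \<open>t\<close> with sign \<open>c\<close>: the assumption \<open>sign\<close> says that the signs are compatible with the Koszul rule.
\<close>

lemma tmap_mult:
  assumes formal: "\<And>xs. length xs = n \<Longrightarrow> G xs \<in> formals n"
    and ml: "\<And>F. multilinear n F \<Longrightarrow> multilinear n (\<lambda>xs. linext (*) F (G xs))"
    and hom: "\<And>F xs ds. multilinear n F \<Longrightarrow> length xs = n \<Longrightarrow> of_degrees xs ds \<Longrightarrow>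
        linext (*) F (G xs) = c ds * F (t xs)"
    and t: "\<And>xs ds. length xs = n \<Longrightarrow> of_degrees xs ds \<Longrightarrow> length (t xs) = n \<and> of_degrees (t xs) (t' ds)"
    and t_mult: "\<And>xs ys. length xs = n \<Longrightarrow> length ys = n \<Longrightarrow> t (map2 (*) xs ys) = map2 (*) (t xs) (t ys)"
    and sign: "\<And>ds es. length ds = n \<Longrightarrow> length es = n \<Longrightarrow>
        koszul ds es * c (map2 (+) ds es) = c ds * (c es * koszul (t' ds) (t' es))"
    and X: "X \<in> carrier (TP n)" and Y: "Y \<in> carrier (TP n)"
  shows "tmap n G (X \<otimes>\<^bsub>TP n\<^esub> Y) = tmap n G X \<otimes>\<^bsub>TP n\<^esub> tmap n G Y"
proof (rule tensor_eqI[where n = n])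
  note closed = tmap_carrier[where n = n, OF _ formal]
  show "tmap n G (X \<otimes>\<^bsub>TP n\<^esub> Y) \<in> carrier (TP n)" by (rule closed[OF mult_carrier[OF X Y]])
  show "tmap n G X \<otimes>\<^bsub>TP n\<^esub> tmap n G Y \<in> carrier (TP n)" by (rule mult_carrier[OF closed[OF X] closed[OF Y]])
  fix F assume F: "multilinear n F"
  let ?H = "\<lambda>xs ys. linext (*) (\<lambda>v. linext (*) (product_form n F v) (G ys)) (G xs)"
  let ?K = "product_form n (\<lambda>v. linext (*) F (G v))"
  \<comment> \<open>\<open>?K\<close> and \<open>?H\<close> are the forms in two words that describe the two sides.\<close>
  have ml1: "multilinear n (\<lambda>v. linext (*) (product_form n F v) (G ys))" if "length ys = n" for ys
    unfolding linext_def using formal[OF that] F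
    by (intro multilinear_sum multilinear_cmult multilinear_product_left) (auto simp: formals_def)
  have ml2: "multilinear n (\<lambda>ys. ?H xs ys)" if "length xs = n" for xs
    unfolding linext_def[of _ _ "G xs"] using formal[OF that] F
    by (intro multilinear_sum multilinear_cmult ml multilinear_product_right) (auto simp: formals_def)
  have eq: "?K xs ys = ?H xs ys" if "length xs = n" "length ys = n" for xs ys
  proof -
    have *: "?K xs ys = ?H xs ys"
      if xs: "length xs = n" "of_degrees xs ds" and ys: "length ys = n" "of_degrees ys es" for xs ys ds es
    proof -
      have l: "length ds = n" "length es = n" using that by (auto dest: list_all2_lengthD)
      have "?K xs ys = koszul ds es * (c (map2 (+) ds es) * F (map2 (*) (t xs) (t ys)))"
        using product_form_homogeneous[OF ml[OF F] xs(2,1) ys(2,1)]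
          hom[OF F _ of_degrees_mult[OF xs(2) ys(2)]] xs ys by (simp add: t_mult)
      also have "\<dots> = c ds * (c es * (koszul (t' ds) (t' es) * F (map2 (*) (t xs) (t ys))))"
        using arg_cong[OF sign[OF l], of "\<lambda>z. z * F (map2 (*) (t xs) (t ys))"] by (simp add: mult.assoc)
      also have "\<dots> = ?H xs ys"
        using t[OF xs] t[OF ys]
        by (simp add: hom[OF ml1[OF ys(1)] xs] hom[OF multilinear_product_right[OF F] ys]
            product_form_homogeneous[OF F, of "t xs" "t' ds" "t ys" "t' es"])
      finally show ?thesis .
    qed
    have **: "?K xs ys = ?H xs ys" if "length xs = n" "of_degrees xs ds" "length ys = n" for xs ys ds
      by (rule multilinear_homogeneous_eq[OF multilinear_product_right[OF ml[OF F] that(1)] ml2[OF that(1)]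
            *[OF that(1,2)] that(3)])
    show ?thesis
      by (rule multilinear_homogeneous_eq[OF multilinear_product_left[OF ml[OF F] that(2)] ml[OF ml1[OF that(2)]]
            **[OF _ _ that(2)] that(1)])
  qed
  have "contract F (tmap n G (X \<otimes>\<^bsub>TP n\<^esub> Y)) = contract (\<lambda>xs. contract (?K xs) Y) X"
    by (simp add: contract_tmap[OF mult_carrier[OF X Y] formal F] contract_mult[OF X Y] ml F)
  also have "\<dots> = contract (\<lambda>xs. contract (?H xs) Y) X"
    by (intro contract_cong[OF X] contract_cong[OF Y] eq)
  also have "\<dots> = contract (\<lambda>xs. linext (*) (\<lambda>v. contract (\<lambda>ys. linext (*) (product_form n F v) (G ys)) Y) (G xs)) X"
    unfolding linext_def[of _ _ "G _"] contract_sum contract_mult_left ..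
  also have "\<dots> = contract (\<lambda>xs. linext (*) (\<lambda>v. contract (product_form n F v) (tmap n G Y)) (G xs)) X"
  proof (intro contract_cong[OF X])
    fix xs :: "'a list" assume "length xs = n"
    then show "linext (*) (\<lambda>v. contract (\<lambda>ys. linext (*) (product_form n F v) (G ys)) Y) (G xs) =
      linext (*) (\<lambda>v. contract (product_form n F v) (tmap n G Y)) (G xs)"
      unfolding linext_def[of _ _ "G xs"] using formal[of xs]
      by (intro sum.cong refl arg_cong2[of _ _ _ _ "(*)"] contract_tmap[OF Y formal, symmetric] multilinear_product_right F)
        (auto simp: formals_def)
  qed
  also have "\<dots> = contract F (tmap n G X \<otimes>\<^bsub>TP n\<^esub> tmap n G Y)"
    by (simp add: contract_mult closed X Y F contract_tmap[OF X formal] multilinear_contract_product_left)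
  finally show "contract F (tmap n G (X \<otimes>\<^bsub>TP n\<^esub> Y)) = contract F (tmap n G X \<otimes>\<^bsub>TP n\<^esub> tmap n G Y)" .
qed

text \<open>
  What an element \<open>a\<close> turns into, up to reordering, when it moves past an element of degree \<open>e\<close>.
  For \<open>e = 1\<close> this is the parity automorphism.  Evenness of a tensor is expressed below as
  invariance under \<open>parity_at\<close> because invariance, unlike membership in a graded part, passes
  to inverses at once.
\<close>

definition twist :: "bit \<Rightarrow> 'a \<Rightarrow> 'a" where
  "twist e a = gproj 0 a + ksgn e *s gproj 1 a"

lemma twist_homogeneous: "a \<in> gr d \<Longrightarrow> twist e a = ksgn (e * d) *s a"
  by (cases d) (simp_all add: twist_def gproj_homogeneous)

lemma twist_add: "twist e (a + b) = twist e a + twist e b"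
  by (simp add: twist_def gproj_add scale_right_distrib)

lemma twist_scale: "twist e (c *s a) = c *s twist e a"
  by (simp add: twist_def gproj_scale scale_right_distrib mult.commute)

lemma multilinear_twist:
  assumes "multilinear n F"
  shows "multilinear n (\<lambda>xs. F (map (twist e) xs))"
  using assms by (intro multilinearI) (simp_all add: map_update twist_add twist_scale multilinear_add multilinear_scale)

lemma multilinear_scale2:
  assumes "multilinear 2 F"
  shows "F [c *s x, d *s y] = c * d * F [x, y]"
  by (simp add: multilinear2D[OF assms])

lemma twist_form:
  assumes "multilinear 2 F" "x \<in> gr d" "y \<in> gr d'"
  shows "F (map (twist e) [x, y]) = ksgn (e * (d + d')) * F [x, y]"
  using assms by (simp add: twist_homogeneous multilinear_scale2 ksgn_mult_add)

abbreviation parity_at :: "bit \<Rightarrow> ('a, 'k) tensor \<Rightarrow> ('a, 'k) tensor" where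
  "parity_at e \<equiv> tmap 2 (\<lambda>xs. word (map (twist e) xs))"

lemma parity_carrier: "X \<in> carrier (TP 2) \<Longrightarrow> parity_at e X \<in> carrier (TP 2)"
  by (rule tmap_carrier) simp_all

lemma contract_parity:
  "X \<in> carrier (TP 2) \<Longrightarrow> multilinear 2 F \<Longrightarrow> contract F (parity_at e X) = contract (\<lambda>xs. F (map (twist e) xs)) X"
  by (subst contract_tmap[where n = 2]) simp_all

lemma parity_mult:
  assumes "X \<in> carrier (TP 2)" "Y \<in> carrier (TP 2)"
  shows "parity_at e (X \<otimes>\<^bsub>TP 2\<^esub> Y) = parity_at e X \<otimes>\<^bsub>TP 2\<^esub> parity_at e Y"
proof (rule tmap_mult[where c = "\<lambda>ds. ksgn (e * sum_list ds)" and t = "\<lambda>xs. xs" and t' = "\<lambda>xs. xs"])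
  fix F xs ds assume "multilinear 2 F" "length xs = 2" "of_degrees xs ds"
  then show "linext (*) F (word (map (twist e) xs)) = ksgn (e * sum_list ds) * F xs"
    by (auto elim!: length2E simp: list_all2_Cons1 twist_form simp del: list.map)
next
  fix ds es :: "bit list" assume "length ds = 2" "length es = 2"
  then show "koszul ds es * ksgn (e * sum_list (map2 (+) ds es)) =
      ksgn (e * sum_list ds) * (ksgn (e * sum_list es) * koszul ds es :: 'k)"
    by (elim length2E) (simp add: ksgn_mult_add)
qed (use assms in \<open>simp_all add: multilinear_twist\<close>)

lemma parity_one: "parity_at e \<one>\<^bsub>TP 2\<^esub> = \<one>\<^bsub>TP 2\<^esub>"
proof (rule tensor_eqI[OF parity_carrier[OF one_carrier] one_carrier])
  fix F :: "'a list \<Rightarrow> 'k" assume F: "multilinear 2 F"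
  show "contract F (parity_at e \<one>\<^bsub>TP 2\<^esub>) = contract F \<one>\<^bsub>TP 2\<^esub>"
    using F by (simp add: contract_parity one_carrier contract_one multilinear_twist twist_homogeneous[OF one_even])
qed

abbreviation flip :: "('a, 'k) tensor \<Rightarrow> ('a, 'k) tensor" where
  "flip \<equiv> swap_at 2 0"

text \<open>
  The pullback of a form along the graded flip.
\<close>

definition flip_form :: "('a list \<Rightarrow> 'k) \<Rightarrow> 'a list \<Rightarrow> 'k" where
  "flip_form F xs = (\<Sum>d\<in>UNIV. \<Sum>e\<in>UNIV. ksgn (d * e) * F [gproj e (xs ! 1), gproj d (xs ! 0)])"

lemma multilinear_flip:
  assumes "multilinear 2 F" shows "multilinear 2 (flip_form F)"
  unfolding flip_form_def
  by (intro multilinear_sum multilinear_cmult multilinear2I)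
    (simp_all add: gproj_add gproj_scale multilinear2D[OF assms])

lemma flip_form_homogeneous:
  assumes F: "multilinear 2 F" and xy: "x \<in> gr d" "y \<in> gr e"
  shows "flip_form F [x, y] = ksgn (d * e) * F [y, x]"
proof -
  have "F [0, a] = 0" "F [a, 0] = 0" for a
    using multilinear_zero[OF F, of "[0, a]" 0] multilinear_zero[OF F, of "[a, 0]" 1] by simp_all
  then show ?thesis using xy
    by (cases d; cases e) (simp_all add: flip_form_def UNIV_bit gproj_homogeneous)
qed

abbreviation (input) flip_word :: "'a list \<Rightarrow> ('a, 'k) formal" where
  "flip_word \<equiv> \<lambda>xs. \<Sum>d\<in>UNIV. \<Sum>e\<in>UNIV. fscale (ksgn (d * e))
     (word (take 0 xs @ [gproj e (xs ! Suc 0), gproj d (xs ! 0)] @ drop (0 + 2) xs))"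

lemma flip_word_formals: "length xs = 2 \<Longrightarrow> flip_word xs \<in> formals 2"
  by (intro formal.subspace_sum[OF formals_subspace] formal.subspace_scale[OF formals_subspace]) simp

lemma linext_flip_word: "length xs = 2 \<Longrightarrow> linext (*) F (flip_word xs) = flip_form F xs"
  by (simp add: flip_form_def field_space.linext_sum field_space.linext_fscale)

lemma flip_carrier: "X \<in> carrier (TP 2) \<Longrightarrow> flip X \<in> carrier (TP 2)"
  unfolding swap_at_def by (rule tmap_carrier[where n = 2]) (simp, rule flip_word_formals)

lemma contract_flip:
  assumes "X \<in> carrier (TP 2)" "multilinear 2 F"
  shows "contract F (flip X) = contract (flip_form F) X"
  unfolding swap_at_def
  by (subst contract_tmap[OF assms(1) flip_word_formals assms(2)], assumption)
     (intro contract_cong[OF assms(1)] linext_flip_word)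

lemma multilinear_cong:
  assumes "\<And>xs. length xs = n \<Longrightarrow> F xs = G xs" shows "multilinear n F \<longleftrightarrow> multilinear n G"
  using assms by (simp add: multilinear_def)

lemma flip_mult:
  assumes "X \<in> carrier (TP 2)" "Y \<in> carrier (TP 2)"
  shows "flip (X \<otimes>\<^bsub>TP 2\<^esub> Y) = flip X \<otimes>\<^bsub>TP 2\<^esub> flip Y"
  unfolding swap_at_def
proof (rule tmap_mult[where c = "\<lambda>ds. ksgn (ds ! 0 * ds ! 1)" and t = rev and t' = rev, OF flip_word_formals])
  fix F :: "'a list \<Rightarrow> 'k" assume "multilinear 2 F"
  then have "multilinear 2 (flip_form F)" by (rule multilinear_flip)
  then show "multilinear 2 (\<lambda>xs. linext (*) F (flip_word xs))"
    by (rule multilinear_cong[THEN iffD2, rotated]) (rule linext_flip_word)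
next
  fix F xs ds assume "multilinear 2 F" "length xs = 2" "of_degrees xs ds"
  then show "linext (*) F (flip_word xs) = ksgn (ds ! 0 * ds ! 1) * F (rev xs)"
    unfolding linext_flip_word[OF \<open>length xs = 2\<close>]
    by (auto elim!: length2E simp: list_all2_Cons1 flip_form_homogeneous)
next
  fix xs ds assume "length xs = 2" "of_degrees xs ds"
  then show "length (rev xs) = 2 \<and> of_degrees (rev xs) (rev ds)" by simp
next
  fix xs ys :: "'a list" assume "length xs = 2" "length ys = 2"
  then show "rev (map2 (*) xs ys) = map2 (*) (rev xs) (rev ys)" by (elim length2E) simp
next
  fix ds es :: "bit list" assume "length ds = 2" "length es = 2"
  then obtain d d' e e' where [simp]: "ds = [d, d']" "es = [e, e']" by (elim length2E)
  show "koszul ds es * ksgn (map2 (+) ds es ! 0 * map2 (+) ds es ! 1) =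
      ksgn (ds ! 0 * ds ! 1) * (ksgn (es ! 0 * es ! 1) * koszul (rev ds) (rev es) :: 'k)"
    by (cases d; cases d'; cases e; cases e') (simp_all add: koszul_2 ksgn_def)
qed (use assms in simp_all)

lemma flip_flip:
  assumes X: "X \<in> carrier (TP 2)" shows "flip (flip X) = X"
proof (rule tensor_eqI[OF flip_carrier[OF flip_carrier[OF X]] X])
  fix F :: "'a list \<Rightarrow> 'k" assume F: "multilinear 2 F"
  have "flip_form (flip_form F) xs = F xs" if "length xs = 2" for xs
  proof (rule homogeneous_eq2[OF multilinear_flip[OF multilinear_flip[OF F]] F _ that])
    fix x y d e assume "x \<in> gr d" "y \<in> gr e"
    then show "flip_form (flip_form F) [x, y] = F [x, y]"
      by (simp add: flip_form_homogeneous multilinear_flip F mult.commute[of e d] flip: mult.assoc)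
  qed
  then show "contract F (flip (flip X)) = contract F X"
    unfolding contract_flip[OF flip_carrier[OF X] F] contract_flip[OF X multilinear_flip[OF F]]
    by (intro contract_cong[OF X])
qed

lemma flip_one: "flip \<one>\<^bsub>TP 2\<^esub> = \<one>\<^bsub>TP 2\<^esub>"
proof (rule tensor_eqI[OF flip_carrier[OF one_carrier] one_carrier])
  fix F :: "'a list \<Rightarrow> 'k" assume F: "multilinear 2 F"
  show "contract F (flip \<one>\<^bsub>TP 2\<^esub>) = contract F \<one>\<^bsub>TP 2\<^esub>"
    using flip_form_homogeneous[OF F one_even one_even]
    by (simp add: contract_flip one_carrier contract_one multilinear_flip F replicate_2)
qed

end

section \<open>Iterated coproducts and inserted units\<close>

context superalgebra
begin

lemma multilinear_append1: "multilinear 3 F \<Longrightarrow> multilinear 2 (\<lambda>ys. F (ys @ [x]))"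
  by (rule multilinear2I) (simp_all add: multilinear3D)

lemma multilinear_Cons: "multilinear 3 F \<Longrightarrow> multilinear 2 (\<lambda>ys. F (x # ys))"
  by (rule multilinear2I) (simp_all add: multilinear3D)

lemma homogeneous_eq22:
  assumes A: "\<And>ms. length ms = 2 \<Longrightarrow> multilinear 2 (\<lambda>ys. A ys ms)" "\<And>ys. length ys = 2 \<Longrightarrow> multilinear 2 (A ys)"
    and B: "\<And>ms. length ms = 2 \<Longrightarrow> multilinear 2 (\<lambda>ys. B ys ms)" "\<And>ys. length ys = 2 \<Longrightarrow> multilinear 2 (B ys)"
    and eq: "\<And>a b p q d d' i j. a \<in> gr d \<Longrightarrow> b \<in> gr d' \<Longrightarrow> p \<in> gr i \<Longrightarrow> q \<in> gr j \<Longrightarrow> A [a, b] [p, q] = B [a, b] [p, q]"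
    and len: "length ys = 2" "length ms = 2"
  shows "A ys ms = B ys ms"
proof (rule homogeneous_eq2[OF A(1)[OF len(2)] B(1)[OF len(2)] _ len(1)])
  fix a b d d' assume "a \<in> gr d" "b \<in> gr d'"
  then show "A [a, b] ms = B [a, b] ms"
    by (intro homogeneous_eq2[OF A(2) B(2) _ len(2)] eq) simp_all
qed

text \<open>
  Both legs of \<open>ms\<close> have to pass the third factor \<open>x\<close>, whence the twist.  When \<open>x\<close> stands in the second
  tensor instead, nothing passes it.
\<close>

lemma product_last_unit_right:
  assumes F: "multilinear 3 F" and x: "x \<in> gr e" and len: "length ys = 2" "length ms = 2"
  shows "product_form 3 F (ys @ [x]) (ms @ [1]) = product_form 2 (\<lambda>w. F (w @ [x])) ys (map (twist e) ms)"
proof -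
  note F2 = multilinear_append1[OF F]
  note ml = multilinear_append1 multilinear_product_left multilinear_product_right
    multilinear_twist[OF multilinear_product_right[OF F2]]
  show ?thesis
  proof (rule homogeneous_eq22[OF _ _ _ _ _ len, where A = "\<lambda>ys ms. product_form 3 F (ys @ [x]) (ms @ [1])"
      and B = "\<lambda>ys ms. product_form 2 (\<lambda>w. F (w @ [x])) ys (map (twist e) ms)"])
    fix a b p q d d' i j assume h: "a \<in> gr d" "b \<in> gr d'" "p \<in> gr i" "q \<in> gr j"
    have "product_form 2 (\<lambda>w. F (w @ [x])) [a, b] (map (twist e) [p, q])
        = ksgn (e * (i + j)) * (ksgn (d' * i) * F ([a * p, b * q] @ [x]))"
      using twist_form[OF multilinear_product_right[OF F2] h(3,4), of "[a, b]"] by (simp add: product_form_2[OF F2 h])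
    moreover have "product_form 3 F ([a, b] @ [x]) ([p, q] @ [1]) =
        ksgn (d' * i) * ksgn (e * i) * ksgn (e * j) * F [a * p, b * q, x * 1]"
      using product_form_3[OF F h(1,2) x h(3,4) one_even] by simp
    ultimately show "product_form 3 F ([a, b] @ [x]) ([p, q] @ [1]) =
        product_form 2 (\<lambda>w. F (w @ [x])) [a, b] (map (twist e) [p, q])"
      by (simp add: ksgn_mult_add)
  next
    show "multilinear 2 (\<lambda>ys. product_form 3 F (ys @ [x]) (ms @ [1]))" if "length ms = 2" for ms
      by (rule multilinear_append1[OF multilinear_product_left[OF F]]) (simp add: that)
    show "multilinear 2 (\<lambda>ms. product_form 3 F (ys @ [x]) (ms @ [1]))" if "length ys = 2" for ys
      by (rule multilinear_append1[OF multilinear_product_right[OF F]]) (simp add: that)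
  qed (simp_all add: multilinear_product_left[OF F2] multilinear_twist multilinear_product_right[OF F2])
qed

lemma product_last_unit_left:
  assumes F: "multilinear 3 F" and len: "length ys = 2" "length ms = 2" and x: "x \<in> gr e"
  shows "product_form 3 F (ms @ [1]) (ys @ [x]) = product_form 2 (\<lambda>w. F (w @ [x])) ms ys"
proof (rule homogeneous_eq22[OF _ _ _ _ _ len, where A = "\<lambda>ys ms. product_form 3 F (ms @ [1]) (ys @ [x])"
      and B = "\<lambda>ys ms. product_form 2 (\<lambda>w. F (w @ [x])) ms ys"])
  note F2 = multilinear_append1[OF F]
  {
    fix a b p q d d' i j assume h: "a \<in> gr d" "b \<in> gr d'" "p \<in> gr i" "q \<in> gr j"
    show "product_form 3 F ([p, q] @ [1]) ([a, b] @ [x]) = product_form 2 (\<lambda>w. F (w @ [x])) [p, q] [a, b]"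
      using product_form_3[OF F h(3,4) one_even h(1,2) x] product_form_2[OF F2 h(3,4) h(1,2)] by simp
  }
  show "multilinear 2 (\<lambda>ys. product_form 3 F (ms @ [1]) (ys @ [x]))" if "length ms = 2" for ms
    by (rule multilinear_append1[OF multilinear_product_right[OF F]]) (simp add: that)
  show "multilinear 2 (\<lambda>ms. product_form 3 F (ms @ [1]) (ys @ [x]))" if "length ys = 2" for ys
    by (rule multilinear_append1[OF multilinear_product_left[OF F]]) (simp add: that)
qed (simp_all add: multilinear_product_left multilinear_product_right multilinear_append1[OF F])

text \<open>
  The mirror image: the twist now comes from the first factor \<open>x\<close>, which has to pass both legs of \<open>ms\<close>.
\<close>

lemma product_first_unit_left:
  assumes F: "multilinear 3 F" and x: "x \<in> gr e" and len: "length ys = 2" "length ms = 2"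
  shows "product_form 3 F (1 # ms) (x # ys) = product_form 2 (\<lambda>w. F (x # w)) (map (twist e) ms) ys"
proof (rule homogeneous_eq22[OF _ _ _ _ _ len, where A = "\<lambda>ys ms. product_form 3 F (1 # ms) (x # ys)"
      and B = "\<lambda>ys ms. product_form 2 (\<lambda>w. F (x # w)) (map (twist e) ms) ys"])
  note F2 = multilinear_Cons[OF F]
  {
    fix a b p q d d' i j assume h: "a \<in> gr d" "b \<in> gr d'" "p \<in> gr i" "q \<in> gr j"
    have "product_form 2 (\<lambda>w. F (x # w)) (map (twist e) [p, q]) [a, b]
        = ksgn (e * (i + j)) * (ksgn (j * d) * F (x # [p * a, q * b]))"
      using twist_form[OF multilinear_product_left[OF F2, of "[a, b]"] h(3,4)] by (simp add: product_form_2[OF F2 h(3,4) h(1,2)])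
    moreover have "product_form 3 F (1 # [p, q]) (x # [a, b]) =
        ksgn (i * e) * ksgn (j * e) * ksgn (j * d) * F [1 * x, p * a, q * b]"
      using product_form_3[OF F one_even h(3,4) x h(1,2)] by simp
    ultimately show "product_form 3 F (1 # [p, q]) (x # [a, b]) =
        product_form 2 (\<lambda>w. F (x # w)) (map (twist e) [p, q]) [a, b]"
      by (simp add: ksgn_mult_add mult.commute[of _ e])
  }
  show "multilinear 2 (\<lambda>ys. product_form 3 F (1 # ms) (x # ys))" if "length ms = 2" for ms
    by (rule multilinear_Cons[OF multilinear_product_right[OF F]]) (simp add: that)
  show "multilinear 2 (\<lambda>ms. product_form 3 F (1 # ms) (x # ys))" if "length ys = 2" for ys
    by (rule multilinear_Cons[OF multilinear_product_left[OF F]]) (simp add: that)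
  show "multilinear 2 (\<lambda>ms. product_form 2 (\<lambda>w. F (x # w)) (map (twist e) ms) ys)" if "length ys = 2" for ys
    by (rule multilinear_twist[OF multilinear_product_left[OF F2 that]])
qed (simp_all add: multilinear_product_right multilinear_Cons[OF F])

lemma product_first_unit_right:
  assumes F: "multilinear 3 F" and len: "length ys = 2" "length ms = 2" and x: "x \<in> gr e"
  shows "product_form 3 F (x # ys) (1 # ms) = product_form 2 (\<lambda>w. F (x # w)) ys ms"
proof (rule homogeneous_eq22[OF _ _ _ _ _ len, where A = "\<lambda>ys ms. product_form 3 F (x # ys) (1 # ms)"
      and B = "\<lambda>ys ms. product_form 2 (\<lambda>w. F (x # w)) ys ms"])
  note F2 = multilinear_Cons[OF F]
  {
    fix a b p q d d' i j assume h: "a \<in> gr d" "b \<in> gr d'" "p \<in> gr i" "q \<in> gr j"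
    show "product_form 3 F (x # [a, b]) (1 # [p, q]) = product_form 2 (\<lambda>w. F (x # w)) [a, b] [p, q]"
      using product_form_3[OF F x h(1,2) one_even h(3,4)] product_form_2[OF F2 h] by simp
  }
  show "multilinear 2 (\<lambda>ys. product_form 3 F (x # ys) (1 # ms))" if "length ms = 2" for ms
    by (rule multilinear_Cons[OF multilinear_product_left[OF F]]) (simp add: that)
  show "multilinear 2 (\<lambda>ms. product_form 3 F (x # ys) (1 # ms))" if "length ys = 2" for ys
    by (rule multilinear_Cons[OF multilinear_product_right[OF F]]) (simp add: that)
qed (simp_all add: multilinear_product_left multilinear_product_right multilinear_Cons[OF F])

lemma
  assumes "M \<in> carrier (TP 2)"
  shows unit_carrier: "i \<le> 2 \<Longrightarrow> unit_at 3 i M \<in> carrier (TP 3)"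
    and contract_unit_last: "multilinear 3 F \<Longrightarrow> contract F (unit_at 3 2 M) = contract (\<lambda>ms. F (ms @ [1])) M"
    and contract_unit_first: "multilinear 3 F \<Longrightarrow> contract F (unit_at 3 0 M) = contract (\<lambda>ms. F (1 # ms)) M"
proof -
  show "i \<le> 2 \<Longrightarrow> unit_at 3 i M \<in> carrier (TP 3)"
    unfolding unit_at_def by (rule tmap_carrier[OF assms]) simp
  show "contract F (unit_at 3 2 M) = contract (\<lambda>ms. F (ms @ [1])) M" if "multilinear 3 F"
    unfolding unit_at_def using that by (subst contract_tmap[OF assms]) (auto intro: contract_cong[OF assms])
  show "contract F (unit_at 3 0 M) = contract (\<lambda>ms. F (1 # ms)) M" if "multilinear 3 F"
    unfolding unit_at_def using that by (subst contract_tmap[OF assms]) (auto intro: contract_cong[OF assms])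
qed

end

context quasi_hopf_superalgebra
begin

lemma contract_coproduct_add:
  "multilinear 2 F \<Longrightarrow> contract F (\<Delta> (a + b)) = contract F (\<Delta> a) + contract F (\<Delta> b)"
  and contract_coproduct_scale: "multilinear 2 F \<Longrightarrow> contract F (\<Delta> (c *s a)) = c * contract F (\<Delta> a)"
  by (simp_all add: coproduct_add coproduct_scale contract_TP_add contract_TP_smult coproduct_closed)

lemma multilinear_coproduct_first:
  assumes "multilinear 3 F"
  shows "multilinear 2 (\<lambda>xs. contract (\<lambda>ys. F (ys @ [xs ! 1])) (\<Delta> (xs ! 0)))"
proof (rule multilinear2I)
  fix x x' y y' c
  note [simp] = contract_coproduct_add[OF multilinear_append1[OF assms]] contract_coproduct_scale[OF multilinear_append1[OF assms]]
  let ?G = "\<lambda>xs. contract (\<lambda>ys. F (ys @ [xs ! 1])) (\<Delta> (xs ! 0))"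
  show "?G [x + x', y] = ?G [x, y] + ?G [x', y]" "?G [c *s x, y] = c * ?G [x, y]" by simp_all
  have "contract (\<lambda>ys. F (ys @ [y + y'])) (\<Delta> x) = contract (\<lambda>ys. F (ys @ [y]) + F (ys @ [y'])) (\<Delta> x)"
    by (rule contract_cong[OF coproduct_closed]) (auto elim!: length2E simp: multilinear3D[OF assms])
  then show "?G [x, y + y'] = ?G [x, y] + ?G [x, y']" by (simp add: contract_add)
  have "contract (\<lambda>ys. F (ys @ [c *s y])) (\<Delta> x) = contract (\<lambda>ys. c * F (ys @ [y])) (\<Delta> x)"
    by (rule contract_cong[OF coproduct_closed]) (auto elim!: length2E simp: multilinear3D[OF assms])
  then show "?G [x, c *s y] = c * ?G [x, y]" by (simp add: contract_mult_left)
qed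

lemma multilinear_coproduct_second:
  assumes "multilinear 3 F"
  shows "multilinear 2 (\<lambda>xs. contract (\<lambda>ys. F (xs ! 0 # ys)) (\<Delta> (xs ! 1)))"
proof (rule multilinear2I)
  fix x x' y y' c
  note [simp] = contract_coproduct_add[OF multilinear_Cons[OF assms]] contract_coproduct_scale[OF multilinear_Cons[OF assms]]
  let ?G = "\<lambda>xs. contract (\<lambda>ys. F (xs ! 0 # ys)) (\<Delta> (xs ! 1))"
  show "?G [x, y + y'] = ?G [x, y] + ?G [x, y']" "?G [x, c *s y] = c * ?G [x, y]" by simp_all
  have "contract (\<lambda>ys. F ((x + x') # ys)) (\<Delta> y) = contract (\<lambda>ys. F (x # ys) + F (x' # ys)) (\<Delta> y)"
    by (rule contract_cong[OF coproduct_closed]) (auto elim!: length2E simp: multilinear3D[OF assms])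
  then show "?G [x + x', y] = ?G [x, y] + ?G [x', y]" by (simp add: contract_add)
  have "contract (\<lambda>ys. F ((c *s x) # ys)) (\<Delta> y) = contract (\<lambda>ys. c * F (x # ys)) (\<Delta> y)"
    by (rule contract_cong[OF coproduct_closed]) (auto elim!: length2E simp: multilinear3D[OF assms])
  then show "?G [c *s x, y] = c * ?G [x, y]" by (simp add: contract_mult_left)
qed

lemma
  assumes X: "X \<in> carrier (TP 2)"
  shows coproduct_at_carrier: "i < 2 \<Longrightarrow> coproduct_at \<Delta> 3 i X \<in> carrier (TP 3)"
    and contract_coproduct_first: "multilinear 3 F \<Longrightarrow>
      contract F (coproduct_at \<Delta> 3 0 X) = contract (\<lambda>xs. contract (\<lambda>ys. F (ys @ [xs ! 1])) (\<Delta> (xs ! 0))) X"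
    and contract_coproduct_second: "multilinear 3 F \<Longrightarrow>
      contract F (coproduct_at \<Delta> 3 1 X) = contract (\<lambda>xs. contract (\<lambda>ys. F (xs ! 0 # ys)) (\<Delta> (xs ! 1))) X"
proof -
  let ?G = "\<lambda>i xs. linext fscale (\<lambda>ys. word (take i xs @ ys @ drop (Suc i) xs)) (rep (\<Delta> (xs ! i)))"
  have closed: "?G i xs \<in> formals 3" if "i < 2" "length xs = 2" for i xs
    using that by (intro linext_formals[OF rep_formals[OF coproduct_closed]]) auto
  show "coproduct_at \<Delta> 3 i X \<in> carrier (TP 3)" if "i < 2"
    unfolding coproduct_at_def by (rule tmap_carrier[OF X]) (rule closed[OF that])
  have *: "contract F (coproduct_at \<Delta> 3 i X) = contract (\<lambda>xs. contract (\<lambda>ys. F (take i xs @ ys @ drop (Suc i) xs)) (\<Delta> (xs ! i))) X"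
    if "i < 2" "multilinear 3 F" for i
  proof -
    have "contract F (coproduct_at \<Delta> 3 i X) = contract (\<lambda>xs. linext (*) F (?G i xs)) X"
      unfolding coproduct_at_def by (rule contract_tmap[OF X closed[OF that(1)] that(2)])
    then show ?thesis by (simp add: field_space.linext_linext contract_def)
  qed
  show "contract F (coproduct_at \<Delta> 3 0 X) = contract (\<lambda>xs. contract (\<lambda>ys. F (ys @ [xs ! 1])) (\<Delta> (xs ! 0))) X"
    if "multilinear 3 F"
    by (subst *[OF _ that]) (simp, rule contract_cong[OF X], auto elim!: length2E)
  show "contract F (coproduct_at \<Delta> 3 1 X) = contract (\<lambda>xs. contract (\<lambda>ys. F (xs ! 0 # ys)) (\<Delta> (xs ! 1))) X"
    if "multilinear 3 F"
    by (subst *[OF _ that]) (simp, rule contract_cong[OF X], auto elim!: length2E)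
qed

text \<open>
  On \<open>\<Delta>(x\<^sub>0) \<otimes> x\<^sub>1\<close> the claim is the hypothesis for \<open>\<Delta>(x\<^sub>0)\<close> in the first two factors, once the evenness of
  \<open>M\<close> has removed the sign produced by \<open>x\<^sub>1\<close>.
\<close>

lemma coproduct_first_commutes:
  assumes M: "M \<in> carrier (TP 2)" and even: "\<And>e. parity_at e M = M"
    and comm: "\<And>a. M \<otimes>\<^bsub>TP 2\<^esub> \<Delta> a = \<Delta> a \<otimes>\<^bsub>TP 2\<^esub> M" and X: "X \<in> carrier (TP 2)"
  shows "unit_at 3 2 M \<otimes>\<^bsub>TP 3\<^esub> coproduct_at \<Delta> 3 0 X = coproduct_at \<Delta> 3 0 X \<otimes>\<^bsub>TP 3\<^esub> unit_at 3 2 M"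
    (is "?W \<otimes>\<^bsub>_\<^esub> ?L = _")
proof (rule tensor_eqI[where n = 3])
  have W: "?W \<in> carrier (TP 3)" and L: "?L \<in> carrier (TP 3)"
    by (simp_all add: unit_carrier[OF M] coproduct_at_carrier[OF X])
  then show "?W \<otimes>\<^bsub>TP 3\<^esub> ?L \<in> carrier (TP 3)" "?L \<otimes>\<^bsub>TP 3\<^esub> ?W \<in> carrier (TP 3)"
    by (simp_all add: mult_carrier)
  fix F :: "'a list \<Rightarrow> 'k" assume F: "multilinear 3 F"
  define H where "H v = contract (product_form 3 F v) ?W" for v
  define H' where "H' v = contract (\<lambda>ms. product_form 3 F (ms @ [1]) v) M" for v
  have H: "multilinear 3 H"
    unfolding H_def by (rule multilinear_contract_product_left[OF F W])
  have H': "multilinear 3 H'"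
    unfolding H'_def by (rule multilinear_contract[OF M]) (simp add: multilinear_product_right[OF F])
  have "contract F (?W \<otimes>\<^bsub>TP 3\<^esub> ?L) = contract (\<lambda>ms. contract (product_form 3 F (ms @ [1])) ?L) M"
    by (simp add: contract_mult[OF W L F] contract_unit_last[OF M] multilinear_contract_product_left F L)
  also have "\<dots> = contract H' ?L"
    unfolding H'_def by (rule contract_swap)
  also have "\<dots> = contract (\<lambda>xs. contract (\<lambda>ys. H' (ys @ [xs ! 1])) (\<Delta> (xs ! 0))) X"
    by (rule contract_coproduct_first[OF X H'])
  also have "\<dots> = contract (\<lambda>xs. contract (\<lambda>ys. H (ys @ [xs ! 1])) (\<Delta> (xs ! 0))) X"
  proof (rule contract_cong[OF X], erule homogeneous_eq2[OF multilinear_coproduct_first[OF H'] multilinear_coproduct_first[OF H], rotated])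
    fix x0 x1 d e assume "x0 \<in> gr d" and x1: "x1 \<in> gr e"
    let ?F = "\<lambda>w. F (w @ [x1])"
    note F2 = multilinear_append1[OF F, of x1]
    have "contract (\<lambda>ys. H' (ys @ [x1])) (\<Delta> x0) = contract (\<lambda>ys. contract (\<lambda>ms. product_form 2 ?F ms ys) M) (\<Delta> x0)"
      unfolding H'_def
      by (intro contract_cong[OF coproduct_closed] contract_cong[OF M] product_last_unit_left[OF F _ _ x1])
    also have "\<dots> = contract ?F (M \<otimes>\<^bsub>TP 2\<^esub> \<Delta> x0)"
      unfolding contract_mult[OF M coproduct_closed F2] by (rule contract_swap)
    also have "\<dots> = contract ?F (\<Delta> x0 \<otimes>\<^bsub>TP 2\<^esub> M)" by (simp add: comm)
    also have "\<dots> = contract (\<lambda>ys. contract (product_form 2 ?F ys) (parity_at e M)) (\<Delta> x0)"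
      by (simp add: contract_mult[OF coproduct_closed M F2] even)
    also have "\<dots> = contract (\<lambda>ys. H (ys @ [x1])) (\<Delta> x0)"
    proof (rule contract_cong[OF coproduct_closed])
      fix ys :: "'a list" assume ys: "length ys = 2"
      have "H (ys @ [x1]) = contract (\<lambda>ms. product_form 3 F (ys @ [x1]) (ms @ [1])) M"
        unfolding H_def using ys by (simp add: contract_unit_last[OF M] multilinear_product_right[OF F])
      also have "\<dots> = contract (\<lambda>ms. product_form 2 ?F ys (map (twist e) ms)) M"
        by (intro contract_cong[OF M] product_last_unit_right[OF F x1 ys])
      also have "\<dots> = contract (product_form 2 ?F ys) (parity_at e M)"
        by (simp add: contract_parity[OF M] multilinear_product_right[OF F2 ys])
      finally show "contract (product_form 2 ?F ys) (parity_at e M) = H (ys @ [x1])" ..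
    qed
    finally show "contract (\<lambda>ys. H' (ys @ [[x0, x1] ! 1])) (\<Delta> ([x0, x1] ! 0))
        = contract (\<lambda>ys. H (ys @ [[x0, x1] ! 1])) (\<Delta> ([x0, x1] ! 0))" by simp
  qed
  also have "\<dots> = contract F (?L \<otimes>\<^bsub>TP 3\<^esub> ?W)"
    by (simp add: contract_mult[OF L W F] contract_coproduct_first[OF X H] flip: H_def)
  finally show "contract F (?W \<otimes>\<^bsub>TP 3\<^esub> ?L) = contract F (?L \<otimes>\<^bsub>TP 3\<^esub> ?W)" .
qed

lemma coproduct_second_commutes:
  assumes M: "M \<in> carrier (TP 2)" and even: "\<And>e. parity_at e M = M"
    and comm: "\<And>a. M \<otimes>\<^bsub>TP 2\<^esub> \<Delta> a = \<Delta> a \<otimes>\<^bsub>TP 2\<^esub> M" and X: "X \<in> carrier (TP 2)"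
  shows "unit_at 3 0 M \<otimes>\<^bsub>TP 3\<^esub> coproduct_at \<Delta> 3 1 X = coproduct_at \<Delta> 3 1 X \<otimes>\<^bsub>TP 3\<^esub> unit_at 3 0 M"
    (is "?W \<otimes>\<^bsub>_\<^esub> ?L = _")
proof (rule tensor_eqI[where n = 3])
  have W: "?W \<in> carrier (TP 3)" and L: "?L \<in> carrier (TP 3)"
    by (simp_all add: unit_carrier[OF M] coproduct_at_carrier[OF X])
  then show "?W \<otimes>\<^bsub>TP 3\<^esub> ?L \<in> carrier (TP 3)" "?L \<otimes>\<^bsub>TP 3\<^esub> ?W \<in> carrier (TP 3)"
    by (simp_all add: mult_carrier)
  fix F :: "'a list \<Rightarrow> 'k" assume F: "multilinear 3 F"
  define H where "H v = contract (product_form 3 F v) ?W" for v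
  define H' where "H' v = contract (\<lambda>ms. product_form 3 F (1 # ms) v) M" for v
  have H: "multilinear 3 H"
    unfolding H_def by (rule multilinear_contract_product_left[OF F W])
  have H': "multilinear 3 H'"
    unfolding H'_def by (rule multilinear_contract[OF M]) (simp add: multilinear_product_right[OF F])
  have "contract F (?W \<otimes>\<^bsub>TP 3\<^esub> ?L) = contract (\<lambda>ms. contract (product_form 3 F (1 # ms)) ?L) M"
    by (simp add: contract_mult[OF W L F] contract_unit_first[OF M] multilinear_contract_product_left F L
        del: One_nat_def)
  also have "\<dots> = contract H' ?L"
    unfolding H'_def by (rule contract_swap)
  also have "\<dots> = contract (\<lambda>xs. contract (\<lambda>ys. H' (xs ! 0 # ys)) (\<Delta> (xs ! 1))) X"
    by (rule contract_coproduct_second[OF X H'])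
  also have "\<dots> = contract (\<lambda>xs. contract (\<lambda>ys. H (xs ! 0 # ys)) (\<Delta> (xs ! 1))) X"
  proof (rule contract_cong[OF X], erule homogeneous_eq2[OF multilinear_coproduct_second[OF H'] multilinear_coproduct_second[OF H], rotated])
    fix x0 x1 d e assume x0: "x0 \<in> gr d" and "x1 \<in> gr e"
    let ?F = "\<lambda>w. F (x0 # w)"
    note F2 = multilinear_Cons[OF F, of x0]
    have "contract (\<lambda>ys. H' (x0 # ys)) (\<Delta> x1) = contract (\<lambda>ys. contract (\<lambda>ms. product_form 2 ?F ms ys) (parity_at d M)) (\<Delta> x1)"
    proof (rule contract_cong[OF coproduct_closed])
      fix ys :: "'a list" assume ys: "length ys = 2"
      have "H' (x0 # ys) = contract (\<lambda>ms. product_form 2 ?F (map (twist d) ms) ys) M"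
        unfolding H'_def by (intro contract_cong[OF M] product_first_unit_left[OF F x0 ys])
      also have "\<dots> = contract (\<lambda>ms. product_form 2 ?F ms ys) (parity_at d M)"
        by (simp add: contract_parity[OF M] multilinear_product_left[OF F2 ys])
      finally show "H' (x0 # ys) = contract (\<lambda>ms. product_form 2 ?F ms ys) (parity_at d M)" .
    qed
    also have "\<dots> = contract ?F (M \<otimes>\<^bsub>TP 2\<^esub> \<Delta> x1)"
      unfolding contract_mult[OF M coproduct_closed F2] even by (rule contract_swap)
    also have "\<dots> = contract (\<lambda>ys. contract (product_form 2 ?F ys) M) (\<Delta> x1)"
      by (simp add: comm contract_mult[OF coproduct_closed M F2])
    also have "\<dots> = contract (\<lambda>ys. H (x0 # ys)) (\<Delta> x1)"
    proof (rule contract_cong[OF coproduct_closed])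
      fix ys :: "'a list" assume ys: "length ys = 2"
      have "H (x0 # ys) = contract (\<lambda>ms. product_form 3 F (x0 # ys) (1 # ms)) M"
        unfolding H_def using ys by (simp add: contract_unit_first[OF M] multilinear_product_right[OF F])
      also have "\<dots> = contract (product_form 2 ?F ys) M"
        by (intro contract_cong[OF M] product_first_unit_right[OF F ys _ x0])
      finally show "contract (product_form 2 ?F ys) M = H (x0 # ys)" ..
    qed
    finally show "contract (\<lambda>ys. H' ([x0, x1] ! 0 # ys)) (\<Delta> ([x0, x1] ! 1))
        = contract (\<lambda>ys. H ([x0, x1] ! 0 # ys)) (\<Delta> ([x0, x1] ! 1))" by simp
  qed
  also have "\<dots> = contract F (?L \<otimes>\<^bsub>TP 3\<^esub> ?W)"
    by (simp add: contract_mult[OF L W F] contract_coproduct_second[OF X H] del: One_nat_def flip: H_def)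
  finally show "contract F (?W \<otimes>\<^bsub>TP 3\<^esub> ?L) = contract F (?L \<otimes>\<^bsub>TP 3\<^esub> ?W)" .
qed

end

section \<open>The powers of the monodromy\<close>

context quasi_triangular_quasi_hopf_superalgebra
begin

lemma R_carrier: "R \<in> carrier (TP 2)"
  using R_Units by (simp add: Units_def)

lemma monodromy_Units: "monodromy \<in> Units (TP 2)"
proof -
  interpret T2: monoid "TP 2" by (rule monoid_TP)
  show ?thesis
    unfolding monodromy_def
    using T2.mult_Units_hom(1)[OF flip_mult flip_carrier flip_one R_Units] R_Units by simp
qed

text \<open>
  \<open>R\<close> intertwines \<open>\<Delta>\<close> with \<open>\<Delta>\<^sup>T\<close>, and by applying the flip \<open>R\<^sup>T\<close> intertwines \<open>\<Delta>\<^sup>T\<close> with \<open>\<Delta>\<close>.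
\<close>

lemma monodromy_commutes: "monodromy \<otimes>\<^bsub>TP 2\<^esub> \<Delta> a = \<Delta> a \<otimes>\<^bsub>TP 2\<^esub> monodromy"
proof -
  interpret T2: monoid "TP 2" by (rule monoid_TP)
  note [simp] = R_carrier flip_carrier coproduct_closed
  have "flip (flip (\<Delta> a) \<otimes>\<^bsub>TP 2\<^esub> R) = flip (R \<otimes>\<^bsub>TP 2\<^esub> \<Delta> a)" by (simp add: R_intertwines)
  then have flipped: "\<Delta> a \<otimes>\<^bsub>TP 2\<^esub> flip R = flip R \<otimes>\<^bsub>TP 2\<^esub> flip (\<Delta> a)" by (simp add: flip_mult flip_flip)
  have "monodromy \<otimes>\<^bsub>TP 2\<^esub> \<Delta> a = flip R \<otimes>\<^bsub>TP 2\<^esub> (flip (\<Delta> a) \<otimes>\<^bsub>TP 2\<^esub> R)"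
    by (simp add: monodromy_def T2.m_assoc R_intertwines)
  also have "\<dots> = \<Delta> a \<otimes>\<^bsub>TP 2\<^esub> flip R \<otimes>\<^bsub>TP 2\<^esub> R" by (simp add: flipped T2.m_assoc)
  also have "\<dots> = \<Delta> a \<otimes>\<^bsub>TP 2\<^esub> monodromy" by (simp add: monodromy_def T2.m_assoc)
  finally show ?thesis .
qed

text \<open>
  \<open>R\<close> and its flip are homogeneous of the same degree, so the two signs cancel in the product.
\<close>

lemma monodromy_even: "parity_at e monodromy = monodromy"
proof -
  obtain k where k: "R \<in> TP_gr 2 k" using R_homogeneous by blast
  note [simp] = R_carrier flip_carrier parity_carrier
  have pR: "contract F (parity_at e R) = ksgn (e * k) * contract F R" if F: "multilinear 2 F" for F
  proof -
    have "contract (\<lambda>xs. F (map (twist e) xs)) R = contract (\<lambda>xs. ksgn (e * k) * F xs) R"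
      using twist_form[OF F, of _ _ _ _ e]
      by (intro contract_TP_gr2[OF k]) (auto simp: multilinear_twist multilinear_cmult F simp del: list.map)
    then show ?thesis by (simp add: contract_parity F contract_mult_left)
  qed
  \<comment> \<open>The flip preserves the total degree, so it commutes with the sign of the parity.\<close>
  have pfR: "contract F (parity_at e (flip R)) = ksgn (e * k) * contract F (flip R)" if F: "multilinear 2 F" for F
  proof -
    have "contract (flip_form (\<lambda>xs. F (map (twist e) xs))) R = contract (\<lambda>xs. ksgn (e * k) * flip_form F xs) R"
    proof (rule contract_TP_gr2[OF k])
      fix x y d d' assume xy: "x \<in> gr d" "y \<in> gr d'" "d + d' = k"
      show "flip_form (\<lambda>xs. F (map (twist e) xs)) [x, y] = ksgn (e * k) * flip_form F [x, y]"
        using twist_form[OF F xy(2,1), of e] xy(3)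
        by (simp add: flip_form_homogeneous[OF multilinear_twist[OF F] xy(1,2)] flip_form_homogeneous[OF F xy(1,2)]
            add.commute[of d'] del: list.map)
    qed (simp_all add: multilinear_flip multilinear_twist multilinear_cmult F)
    then show ?thesis by (simp add: contract_parity contract_flip multilinear_twist F contract_mult_left)
  qed
  show ?thesis
  proof (rule tensor_eqI)
    show "parity_at e monodromy \<in> carrier (TP 2)" "monodromy \<in> carrier (TP 2)"
      by (simp_all add: monodromy_def mult_carrier)
    fix F :: "'a list \<Rightarrow> 'k" assume F: "multilinear 2 F"
    have "contract F (parity_at e monodromy)
        = contract (\<lambda>xs. contract (product_form 2 F xs) (parity_at e R)) (parity_at e (flip R))"
      by (simp add: monodromy_def parity_mult contract_mult F)
    also have "\<dots> = contract (\<lambda>xs. ksgn (e * k) * contract (product_form 2 F xs) R) (parity_at e (flip R))"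
      by (intro contract_cong[where n = 2] pR multilinear_product_right F) simp_all
    also have "\<dots> = ksgn (e * k) * ksgn (e * k) * contract (\<lambda>xs. contract (product_form 2 F xs) R) (flip R)"
      by (simp add: contract_mult_left pfR multilinear_contract_product_left F mult.assoc)
    also have "\<dots> = contract F monodromy" by (simp add: monodromy_def contract_mult F)
    finally show "contract F (parity_at e monodromy) = contract F monodromy" .
  qed
qed

lemma monodromy_pow:
  fixes m :: int
  defines "M \<equiv> monodromy [^]\<^bsub>TP 2\<^esub> m"
  shows monodromy_pow_carrier: "M \<in> carrier (TP 2)"
    and monodromy_pow_even: "parity_at e M = M"
    and monodromy_pow_commutes: "M \<otimes>\<^bsub>TP 2\<^esub> \<Delta> a = \<Delta> a \<otimes>\<^bsub>TP 2\<^esub> M"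
proof -
  interpret T2: monoid "TP 2" by (rule monoid_TP)
  show "M \<in> carrier (TP 2)"
    unfolding M_def by (rule T2.Units_closed[OF T2.Units_int_pow_closed[OF monodromy_Units]])
  show "parity_at e M = M"
    unfolding M_def
    by (rule T2.fixed_int_pow[OF parity_mult parity_carrier parity_one monodromy_Units monodromy_even])
  show "M \<otimes>\<^bsub>TP 2\<^esub> \<Delta> a = \<Delta> a \<otimes>\<^bsub>TP 2\<^esub> M"
    unfolding M_def by (rule T2.commutes_int_pow[OF monodromy_Units coproduct_closed monodromy_commutes])
qed

text \<open>
  Quasi-coassociativity exhibits \<open>(1 \<otimes> \<Delta>)\<Delta>(a)\<close> as the conjugate of \<open>(\<Delta> \<otimes> 1)\<Delta>(a)\<close> under the same
  \<open>\<Phi>\<close> that conjugates the power of the monodromy.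
\<close>

lemma casimir_tensor_commutes:
  fixes m :: int
  defines "\<omega> \<equiv> inv\<^bsub>TP 3\<^esub> \<Phi> \<otimes>\<^bsub>TP 3\<^esub> unit_at 3 2 (monodromy [^]\<^bsub>TP 2\<^esub> m) \<otimes>\<^bsub>TP 3\<^esub> \<Phi>"
  shows casimir_tensor_carrier: "\<omega> \<in> carrier (TP 3)"
    and "\<omega> \<otimes>\<^bsub>TP 3\<^esub> coproduct_at \<Delta> 3 1 (\<Delta> a) = coproduct_at \<Delta> 3 1 (\<Delta> a) \<otimes>\<^bsub>TP 3\<^esub> \<omega>"
proof -
  interpret T3: monoid "TP 3" by (rule monoid_TP)
  have W: "unit_at 3 2 (monodromy [^]\<^bsub>TP 2\<^esub> m) \<in> carrier (TP 3)"
    by (simp add: unit_carrier monodromy_pow_carrier)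
  show "\<omega> \<in> carrier (TP 3)"
    unfolding \<omega>_def using W coassociator_Units by (simp add: T3.Units_closed)
  show "\<omega> \<otimes>\<^bsub>TP 3\<^esub> coproduct_at \<Delta> 3 1 (\<Delta> a) = coproduct_at \<Delta> 3 1 (\<Delta> a) \<otimes>\<^bsub>TP 3\<^esub> \<omega>"
    unfolding \<omega>_def quasi_coassoc
    using W by (intro T3.conjugates_commute coassociator_Units coproduct_first_commutes coproduct_at_carrier)
      (simp_all add: coproduct_closed monodromy_pow)
qed

lemma casimir_bar_tensor_commutes:
  fixes m :: int
  defines "\<omega> \<equiv> \<Phi> \<otimes>\<^bsub>TP 3\<^esub> unit_at 3 0 (monodromy [^]\<^bsub>TP 2\<^esub> m) \<otimes>\<^bsub>TP 3\<^esub> inv\<^bsub>TP 3\<^esub> \<Phi>"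
  shows casimir_bar_tensor_carrier: "\<omega> \<in> carrier (TP 3)"
    and "\<omega> \<otimes>\<^bsub>TP 3\<^esub> coproduct_at \<Delta> 3 0 (\<Delta> a) = coproduct_at \<Delta> 3 0 (\<Delta> a) \<otimes>\<^bsub>TP 3\<^esub> \<omega>"
proof -
  interpret T3: monoid "TP 3" by (rule monoid_TP)
  have W: "unit_at 3 0 (monodromy [^]\<^bsub>TP 2\<^esub> m) \<in> carrier (TP 3)"
    by (simp add: unit_carrier monodromy_pow_carrier)
  note [simp] = coassociator_Units T3.Units_closed[OF coassociator_Units]
  show "\<omega> \<in> carrier (TP 3)" unfolding \<omega>_def using W by simp
  let ?L = "coproduct_at \<Delta> 3 0 (\<Delta> a)" and ?D = "coproduct_at \<Delta> 3 1 (\<Delta> a)"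
  have carriers: "?L \<in> carrier (TP 3)" "?D \<in> carrier (TP 3)"
    by (simp_all add: coproduct_at_carrier coproduct_closed del: One_nat_def)
  have "\<Phi> \<otimes>\<^bsub>TP 3\<^esub> (inv\<^bsub>TP 3\<^esub> \<Phi> \<otimes>\<^bsub>TP 3\<^esub> ?L \<otimes>\<^bsub>TP 3\<^esub> \<Phi>) \<otimes>\<^bsub>TP 3\<^esub> inv\<^bsub>TP 3\<^esub> \<Phi> = ?L"
  proof -
    have "\<Phi> \<otimes>\<^bsub>TP 3\<^esub> (inv\<^bsub>TP 3\<^esub> \<Phi> \<otimes>\<^bsub>TP 3\<^esub> ?L \<otimes>\<^bsub>TP 3\<^esub> \<Phi>) = ?L \<otimes>\<^bsub>TP 3\<^esub> \<Phi>"
      using carriers by (simp flip: T3.m_assoc)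
    then show ?thesis using carriers by (simp add: T3.m_assoc)
  qed
  then have L: "?L = \<Phi> \<otimes>\<^bsub>TP 3\<^esub> ?D \<otimes>\<^bsub>TP 3\<^esub> inv\<^bsub>TP 3\<^esub> \<Phi>"
    by (simp add: quasi_coassoc del: One_nat_def)
  show "\<omega> \<otimes>\<^bsub>TP 3\<^esub> ?L = ?L \<otimes>\<^bsub>TP 3\<^esub> \<omega>"
    using T3.conjugates_commute[OF T3.Units_inv_Units[OF coassociator_Units] W carriers(2)
        coproduct_second_commutes[OF monodromy_pow_carrier monodromy_pow_even monodromy_pow_commutes coproduct_closed]]
    unfolding L \<omega>_def by simp
qed

end

section \<open>The supertrace\<close>

context superspace
begin

text \<open>
  A maximal independent subset of the homogeneous vectors spans both graded parts.
\<close>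

lemma homogeneous_basis_exists: "\<exists>B. homogeneous_basis B"
proof -
  obtain B where B: "B \<subseteq> gr 0 \<union> gr 1" "independent B" "gr 0 \<union> gr 1 \<subseteq> span B"
    using maximal_independent_subset by blast
  have "v \<in> span B" for v
    using B(3) gproj_mem[of 0 v] gproj_mem[of 1 v] span_add[of "gproj 0 v" B "gproj 1 v"] by (auto simp: gproj_sum)
  with B show ?thesis unfolding homogeneous_basis_def by blast
qed

context
  fixes B :: "'v set"
  assumes basis: "homogeneous_basis B" and finite: "finite B"
begin

lemma basis_independent: "independent B" and basis_span: "v \<in> span B"
  using basis by (auto simp: homogeneous_basis_def)

lemma basis_expansion: "(\<Sum>c\<in>B. representation B v c *s c) = v"
  by (rule sum_representation_eq[OF basis_independent basis_span finite]) simp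

lemma representation_expand:
  assumes "Vector_Spaces.linear scale scale f"
  shows "representation B (f v) b = (\<Sum>c\<in>B. representation B v c * representation B (f c) b)"
proof -
  interpret f: Vector_Spaces.linear scale scale f by fact
  have "representation B (f v) b = representation B (f (\<Sum>c\<in>B. representation B v c *s c)) b"
    by (simp add: basis_expansion)
  also have "\<dots> = (\<Sum>c\<in>B. representation B v c * representation B (f c) b)"
    by (simp add: f.sum f.scale representation_sum[OF basis_independent] representation_scale[OF basis_independent] basis_span)
  finally show ?thesis .
qed

text \<open>
  Expanding \<open>v = gproj i v\<close> shows that only basis vectors of degree \<open>i\<close> contribute.
\<close>

lemma representation_degree:
  assumes "v \<in> gr i" "b \<in> B" "b \<notin> gr i"
  shows "representation B v b = 0"
proof -
  have "Vector_Spaces.linear scale scale (gproj i)"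
    unfolding Vector_Spaces.linear_iff by (simp add: gproj_add gproj_scale vector_space_axioms)
  from representation_expand[OF this, of v b]
  have "representation B v b = (\<Sum>c\<in>B. representation B v c * representation B (gproj i c) b)"
    using assms(1) by (simp add: gproj_homogeneous)
  also have "\<dots> = 0"
  proof (intro sum.neutral ballI)
    fix c assume c: "c \<in> B"
    show "representation B v c * representation B (gproj i c) b = 0"
    proof (cases "c \<in> gr i")
      case True
      then have "c \<noteq> b" using assms(3) by blast
      then show ?thesis using True representation_basis[OF basis_independent c] by (simp add: gproj_homogeneous)
    next
      case False
      moreover obtain j where "c \<in> gr j" using c basis unfolding homogeneous_basis_def by blast
      ultimately show ?thesis by (cases "i = j") (auto simp: gproj_homogeneous representation_zero)
    qed
  qed
  finally show ?thesis .
qed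

lemma basis_degree: assumes "b \<in> B" obtains d where "b \<in> gr d" "(if b \<in> gr 0 then 1 else - 1) = (ksgn d :: 'k)"
    "\<And>e. b \<in> gr e \<Longrightarrow> e = d"
proof -
  have "b \<noteq> 0" using assms basis_independent dependent_zero by blast
  then have unique: "d = e" if "b \<in> gr d" "b \<in> gr e" for d e using that gr_unique by blast
  obtain d where d: "b \<in> gr d" using assms basis unfolding homogeneous_basis_def by blast
  have "(if b \<in> gr 0 then 1 else - 1) = (ksgn d :: 'k)"
    using d unique[OF d, of 0] by (cases d) (auto simp: ksgn_def)
  with d unique show thesis using that by blast
qed

end

context
  assumes finite_dim: "\<And>B. independent B \<Longrightarrow> finite B"
begin

lemma supertrace_basis:
  obtains B where "homogeneous_basis B" "finite B"
    "\<And>f. supertrace f = (\<Sum>b\<in>B. (if b \<in> gr 0 then 1 else - 1) * representation B (f b) b)"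
proof
  show B: "homogeneous_basis (SOME B. homogeneous_basis B)" using homogeneous_basis_exists by (rule someI_ex)
  then show "finite (SOME B. homogeneous_basis B)" using finite_dim by (auto simp: homogeneous_basis_def)
qed (simp add: supertrace_def Let_def)

lemma supertrace_add: "supertrace (\<lambda>v. f v + g v) = supertrace f + supertrace g"
  and supertrace_scale: "supertrace (\<lambda>v. c *s f v) = c * supertrace f"
proof -
  obtain B where B: "homogeneous_basis B" "finite B"
    and str: "\<And>f. supertrace f = (\<Sum>b\<in>B. (if b \<in> gr 0 then 1 else - 1) * representation B (f b) b)"
    by (rule supertrace_basis) blast
  note rep = basis_independent[OF B] basis_span[OF B]
  show "supertrace (\<lambda>v. f v + g v) = supertrace f + supertrace g"
    unfolding str by (simp add: representation_add rep distrib_left sum.distrib)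
  show "supertrace (\<lambda>v. c *s f v) = c * supertrace f"
    unfolding str by (simp add: representation_scale rep sum_distrib_left mult.left_commute)
qed

lemma supertrace_odd:
  assumes "\<And>v j. v \<in> gr j \<Longrightarrow> f v \<in> gr (1 + j)"
  shows "supertrace f = 0"
proof -
  obtain B where B: "homogeneous_basis B" "finite B"
    and str: "\<And>f. supertrace f = (\<Sum>b\<in>B. (if b \<in> gr 0 then 1 else - 1) * representation B (f b) b)"
    by (rule supertrace_basis) blast
  have "representation B (f b) b = 0" if b: "b \<in> B" for b
  proof -
    obtain d where d: "b \<in> gr d" "\<And>e. b \<in> gr e \<Longrightarrow> e = d" using basis_degree[OF B b] by blast
    then have "b \<notin> gr (1 + d)" by (metis add_cancel_left_left zero_neq_one)
    then show ?thesis by (rule representation_degree[OF B assms[OF d(1)] b])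
  qed
  then show ?thesis unfolding str by simp
qed

text \<open>
  In the double sum over matrix entries, a nonzero summand for \<open>b\<close> of degree \<open>d\<close> and \<open>c\<close> of degree \<open>e\<close> forces
  \<open>e = j + d\<close> and \<open>d = i + e\<close>.  Hence \<open>i = j\<close>, and the signs of \<open>b\<close> and \<open>c\<close> differ by the factor \<open>ksgn (i * j)\<close>.
\<close>

lemma supertrace_cyclic:
  assumes f: "Vector_Spaces.linear scale scale f" "\<And>v d. v \<in> gr d \<Longrightarrow> f v \<in> gr (i + d)"
    and g: "Vector_Spaces.linear scale scale g" "\<And>v d. v \<in> gr d \<Longrightarrow> g v \<in> gr (j + d)"
  shows "supertrace (\<lambda>v. f (g v)) = ksgn (i * j) * supertrace (\<lambda>v. g (f v))"
proof -
  obtain B where B: "homogeneous_basis B" "finite B"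
    and str: "\<And>f. supertrace f = (\<Sum>b\<in>B. (if b \<in> gr 0 then 1 else - 1) * representation B (f b) b)"
    by (rule supertrace_basis) blast
  let ?s = "\<lambda>b. if b \<in> gr 0 then 1 else - 1 :: 'k"
  let ?r = "representation B"
  have "?s b * (?r (g b) c * ?r (f c) b) = ksgn (i * j) * (?s c * (?r (f c) b * ?r (g b) c))"
    if b: "b \<in> B" and c: "c \<in> B" for b c
  proof (cases "?r (g b) c = 0 \<or> ?r (f c) b = 0")
    case False
    obtain d where d: "b \<in> gr d" "?s b = ksgn d" "\<And>e. b \<in> gr e \<Longrightarrow> e = d" using basis_degree[OF B b] by blast
    obtain e where e: "c \<in> gr e" "?s c = ksgn e" "\<And>d. c \<in> gr d \<Longrightarrow> d = e" using basis_degree[OF B c] by blast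
    have "c \<in> gr (j + d)" using representation_degree[OF B g(2)[OF d(1)] c] False by blast
    then have "e = j + d" using e(3) by blast
    have "b \<in> gr (i + e)" using representation_degree[OF B f(2)[OF e(1)] b] False by blast
    then have "d = i + e" using d(3) by blast
    have "e = j + d \<Longrightarrow> d = i + e \<Longrightarrow> (ksgn d :: 'k) = ksgn (i * j) * ksgn e"
      by (cases i; cases j; cases e; cases d; simp add: ksgn_def)
    then have "(ksgn d :: 'k) = ksgn (i * j) * ksgn e"
      using \<open>e = j + d\<close> \<open>d = i + e\<close> by blast
    then show ?thesis unfolding d(2) e(2) by simp
  qed auto
  then have "(\<Sum>b\<in>B. \<Sum>c\<in>B. ?s b * (?r (g b) c * ?r (f c) b))
      = (\<Sum>b\<in>B. \<Sum>c\<in>B. ksgn (i * j) * (?s c * (?r (f c) b * ?r (g b) c)))"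
    by (intro sum.cong refl) blast
  also have "\<dots> = (\<Sum>c\<in>B. \<Sum>b\<in>B. ksgn (i * j) * (?s c * (?r (f c) b * ?r (g b) c)))"
    by (rule sum.swap)
  finally show ?thesis
    unfolding str representation_expand[OF B f(1), of "g _"] representation_expand[OF B g(1), of "f _"]
    by (simp only: sum_distrib_left)
qed

end
end

context graded_module
begin

context
  assumes finite_dim: "\<exists>B. finite_dimensional_vector_space scaleV B"
begin

lemma finite_independent: "V.independent B \<Longrightarrow> finite B"
  using finite_dim finite_dimensional_vector_space.finiteI_independent by blast

lemma str_add: "V.supertrace (act (a + b)) = V.supertrace (act a) + V.supertrace (act b)"
  and str_scale: "V.supertrace (act (scale c a)) = c * V.supertrace (act a)"
proof -
  have "act (a + b) = (\<lambda>v. act a v + act b v)" "act (scale c a) = (\<lambda>v. scaleV c (act a v))"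
    using act_linear_left by (simp_all add: Vector_Spaces.linear_iff fun_eq_iff)
  then show "V.supertrace (act (a + b)) = V.supertrace (act a) + V.supertrace (act b)"
    "V.supertrace (act (scale c a)) = c * V.supertrace (act a)"
    by (simp_all add: V.supertrace_add V.supertrace_scale finite_independent)
qed

lemma str_odd: "a \<in> gr 1 \<Longrightarrow> V.supertrace (act a) = 0"
  by (rule V.supertrace_odd[OF finite_independent]) (simp_all add: act_gr)

lemma str_cyclic:
  assumes "a \<in> gr i" "b \<in> gr j"
  shows "V.supertrace (act (a * b)) = ksgn (i * j) * V.supertrace (act (b * a))"
  using V.supertrace_cyclic[OF finite_independent act_linear_right[of a] act_gr[OF assms(1)]
      act_linear_right[of b] act_gr[OF assms(2)]]
  by (simp add: act_mult[abs_def])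

end
end

section \<open>Counit and antipode\<close>

context superalgebra
begin

lemma gr_mult_eq: "a \<in> gr i \<Longrightarrow> b \<in> gr j \<Longrightarrow> i + j = k \<Longrightarrow> a * b \<in> gr k"
  using gr_mult by blast

lemma functional_add: "Vector_Spaces.linear scale (*) g \<Longrightarrow> g (a + b) = g a + g b"
  and functional_scale: "Vector_Spaces.linear scale (*) g \<Longrightarrow> g (c *s a) = c * g a"
  by (simp_all add: Vector_Spaces.linear_iff)

lemma functionalI:
  assumes "\<And>a b. g (a + b) = g a + g b" "\<And>c a. g (c *s a) = c * g a"
  shows "Vector_Spaces.linear scale (*) g"
  using assms by (simp add: Vector_Spaces.linear_iff vector_space_axioms field_space.vector_space_axioms)

lemma functional_separates:
  assumes "\<And>f. Vector_Spaces.linear scale (*) f \<Longrightarrow> f v = f w"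
  shows "v = w"
proof (rule ccontr)
  assume "v \<noteq> w"
  interpret vs: vector_space_pair scale "(*)" ..
  have "independent {v - w}" using \<open>v \<noteq> w\<close> by simp
  from vs.linear_independent_extend[OF this, of "\<lambda>_. 1"]
  obtain f where f: "Vector_Spaces.linear scale (*) f" "f (v - w) = 1" by auto
  interpret f: Vector_Spaces.linear scale "(*)" f by fact
  show False using assms[OF f(1)] f(2) by (simp add: f.diff)
qed

text \<open>
  The odd part of \<open>u * u' = 1\<close> is \<open>u\<close> times the odd part of \<open>u'\<close>, and \<open>u\<close> can be cancelled.
\<close>

lemma inverse_even:
  assumes "u \<in> gr 0" "u * u' = 1" "u' * u = 1"
  shows "u' \<in> gr 0"
proof -
  have "1 = u * gproj 0 u' + u * gproj 1 u'" using assms(2) by (simp flip: distrib_left add: gproj_sum)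
  then have "1 - u * gproj 0 u' = u * gproj 1 u'" by (simp add: algebra_simps)
  moreover have "1 - u * gproj 0 u' \<in> gr 0"
    using gr_mult[OF assms(1) gproj_mem, of 0 u'] one_even by (simp add: gr_diff)
  moreover have "u * gproj 1 u' \<in> gr 1" using gr_mult[OF assms(1) gproj_mem, of 1 u'] by simp
  ultimately have "u * gproj 1 u' = 0" by (metis gr_unique zero_neq_one)
  then have "gproj 1 u' = 0" using assms(3) by (metis mult.assoc mult_1 mult_zero_right)
  then show ?thesis using gproj_sum[of u'] gproj_mem[of 0 u'] by simp
qed

end

context quasi_hopf_superalgebra
begin

abbreviation S_inv :: "'a \<Rightarrow> 'a" where "S_inv \<equiv> inv_into UNIV S"

sublocale S: Vector_Spaces.linear scale scale S by (rule antipode_linear)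

lemma counit_add: "\<epsilon> (a + b) = \<epsilon> a + \<epsilon> b" and counit_scale: "\<epsilon> (c *s a) = c * \<epsilon> a"
  using counit_linear by (simp_all add: Vector_Spaces.linear_iff)

lemma S_S_inv [simp]: "S (S_inv a) = a" and S_inv_S [simp]: "S_inv (S a) = a"
  using antipode_bij by (simp_all add: bij_is_surj surj_f_inv_f bij_is_inj)

lemma S_inv_add: "S_inv (a + b) = S_inv a + S_inv b"
  using S_inv_S[of "S_inv a + S_inv b"] by (simp add: S.add)

lemma S_inv_scale: "S_inv (c *s a) = c *s S_inv a"
  using S_inv_S[of "c *s S_inv a"] by (simp add: S.scale)

lemma S_inv_gr: assumes "a \<in> gr i" shows "S_inv a \<in> gr i"
proof -
  let ?b = "S_inv a"
  have "S (?b - gproj i ?b) \<in> gr (i + 1)" by (rule antipode_gr[OF gproj_rest])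
  moreover have "S (?b - gproj i ?b) \<in> gr i"
    using assms antipode_gr[OF gproj_mem[of i ?b]] by (simp add: S.diff gr_diff)
  ultimately have "S (?b - gproj i ?b) = 0" by (metis gr_unique add_cancel_left_right zero_neq_one)
  then have "?b - gproj i ?b = 0" using S_inv_S[of "?b - gproj i ?b"] S_inv_S[of 0] by simp
  then show ?thesis using gproj_mem[of i ?b] by simp
qed

lemma S_inv_mult:
  assumes "a \<in> gr i" "b \<in> gr j"
  shows "S_inv (a * b) = ksgn (i * j) *s (S_inv b * S_inv a)"
proof -
  have "S (ksgn (i * j) *s (S_inv b * S_inv a)) = a * b"
    using assms by (simp add: S.scale antipode_mult[OF S_inv_gr S_inv_gr, of b j a i] mult.commute[of j])
  then show ?thesis using S_inv_S by metis
qed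

lemma counit_odd: "a \<in> gr i \<Longrightarrow> i \<noteq> 0 \<Longrightarrow> \<epsilon> a = 0"
  using counit_gr by (cases i) auto

text \<open>
  The counit is multiplicative, so applying it to \<open>\<Sum> S(X)\<alpha>Y\<beta>S(Z) = 1\<close> writes \<open>1\<close> as a multiple of
  \<open>\<epsilon>(\<alpha>)\<epsilon>(\<beta>)\<close>, which would be zero if \<open>\<alpha>\<close> or \<open>\<beta>\<close> were odd.
\<close>

lemma alpha_even: "\<alpha> \<in> gr 0" and beta_even: "\<beta> \<in> gr 0"
proof -
  have "1 = \<epsilon> (lift3 (\<lambda>x y z. S x * \<alpha> * y * \<beta> * S z) \<Phi>)"
    by (simp add: antipode_coassociator counit_one)
  also have "\<dots> = linext (*) (\<lambda>xs. \<epsilon> (S (xs ! 0) * \<alpha> * xs ! 1 * \<beta> * S (xs ! 2))) (rep \<Phi>)"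
    unfolding lift3_def by (rule linear_linext[OF counit_linear])
  finally have "\<epsilon> \<alpha> \<noteq> 0" "\<epsilon> \<beta> \<noteq> 0"
    by (auto simp: counit_mult linext_def)
  then show "\<alpha> \<in> gr 0" "\<beta> \<in> gr 0"
    using alpha_homogeneous beta_homogeneous counit_odd by metis+
qed

lemma
  assumes "Vector_Spaces.linear scale (*) g"
  shows contract_alpha: "contract (\<lambda>bs. g (S (bs ! 0) * \<alpha> * bs ! 1)) (\<Delta> a) = \<epsilon> a * g \<alpha>"
    and contract_beta: "contract (\<lambda>bs. g (bs ! 0 * \<beta> * S (bs ! 1))) (\<Delta> a) = \<epsilon> a * g \<beta>"
    and contract_counit_left: "contract (\<lambda>bs. \<epsilon> (bs ! 0) * g (bs ! 1)) (\<Delta> a) = g a"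
    and contract_counit_right: "contract (\<lambda>bs. \<epsilon> (bs ! 1) * g (bs ! 0)) (\<Delta> a) = g a"
proof -
  note g_add = functional_add[OF assms] and g_scale = functional_scale[OF assms]
  have *: "contract (\<lambda>bs. g (f (bs ! 0) (bs ! 1))) X = g (lift2 f X)" for f X
    unfolding lift2_def contract_def by (rule linear_linext[OF assms, symmetric])
  show "contract (\<lambda>bs. g (S (bs ! 0) * \<alpha> * bs ! 1)) (\<Delta> a) = \<epsilon> a * g \<alpha>"
    unfolding *[of "\<lambda>x y. S x * \<alpha> * y"] antipode_alpha by (rule g_scale)
  show "contract (\<lambda>bs. g (bs ! 0 * \<beta> * S (bs ! 1))) (\<Delta> a) = \<epsilon> a * g \<beta>"
    unfolding *[of "\<lambda>x y. x * \<beta> * S y"] antipode_beta by (rule g_scale)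
  show "contract (\<lambda>bs. \<epsilon> (bs ! 0) * g (bs ! 1)) (\<Delta> a) = g a"
    using *[of "\<lambda>x y. \<epsilon> x *s y" "\<Delta> a"] by (simp add: counit_left g_scale del: One_nat_def)
  show "contract (\<lambda>bs. \<epsilon> (bs ! 1) * g (bs ! 0)) (\<Delta> a) = g a"
    using *[of "\<lambda>x y. \<epsilon> y *s x" "\<Delta> a"] by (simp add: counit_right g_scale del: One_nat_def)
qed

end

section \<open>Casimir elements\<close>

text \<open>
  The function \<open>t\<close> abstracts the supertrace over a finite-dimensional graded module.
\<close>

locale traced_quasi_triangular =
  quasi_triangular_quasi_hopf_superalgebra scale gr \<Delta> \<epsilon> \<Phi> S \<alpha> \<beta> R
  for scale :: "'k::field \<Rightarrow> 'a::ring_1 \<Rightarrow> 'a" (infixr \<open>*s\<close> 75) and gr \<Delta> \<epsilon> \<Phi> S \<alpha> \<beta> R +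
  fixes t :: "'a \<Rightarrow> 'k" and u u' :: 'a
  assumes trace_add: "t (a + b) = t a + t b"
    and trace_scale: "t (c *s a) = c * t a"
    and trace_odd: "a \<in> gr 1 \<Longrightarrow> t a = 0"
    and trace_cyclic: "a \<in> gr i \<Longrightarrow> b \<in> gr j \<Longrightarrow> t (a * b) = ksgn (i * j) * t (b * a)"
    and u_even: "u \<in> gr 0" and u_inv: "u * u' = 1" "u' * u = 1"
    and S_square: "S (S a) = u * a * u'"
begin

lemma u'_even: "u' \<in> gr 0"
  using u_even u_inv by (rule inverse_even)

lemma S_mult_u: "S a * u = u * S_inv a"
  using S_square[of "S_inv a"] by (simp add: mult.assoc u_inv)

lemma mult_u': "a * u' = u' * S (S a)"
  by (simp add: S_square u_inv flip: mult.assoc)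

lemma trace_degree: "a \<in> gr i \<Longrightarrow> i \<noteq> 0 \<Longrightarrow> t a = 0"
  using trace_odd by (cases i) auto

lemmas expand = distrib_left distrib_right scale_mult_left scale_mult_right trace_add trace_scale
  S.add S.scale S_inv_add S_inv_scale counit_add counit_scale

lemmas grs = gr_mult_eq antipode_gr S_inv_gr alpha_even beta_even u_even u'_even

text \<open>
  The composite of \<open>x \<otimes> y \<otimes> z \<mapsto> Str(u S\<^sup>-\<^sup>1(\<alpha>) y \<beta> S(z)) x\<close> with a functional \<open>g\<close> on \<open>A\<close>; working with
  scalars allows the use of \<open>contract\<close>.
\<close>

definition casimir_form :: "('a \<Rightarrow> 'k) \<Rightarrow> 'a list \<Rightarrow> 'k" where
  "casimir_form g xs = t (u * S_inv \<alpha> * xs ! 1 * \<beta> * S (xs ! 2)) * g (xs ! 0)"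

definition casimir_bar_form :: "('a \<Rightarrow> 'k) \<Rightarrow> 'a list \<Rightarrow> 'k" where
  "casimir_bar_form g xs = t (u' * S \<beta> * S (xs ! 0) * \<alpha> * xs ! 1) * g (xs ! 2)"

lemma
  assumes "Vector_Spaces.linear scale (*) g"
  shows multilinear_casimir: "multilinear 3 (casimir_form g)"
    and multilinear_casimir_bar: "multilinear 3 (casimir_bar_form g)"
    and casimir_contract: "g (casimir t u m) = contract (casimir_form g)
      (inv\<^bsub>TP 3\<^esub> \<Phi> \<otimes>\<^bsub>TP 3\<^esub> unit_at 3 2 (monodromy [^]\<^bsub>TP 2\<^esub> m) \<otimes>\<^bsub>TP 3\<^esub> \<Phi>)"
    and casimir_bar_contract: "g (casimir_bar t u' m) = contract (casimir_bar_form g)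
      (\<Phi> \<otimes>\<^bsub>TP 3\<^esub> unit_at 3 0 (monodromy [^]\<^bsub>TP 2\<^esub> m) \<otimes>\<^bsub>TP 3\<^esub> inv\<^bsub>TP 3\<^esub> \<Phi>)"
proof -
  note g_add = functional_add[OF assms] and g_scale = functional_scale[OF assms]
  show "multilinear 3 (casimir_form g)" "multilinear 3 (casimir_bar_form g)"
    unfolding casimir_form_def casimir_bar_form_def
    by (rule multilinear3I; simp add: expand g_add g_scale mult_ac)+
  show "g (casimir t u m) = contract (casimir_form g)
      (inv\<^bsub>TP 3\<^esub> \<Phi> \<otimes>\<^bsub>TP 3\<^esub> unit_at 3 2 (monodromy [^]\<^bsub>TP 2\<^esub> m) \<otimes>\<^bsub>TP 3\<^esub> \<Phi>)"
    unfolding casimir_def lift3_def contract_def linear_linext[OF assms] casimir_form_def by (simp add: g_scale)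
  show "g (casimir_bar t u' m) = contract (casimir_bar_form g)
      (\<Phi> \<otimes>\<^bsub>TP 3\<^esub> unit_at 3 0 (monodromy [^]\<^bsub>TP 2\<^esub> m) \<otimes>\<^bsub>TP 3\<^esub> inv\<^bsub>TP 3\<^esub> \<Phi>)"
    unfolding casimir_bar_def lift3_def contract_def linear_linext[OF assms] casimir_bar_form_def by (simp add: g_scale)
qed

lemma linear_mult_left: "Vector_Spaces.linear scale (*) g \<Longrightarrow> Vector_Spaces.linear scale (*) (\<lambda>x. g (a * x))"
  and linear_mult_right: "Vector_Spaces.linear scale (*) g \<Longrightarrow> Vector_Spaces.linear scale (*) (\<lambda>x. g (x * a))"
  by (rule functionalI; simp add: expand functional_add functional_scale)+

text \<open>
  With \<open>a\<^sub>(\<^sub>1\<^sub>) \<otimes> b\<^sub>(\<^sub>1\<^sub>) \<otimes> b\<^sub>(\<^sub>2\<^sub>)\<close>, \<open>b = a\<^sub>(\<^sub>2\<^sub>)\<close>, multiplied from the right, the trace contains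
  \<open>y b\<^sub>(\<^sub>1\<^sub>) \<beta> S(b\<^sub>(\<^sub>2\<^sub>)) S(z)\<close>, and the sum over the coproduct of \<open>b\<close> yields \<open>\<epsilon>(b) y \<beta> S(z)\<close>.  Then
  \<open>\<Sum> a\<^sub>(\<^sub>1\<^sub>) \<epsilon>(a\<^sub>(\<^sub>2\<^sub>)) = a\<close>.
\<close>

lemma casimir_right:
  assumes g: "Vector_Spaces.linear scale (*) g" and X: "X \<in> carrier (TP 3)"
  shows "contract (casimir_form g) (X \<otimes>\<^bsub>TP 3\<^esub> coproduct_at \<Delta> 3 1 (\<Delta> a)) = contract (casimir_form (\<lambda>x. g (x * a))) X"
proof -
  note g_add = functional_add[OF g] and g_scale = functional_scale[OF g]
  let ?D = "coproduct_at \<Delta> 3 1 (\<Delta> a)"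
  have D: "?D \<in> carrier (TP 3)" by (rule coproduct_at_carrier[OF coproduct_closed]) simp
  note F = multilinear_casimir[OF g]
  have "contract (product_form 3 (casimir_form g) xs) ?D = casimir_form (\<lambda>x. g (x * a)) xs" if len: "length xs = 3" for xs
  proof (rule homogeneous_eq3[OF multilinear_contract_product_left[OF F D] multilinear_casimir[OF linear_mult_right[OF g]] _ len])
    fix x y z dx dy dz assume x: "x \<in> gr dx" and y: "y \<in> gr dy" and z: "z \<in> gr dz"
    have F': "multilinear 3 (product_form 3 (casimir_form g) [x, y, z])"
      by (rule multilinear_product_right[OF F]) simp
    let ?c = "t (u * S_inv \<alpha> * y * \<beta> * S z)"
    have "contract (product_form 3 (casimir_form g) [x, y, z]) ?D
        = contract (\<lambda>as. contract (\<lambda>ys. product_form 3 (casimir_form g) [x, y, z] (as ! 0 # ys)) (\<Delta> (as ! 1))) (\<Delta> a)"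
      by (rule contract_coproduct_second[OF coproduct_closed F'])
    also have "\<dots> = contract (\<lambda>as. \<epsilon> (as ! 1) * (?c * g (x * as ! 0))) (\<Delta> a)"
    proof (rule contract_cong[OF coproduct_closed], erule homogeneous_eq2[OF multilinear_coproduct_second[OF F'], rotated 2])
      show "multilinear 2 (\<lambda>as. \<epsilon> (as ! 1) * (?c * g (x * as ! 0)))"
        by (rule multilinear2I) (simp_all add: expand g_add g_scale mult_ac)
      fix p q i e assume p: "p \<in> gr i" and q: "q \<in> gr e"
      let ?h = "\<lambda>v. t (u * S_inv \<alpha> * y * v * S z) * g (x * p)"
      have h: "Vector_Spaces.linear scale (*) ?h"
        by (rule functionalI) (simp_all add: expand mult_ac)
      have "contract (\<lambda>ys. product_form 3 (casimir_form g) [x, y, z] (p # ys)) (\<Delta> q)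
          = contract (\<lambda>bs. ksgn (dy * i) * ksgn (dz * i) * ksgn (dz * e) * ?h (bs ! 0 * \<beta> * S (bs ! 1))) (\<Delta> q)"
      proof (rule contract_TP_gr2[OF coproduct_gr[OF q] multilinear_Cons[OF F']])
        show "multilinear 2 (\<lambda>bs. ksgn (dy * i) * ksgn (dz * i) * ksgn (dz * e) * ?h (bs ! 0 * \<beta> * S (bs ! 1)))"
          by (rule multilinear2I) (simp_all add: expand mult_ac)
        fix b c j k assume b: "b \<in> gr j" and c: "c \<in> gr k" and e: "j + k = e"
        show "product_form 3 (casimir_form g) [x, y, z] (p # [b, c])
          = ksgn (dy * i) * ksgn (dz * i) * ksgn (dz * e) * ?h ([b, c] ! 0 * \<beta> * S ([b, c] ! 1))"
          unfolding e[symmetric] product_form_3[OF F x y z p b c]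
          by (simp add: casimir_form_def antipode_mult[OF z c] expand ksgn_add mult.assoc)
      qed
      also have "\<dots> = ksgn (dy * i) * ksgn (dz * i) * ksgn (dz * e) * (\<epsilon> q * (?c * g (x * p)))"
        unfolding contract_mult_left contract_beta[OF h] ..
      also have "\<dots> = \<epsilon> q * (?c * g (x * p))"
      \<comment> \<open>If \<open>e\<close> is odd, \<open>\<epsilon> q\<close> vanishes; if \<open>dy + dz\<close> is odd, the trace does; otherwise all signs are \<open>1\<close>.\<close>
      proof (cases "e = 0 \<and> dy + dz = 0")
        case True
        then show ?thesis by (simp flip: ksgn_add_mult)
      next
        case False
        have "u * S_inv \<alpha> * y * \<beta> * S z \<in> gr (dy + dz)"
          by (rule grs | rule y z | simp)+
        then show ?thesis using False counit_odd[OF q] trace_degree by force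
      qed
      finally show "contract (\<lambda>ys. product_form 3 (casimir_form g) [x, y, z] ([p, q] ! 0 # ys)) (\<Delta> ([p, q] ! 1))
          = \<epsilon> ([p, q] ! 1) * (?c * g (x * [p, q] ! 0))" by simp
    qed
    also have "\<dots> = ?c * g (x * a)"
      by (rule contract_counit_right[of "\<lambda>v. ?c * g (x * v)" a], rule functionalI)
        (simp_all add: expand g_add g_scale mult_ac)
    finally show "contract (product_form 3 (casimir_form g) [x, y, z]) ?D = casimir_form (\<lambda>x. g (x * a)) [x, y, z]"
      by (simp add: casimir_form_def)
  qed
  then show ?thesis
    unfolding contract_mult[OF X D F] by (rule contract_cong[OF X])
qed

text \<open>
  Multiplied from the left, the same tensor puts \<open>u S\<^sup>-\<^sup>1(\<alpha>) b\<^sub>(\<^sub>1\<^sub>) y \<beta> S(z) S(b\<^sub>(\<^sub>2\<^sub>))\<close> into the trace.  Cyclicity and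
  \<open>S_mult_u\<close> turn this into \<open>u S\<^sup>-\<^sup>1(b\<^sub>(\<^sub>2\<^sub>)) S\<^sup>-\<^sup>1(\<alpha>) b\<^sub>(\<^sub>1\<^sub>) y \<beta> S(z)\<close>, where the antipode axiom for \<open>\<alpha>\<close> applies under
  \<open>S\<^sup>-\<^sup>1\<close>.  All signs combine to one that depends only on the degrees of \<open>b\<close> and \<open>x\<close>.
\<close>

lemma casimir_left:
  assumes g: "Vector_Spaces.linear scale (*) g" and X: "X \<in> carrier (TP 3)"
  shows "contract (casimir_form g) (coproduct_at \<Delta> 3 1 (\<Delta> a) \<otimes>\<^bsub>TP 3\<^esub> X) = contract (casimir_form (\<lambda>x. g (a * x))) X"
proof -
  note g_add = functional_add[OF g] and g_scale = functional_scale[OF g]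
  let ?D = "coproduct_at \<Delta> 3 1 (\<Delta> a)"
  have D: "?D \<in> carrier (TP 3)" by (rule coproduct_at_carrier[OF coproduct_closed]) simp
  note F = multilinear_casimir[OF g]
  let ?P = "\<lambda>xs v. product_form 3 (casimir_form g) v xs"
  have "contract (?P xs) ?D = casimir_form (\<lambda>x. g (a * x)) xs" if len: "length xs = 3" for xs
  proof (rule homogeneous_eq3[OF _ multilinear_casimir[OF linear_mult_left[OF g]] _ len])
    show "multilinear 3 (\<lambda>xs. contract (?P xs) ?D)"
      by (rule multilinear_contract[OF D]) (rule multilinear_product_right[OF F])
    fix x y z dx dy dz assume x: "x \<in> gr dx" and y: "y \<in> gr dy" and z: "z \<in> gr dz"
    have F': "multilinear 3 (?P [x, y, z])"
      by (rule multilinear_product_left[OF F]) simp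
    let ?c = "t (u * S_inv \<alpha> * y * \<beta> * S z)"
    have "contract (?P [x, y, z]) ?D
        = contract (\<lambda>as. contract (\<lambda>ys. ?P [x, y, z] (as ! 0 # ys)) (\<Delta> (as ! 1))) (\<Delta> a)"
      by (rule contract_coproduct_second[OF coproduct_closed F'])
    also have "\<dots> = contract (\<lambda>as. \<epsilon> (as ! 1) * (?c * g (as ! 0 * x))) (\<Delta> a)"
    proof (rule contract_cong[OF coproduct_closed], erule homogeneous_eq2[OF multilinear_coproduct_second[OF F'], rotated 2])
      show "multilinear 2 (\<lambda>as. \<epsilon> (as ! 1) * (?c * g (as ! 0 * x)))"
        by (rule multilinear2I) (simp_all add: expand g_add g_scale mult_ac)
      fix p q i e assume p: "p \<in> gr i" and q: "q \<in> gr e"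
      let ?h = "\<lambda>v. t (u * S_inv v * y * \<beta> * S z) * g (p * x)"
      have h: "Vector_Spaces.linear scale (*) ?h"
        by (rule functionalI) (simp_all add: expand mult_ac)
      have "contract (\<lambda>ys. ?P [x, y, z] (p # ys)) (\<Delta> q)
          = contract (\<lambda>bs. ksgn (e * dx) * ?h (S (bs ! 0) * \<alpha> * bs ! 1)) (\<Delta> q)"
      proof (rule contract_TP_gr2[OF coproduct_gr[OF q] multilinear_Cons[OF F']])
        show "multilinear 2 (\<lambda>bs. ksgn (e * dx) * ?h (S (bs ! 0) * \<alpha> * bs ! 1))"
          by (rule multilinear2I) (simp_all add: expand mult_ac)
        fix b c j k assume b: "b \<in> gr j" and c: "c \<in> gr k" and e: "j + k = e"
        let ?w = "u * S_inv \<alpha> * b * y * \<beta> * S z"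
        have w: "?w \<in> gr (j + dy + dz)" by (rule grs | rule b y z | simp)+
        have "S_inv (S b * \<alpha> * c) = ksgn (j * k) *s (S_inv c * (S_inv \<alpha> * b))"
          using S_inv_mult[of "S b * \<alpha>" j c k] S_inv_mult[of "S b" j \<alpha> 0]
            antipode_gr[OF b] alpha_even c gr_mult_eq[of "S b" j \<alpha> 0 j] by simp
        then have "?h (S b * \<alpha> * c) = ksgn (j * k) * t (u * S_inv c * S_inv \<alpha> * b * y * \<beta> * S z) * g (p * x)"
          by (simp add: expand mult.assoc)
        also have "u * S_inv c * S_inv \<alpha> * b * y * \<beta> * S z = S c * ?w"
          by (simp only: S_mult_u[of c, symmetric] mult.assoc[symmetric])
        also have "t (S c * ?w) = ksgn (k * (j + dy + dz)) * t (?w * S c)"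
          by (rule trace_cyclic[OF antipode_gr[OF c] w])
        finally have h_eq: "?h (S b * \<alpha> * c) = ksgn (j * k) * (ksgn (k * (j + dy + dz)) * t (?w * S c)) * g (p * x)" .
        have "?P [x, y, z] (p # [b, c]) = ksgn (j * dx) * ksgn (k * dx) * ksgn (k * dy) *
            (ksgn (k * dz) * t (?w * S c) * g (p * x))"
          unfolding product_form_3[OF F p b c x y z]
          by (simp add: casimir_form_def antipode_mult[OF c z] expand mult.assoc)
        also have "\<dots> = ksgn (e * dx) * (ksgn (j * k) * (ksgn (k * (j + dy + dz)) * t (?w * S c)) * g (p * x))"
        proof -
          have "ksgn (j * dx) * ksgn (k * dx) * ksgn (k * dy) * ksgn (k * dz)
              = (ksgn ((j + k) * dx) * ksgn (j * k) * ksgn (k * (j + dy + dz)) :: 'k)"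
            by (cases j; cases k; simp add: ksgn_add distrib_left)
          from arg_cong[OF this, of "\<lambda>s. s * (t (?w * S c) * g (p * x))"] show ?thesis
            unfolding e[symmetric] by (simp only: mult.assoc)
        qed
        finally show "?P [x, y, z] (p # [b, c]) = ksgn (e * dx) * ?h (S ([b, c] ! 0) * \<alpha> * [b, c] ! 1)"
          unfolding h_eq[symmetric] by simp
      qed
      also have "\<dots> = ksgn (e * dx) * (\<epsilon> q * (?c * g (p * x)))"
        unfolding contract_mult_left contract_alpha[OF h] ..
      also have "\<dots> = \<epsilon> q * (?c * g (p * x))"
        \<comment> \<open>The remaining sign is \<open>1\<close> unless \<open>e\<close> is odd, and then \<open>\<epsilon> q\<close> vanishes.\<close>
        using counit_odd[OF q] by (cases "e = 0") auto
      finally show "contract (\<lambda>ys. ?P [x, y, z] ([p, q] ! 0 # ys)) (\<Delta> ([p, q] ! 1))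
          = \<epsilon> ([p, q] ! 1) * (?c * g ([p, q] ! 0 * x))" by simp
    qed
    also have "\<dots> = ?c * g (a * x)"
      by (rule contract_counit_right[of "\<lambda>v. ?c * g (v * x)" a], rule functionalI)
        (simp_all add: expand g_add g_scale mult_ac)
    finally show "contract (?P [x, y, z]) ?D = casimir_form (\<lambda>x. g (a * x)) [x, y, z]"
      by (simp add: casimir_form_def)
  qed
  then show ?thesis
    unfolding contract_mult[OF D X F] contract_swap[of "product_form 3 (casimir_form g)"] by (rule contract_cong[OF X])
qed

text \<open>
  Now the first two legs come from one coproduct, and \<open>S(x) S(b\<^sub>(\<^sub>1\<^sub>)) \<alpha> b\<^sub>(\<^sub>2\<^sub>) y\<close> appears in the trace.
\<close>

lemma casimir_bar_left:
  assumes g: "Vector_Spaces.linear scale (*) g" and X: "X \<in> carrier (TP 3)"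
  shows "contract (casimir_bar_form g) (coproduct_at \<Delta> 3 0 (\<Delta> a) \<otimes>\<^bsub>TP 3\<^esub> X) = contract (casimir_bar_form (\<lambda>x. g (a * x))) X"
proof -
  note g_add = functional_add[OF g] and g_scale = functional_scale[OF g]
  let ?D = "coproduct_at \<Delta> 3 0 (\<Delta> a)"
  have D: "?D \<in> carrier (TP 3)" by (rule coproduct_at_carrier[OF coproduct_closed]) simp
  note F = multilinear_casimir_bar[OF g]
  let ?P = "\<lambda>xs v. product_form 3 (casimir_bar_form g) v xs"
  have "contract (?P xs) ?D = casimir_bar_form (\<lambda>x. g (a * x)) xs" if len: "length xs = 3" for xs
  proof (rule homogeneous_eq3[OF _ multilinear_casimir_bar[OF linear_mult_left[OF g]] _ len])
    show "multilinear 3 (\<lambda>xs. contract (?P xs) ?D)"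
      by (rule multilinear_contract[OF D]) (rule multilinear_product_right[OF F])
    fix x y z dx dy dz assume x: "x \<in> gr dx" and y: "y \<in> gr dy" and z: "z \<in> gr dz"
    have F': "multilinear 3 (?P [x, y, z])"
      by (rule multilinear_product_left[OF F]) simp
    let ?c = "t (u' * S \<beta> * S x * \<alpha> * y)"
    have "contract (?P [x, y, z]) ?D
        = contract (\<lambda>as. contract (\<lambda>ys. ?P [x, y, z] (ys @ [as ! 1])) (\<Delta> (as ! 0))) (\<Delta> a)"
      by (rule contract_coproduct_first[OF coproduct_closed F'])
    also have "\<dots> = contract (\<lambda>as. \<epsilon> (as ! 0) * (?c * g (as ! 1 * z))) (\<Delta> a)"
    proof (rule contract_cong[OF coproduct_closed], erule homogeneous_eq2[OF multilinear_coproduct_first[OF F'], rotated 2])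
      show "multilinear 2 (\<lambda>as. \<epsilon> (as ! 0) * (?c * g (as ! 1 * z)))"
        by (rule multilinear2I) (simp_all add: expand g_add g_scale mult_ac)
      fix p q e i assume p: "p \<in> gr e" and q: "q \<in> gr i"
      let ?h = "\<lambda>v. t (u' * S \<beta> * S x * v * y) * g (q * z)"
      have h: "Vector_Spaces.linear scale (*) ?h"
        by (rule functionalI) (simp_all add: expand mult_ac)
      have "contract (\<lambda>ys. ?P [x, y, z] (ys @ [q])) (\<Delta> p)
          = contract (\<lambda>bs. ksgn (e * dx) * ksgn (i * (dx + dy)) * ?h (S (bs ! 0) * \<alpha> * bs ! 1)) (\<Delta> p)"
      proof (rule contract_TP_gr2[OF coproduct_gr[OF p] multilinear_append1[OF F']])
        show "multilinear 2 (\<lambda>bs. ksgn (e * dx) * ksgn (i * (dx + dy)) * ?h (S (bs ! 0) * \<alpha> * bs ! 1))"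
          by (rule multilinear2I) (simp_all add: expand mult_ac)
        fix b c j k assume b: "b \<in> gr j" and c: "c \<in> gr k" and e: "j + k = e"
        have "ksgn (k * dx) * ksgn (i * dx) * ksgn (i * dy) * ksgn (j * dx)
            = (ksgn ((j + k) * dx) * ksgn (i * (dx + dy)) :: 'k)"
          by (simp add: ksgn_add_mult ksgn_mult_add mult_ac)
        from arg_cong[OF this, of "\<lambda>s. s * ?h (S b * \<alpha> * c)"]
        show "?P [x, y, z] ([b, c] @ [q])
            = ksgn (e * dx) * ksgn (i * (dx + dy)) * ?h (S ([b, c] ! 0) * \<alpha> * [b, c] ! 1)"
          unfolding e[symmetric] using product_form_3[OF F b c q x y z]
          by (simp add: casimir_bar_form_def antipode_mult[OF b x] scale_mult_left scale_mult_right trace_scale mult.assoc)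
      qed
      also have "\<dots> = ksgn (e * dx) * ksgn (i * (dx + dy)) * (\<epsilon> p * (?c * g (q * z)))"
        unfolding contract_mult_left contract_alpha[OF h] ..
      also have "\<dots> = \<epsilon> p * (?c * g (q * z))"
      \<comment> \<open>As before, an odd \<open>e\<close> is killed by the counit and an odd \<open>dx + dy\<close> by the trace.\<close>
      proof (cases "e = 0 \<and> dx + dy = 0")
        case True
        then show ?thesis by simp
      next
        case False
        have "u' * S \<beta> * S x * \<alpha> * y \<in> gr (dx + dy)" by (rule grs | rule x y | simp)+
        then show ?thesis using False counit_odd[OF p] trace_degree by force
      qed
      finally show "contract (\<lambda>ys. ?P [x, y, z] (ys @ [[p, q] ! 1])) (\<Delta> ([p, q] ! 0))
          = \<epsilon> ([p, q] ! 0) * (?c * g ([p, q] ! 1 * z))" by simp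
    qed
    also have "\<dots> = ?c * g (a * z)"
      by (rule contract_counit_left[of "\<lambda>v. ?c * g (v * z)" a], rule functionalI)
        (simp_all add: expand g_add g_scale mult_ac)
    finally show "contract (?P [x, y, z]) ?D = casimir_bar_form (\<lambda>x. g (a * x)) [x, y, z]"
      by (simp add: casimir_bar_form_def)
  qed
  then show ?thesis
    unfolding contract_mult[OF D X F] contract_swap[of "product_form 3 (casimir_bar_form g)"] by (rule contract_cong[OF X])
qed

text \<open>
  Here cyclicity brings \<open>b\<^sub>(\<^sub>2\<^sub>)\<close> in front of \<open>u\<^sup>-\<^sup>1\<close>; it becomes \<open>u\<^sup>-\<^sup>1 S\<^sup>2(b\<^sub>(\<^sub>2\<^sub>))\<close>, and
  \<open>S\<^sup>2(b\<^sub>(\<^sub>2\<^sub>)) S(\<beta>) S(b\<^sub>(\<^sub>1\<^sub>))\<close> is, up to sign, \<open>S\<close> of \<open>b\<^sub>(\<^sub>1\<^sub>) \<beta> S(b\<^sub>(\<^sub>2\<^sub>))\<close>.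
\<close>

lemma casimir_bar_right:
  assumes g: "Vector_Spaces.linear scale (*) g" and X: "X \<in> carrier (TP 3)"
  shows "contract (casimir_bar_form g) (X \<otimes>\<^bsub>TP 3\<^esub> coproduct_at \<Delta> 3 0 (\<Delta> a)) = contract (casimir_bar_form (\<lambda>x. g (x * a))) X"
proof -
  note g_add = functional_add[OF g] and g_scale = functional_scale[OF g]
  let ?D = "coproduct_at \<Delta> 3 0 (\<Delta> a)"
  have D: "?D \<in> carrier (TP 3)" by (rule coproduct_at_carrier[OF coproduct_closed]) simp
  note F = multilinear_casimir_bar[OF g]
  let ?P = "product_form 3 (casimir_bar_form g)"
  have "contract (?P xs) ?D = casimir_bar_form (\<lambda>x. g (x * a)) xs" if len: "length xs = 3" for xs
  proof (rule homogeneous_eq3[OF multilinear_contract_product_left[OF F D] multilinear_casimir_bar[OF linear_mult_right[OF g]] _ len])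
    fix x y z dx dy dz assume x: "x \<in> gr dx" and y: "y \<in> gr dy" and z: "z \<in> gr dz"
    have F': "multilinear 3 (?P [x, y, z])"
      by (rule multilinear_product_right[OF F]) simp
    let ?c = "t (u' * S \<beta> * S x * \<alpha> * y)"
    have "contract (?P [x, y, z]) ?D
        = contract (\<lambda>as. contract (\<lambda>ys. ?P [x, y, z] (ys @ [as ! 1])) (\<Delta> (as ! 0))) (\<Delta> a)"
      by (rule contract_coproduct_first[OF coproduct_closed F'])
    also have "\<dots> = contract (\<lambda>as. \<epsilon> (as ! 0) * (?c * g (z * as ! 1))) (\<Delta> a)"
    proof (rule contract_cong[OF coproduct_closed], erule homogeneous_eq2[OF multilinear_coproduct_first[OF F'], rotated 2])
      show "multilinear 2 (\<lambda>as. \<epsilon> (as ! 0) * (?c * g (z * as ! 1)))"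
        by (rule multilinear2I) (simp_all add: expand g_add g_scale mult_ac)
      fix p q e i assume p: "p \<in> gr e" and q: "q \<in> gr i"
      let ?h = "\<lambda>v. t (u' * S v * S x * \<alpha> * y) * g (z * q)"
      have h: "Vector_Spaces.linear scale (*) ?h"
        by (rule functionalI) (simp_all add: expand mult_ac)
      have "contract (\<lambda>ys. ?P [x, y, z] (ys @ [q])) (\<Delta> p)
          = contract (\<lambda>bs. ksgn (e * (dx + dy + dz)) * ?h (bs ! 0 * \<beta> * S (bs ! 1))) (\<Delta> p)"
      proof (rule contract_TP_gr2[OF coproduct_gr[OF p] multilinear_append1[OF F']])
        show "multilinear 2 (\<lambda>bs. ksgn (e * (dx + dy + dz)) * ?h (bs ! 0 * \<beta> * S (bs ! 1)))"
          by (rule multilinear2I) (simp_all add: expand mult_ac)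
        fix b c j k assume b: "b \<in> gr j" and c: "c \<in> gr k" and e: "j + k = e"
        let ?w = "u' * S \<beta> * S b * S x * \<alpha> * y"
        have w: "?w \<in> gr (j + dx + dy)" by (rule grs | rule b x y | simp)+
        have "S (b * \<beta> * S c) = ksgn (j * k) *s (S (S c) * (S \<beta> * S b))"
          using antipode_mult[of "b * \<beta>" j "S c" k] antipode_mult[OF b beta_even]
            antipode_gr[OF c] gr_mult_eq[OF b beta_even, of j] by simp
        then have "?h (b * \<beta> * S c) = ksgn (j * k) * t (u' * S (S c) * S \<beta> * S b * S x * \<alpha> * y) * g (z * q)"
          by (simp add: scale_mult_left scale_mult_right trace_scale mult.assoc)
        also have "u' * S (S c) * S \<beta> * S b * S x * \<alpha> * y = c * ?w"
          by (simp only: mult_u'[symmetric] mult.assoc[symmetric])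
        also have "t (c * ?w) = ksgn (k * (j + dx + dy)) * t (?w * c)"
          by (rule trace_cyclic[OF c w])
        finally have h_eq: "?h (b * \<beta> * S c) = ksgn (j * k) * (ksgn (k * (j + dx + dy)) * t (?w * c)) * g (z * q)" .
        have "?P [x, y, z] ([b, c] @ [q]) = ksgn (dy * j) * ksgn (dz * j) * ksgn (dz * k) *
            (ksgn (dx * j) * t (?w * c) * g (z * q))"
          using product_form_3[OF F x y z b c q]
          by (simp add: casimir_bar_form_def antipode_mult[OF x b] scale_mult_left scale_mult_right trace_scale mult.assoc)
        also have "\<dots> = ksgn (e * (dx + dy + dz)) * (ksgn (j * k) * (ksgn (k * (j + dx + dy)) * t (?w * c)) * g (z * q))"
        proof -
          have "ksgn (dy * j) * ksgn (dz * j) * ksgn (dz * k) * ksgn (dx * j)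
              = (ksgn ((j + k) * (dx + dy + dz)) * ksgn (j * k) * ksgn (k * (j + dx + dy)) :: 'k)"
            by (cases j; cases k; cases dx; cases dy; cases dz; simp add: ksgn_def)
          from arg_cong[OF this, of "\<lambda>s. s * (t (?w * c) * g (z * q))"] show ?thesis
            unfolding e[symmetric] by (simp only: mult.assoc)
        qed
        finally show "?P [x, y, z] ([b, c] @ [q]) = ksgn (e * (dx + dy + dz)) * ?h ([b, c] ! 0 * \<beta> * S ([b, c] ! 1))"
          unfolding h_eq[symmetric] by simp
      qed
      also have "\<dots> = ksgn (e * (dx + dy + dz)) * (\<epsilon> p * (?c * g (z * q)))"
        unfolding contract_mult_left contract_beta[OF h] ..
      also have "\<dots> = \<epsilon> p * (?c * g (z * q))"
        \<comment> \<open>Again the sign matters only for odd \<open>e\<close>, where \<open>\<epsilon> p\<close> vanishes.\<close>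
        using counit_odd[OF p] by (cases "e = 0") auto
      finally show "contract (\<lambda>ys. ?P [x, y, z] (ys @ [[p, q] ! 1])) (\<Delta> ([p, q] ! 0))
          = \<epsilon> ([p, q] ! 0) * (?c * g (z * [p, q] ! 1))" by simp
    qed
    also have "\<dots> = ?c * g (z * a)"
      by (rule contract_counit_left[of "\<lambda>v. ?c * g (z * v)" a], rule functionalI)
        (simp_all add: expand g_add g_scale mult_ac)
    finally show "contract (?P [x, y, z]) ?D = casimir_bar_form (\<lambda>x. g (x * a)) [x, y, z]"
      by (simp add: casimir_bar_form_def)
  qed
  then show ?thesis
    unfolding contract_mult[OF X D F] by (rule contract_cong[OF X])
qed

lemma casimir_central: "central (casimir t u m)"
  unfolding central_def
proof (intro allI functional_separates)
  fix a g assume g: "Vector_Spaces.linear scale (*) g"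
  show "g (casimir t u m * a) = g (a * casimir t u m)"
    unfolding casimir_contract[OF linear_mult_left[OF g]] casimir_contract[OF linear_mult_right[OF g]]
      casimir_left[OF g casimir_tensor_carrier, symmetric] casimir_right[OF g casimir_tensor_carrier, symmetric]
      casimir_tensor_commutes ..
qed

lemma casimir_bar_central: "central (casimir_bar t u' m)"
  unfolding central_def
proof (intro allI functional_separates)
  fix a g assume g: "Vector_Spaces.linear scale (*) g"
  show "g (casimir_bar t u' m * a) = g (a * casimir_bar t u' m)"
    unfolding casimir_bar_contract[OF linear_mult_left[OF g]] casimir_bar_contract[OF linear_mult_right[OF g]]
      casimir_bar_left[OF g casimir_bar_tensor_carrier, symmetric]
      casimir_bar_right[OF g casimir_bar_tensor_carrier, symmetric]
      casimir_bar_tensor_commutes ..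
qed

end

theorem corollary4:
  fixes scale :: "'k::field \<Rightarrow> 'a::ring_1 \<Rightarrow> 'a"
    and gr :: "bit \<Rightarrow> 'a set"
    and \<Delta> :: "'a \<Rightarrow> ('a, 'k) tensor"
    and \<epsilon> :: "'a \<Rightarrow> 'k"
    and \<Phi> R :: "('a, 'k) tensor"
    and S :: "'a \<Rightarrow> 'a"
    and \<alpha> \<beta> u u' :: 'a
    and scaleV :: "'k \<Rightarrow> 'v::ab_group_add \<Rightarrow> 'v"
    and grV :: "bit \<Rightarrow> 'v set"
    and act :: "'a \<Rightarrow> 'v \<Rightarrow> 'v"
    and m :: int
  assumes "quasi_triangular_quasi_hopf_superalgebra scale gr \<Delta> \<epsilon> \<Phi> S \<alpha> \<beta> R"
    and "u \<in> gr 0"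
    and "u * u' = 1" and "u' * u = 1"
    and "\<And>a. S (S a) = u * a * u'"
    and "graded_module scale gr scaleV grV act"
    and "\<exists>B. finite_dimensional_vector_space scaleV B"
  shows "central (quasi_triangular_quasi_hopf_superalgebra.casimir scale gr \<Phi> S \<alpha> \<beta> R (\<lambda>a. superspace.supertrace scaleV grV (act a)) u m)
       \<and> central (quasi_triangular_quasi_hopf_superalgebra.casimir_bar scale gr \<Phi> S \<alpha> \<beta> R (\<lambda>a. superspace.supertrace scaleV grV (act a)) u' m)"
proof -
  interpret H: quasi_triangular_quasi_hopf_superalgebra scale gr \<Delta> \<epsilon> \<Phi> S \<alpha> \<beta> R by fact
  interpret V: graded_module scale gr scaleV grV act by fact
  interpret T: traced_quasi_triangular scale gr \<Delta> \<epsilon> \<Phi> S \<alpha> \<beta> R "\<lambda>a. superspace.supertrace scaleV grV (act a)" u u'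
    using V.str_add[OF assms(7)] V.str_scale[OF assms(7)] V.str_odd[OF assms(7)] V.str_cyclic[OF assms(7)] assms(2-5)
    by unfold_locales
  show ?thesis using T.casimir_central T.casimir_bar_central by blast
qed

end
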